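(* There exist an absolute constant $C>0$ and a deterministic algorithm which, given a tree $T=(V,E)$ on $n$ vertices together with a cost function $c:E\to\mathbb{Q}_{\ge 0}$, runs in time polynomial in $n$ and outputs a decision tree $D$ for $(T,c)$ with $\mathit{cost}(D)\le C\cdot\frac{\log n}{\log\log n}\cdot \mathit{OPT}(T,c)$ (for all $n$ large enough that $\log\log n>0$). That is, the Tree Search Problem with non-uniform costs admits a polynomial-time $O(\log n/\log\log n)$-approximation algorithm.
   Context: Tree Search Problem with non-uniform costs: given a tree $T=(V,E)$ and nonnegative rational edge costs $c$, one wants to identify an unknown vertex $x\in V$ using edge queries; querying $e=\{u,v\}$ costs $c(e)$ and reveals which of the two components $T_u\ni u$, $T_v\ni v$ of $T-e$ contains $x$. A decision tree for $(T,c)$ is a rooted binary tree with exactly $|V|$ leaves, each leaf labelled by a distinct vertex of $T$ and each internal node labelled by an edge $e=\{u,v\}$ of $T$, its two children corresponding to the answers "$x\in T_u$" and "$x\in T_v$", such that for every $x\in V$, starting at the root and always following the child consistent with $x$, one reaches the leaf labelled $x$. For $x\in V$, $\mathit{cost}^D(x)$ is the sum of the costs of the edges labelling the internal nodes on the root-to-leaf path ending at the leaf labelled $x$; $\mathit{cost}(D)=\max_{x\in V}\mathit{cost}^D(x)$; and $\mathit{OPT}(T,c)=\min_D \mathit{cost}(D)$ over all decision trees $D$ for $(T,c)$. Logarithms are base 2. *)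

theory Defs
  imports Complex_Main "HOL-Computational_Algebra.Polynomial"
begin

section \<open>Trees\<close>

text \<open>A simple graph is a vertex set together with a set of two-element vertex sets.\<close>

definition simple_graph :: "'a set \<Rightarrow> 'a set set \<Rightarrow> bool" where
  "simple_graph V E \<longleftrightarrow> finite V \<and> (\<forall>e\<in>E. e \<subseteq> V \<and> card e = 2)"

definition adj :: "'a set set \<Rightarrow> ('a \<times> 'a) set" where
  "adj E = {(x, y). {x, y} \<in> E}"

definition connected_graph :: "'a set \<Rightarrow> 'a set set \<Rightarrow> bool" where
  "connected_graph V E \<longleftrightarrow> V \<noteq> {} \<and> (\<forall>x\<in>V. \<forall>y\<in>V. (x, y) \<in> (adj E)\<^sup>*)"

definition is_cycle :: "'a set set \<Rightarrow> 'a list \<Rightarrow> bool" where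
  "is_cycle E xs \<longleftrightarrow> length xs \<ge> 3 \<and> distinct xs \<and>
     (\<forall>i < length xs. {xs ! i, xs ! (Suc i mod length xs)} \<in> E)"

definition is_tree :: "'a set \<Rightarrow> 'a set set \<Rightarrow> bool" where
  "is_tree V E \<longleftrightarrow> simple_graph V E \<and> connected_graph V E \<and> (\<nexists>xs. is_cycle E xs)"

text \<open>The vertex set of the component of \<open>T - e\<close> that contains \<open>u\<close>.\<close>

definition side :: "'a set set \<Rightarrow> 'a set \<Rightarrow> 'a \<Rightarrow> 'a set" where
  "side E e u = {x. (u, x) \<in> (adj (E - {e}))\<^sup>*}"

section \<open>Decision trees\<close>

text \<open>
  \<open>Node u v l r\<close> is an internal node labelled by the edge \<open>{u, v}\<close>. The order of the two
  endpoints only records which child belongs to which answer: \<open>l\<close> is the child for the answer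
  \<open>x \<in> T\<^sub>u\<close> and \<open>r\<close> is the child for the answer \<open>x \<in> T\<^sub>v\<close>.
\<close>

datatype 'a dtree = Leaf 'a | Node 'a 'a "'a dtree" "'a dtree"

fun leaves :: "'a dtree \<Rightarrow> 'a list" where
  "leaves (Leaf x) = [x]"
| "leaves (Node u v l r) = leaves l @ leaves r"

fun node_labels :: "'a dtree \<Rightarrow> ('a \<times> 'a) set" where
  "node_labels (Leaf x) = {}"
| "node_labels (Node u v l r) = insert (u, v) (node_labels l \<union> node_labels r)"

text \<open>The label of the leaf reached when the unknown vertex is \<open>x\<close>.\<close>

fun search :: "'a set set \<Rightarrow> 'a dtree \<Rightarrow> 'a \<Rightarrow> 'a" where
  "search E (Leaf y) x = y"
| "search E (Node u v l r) x =
     (if x \<in> side E {u, v} u then search E l x else search E r x)"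

definition decision_tree :: "'a set \<Rightarrow> 'a set set \<Rightarrow> 'a dtree \<Rightarrow> bool" where
  "decision_tree V E D \<longleftrightarrow>
     length (leaves D) = card V \<and> distinct (leaves D) \<and> set (leaves D) \<subseteq> V \<and>
     (\<forall>(u, v) \<in> node_labels D. {u, v} \<in> E) \<and>
     (\<forall>x\<in>V. search E D x = x)"

text \<open>
  The cost of the path from the root to the leaf labelled \<open>x\<close>. It is meaningful when \<open>x\<close>
  labels exactly one leaf, as is the case for the vertices in a decision tree.
\<close>

fun leaf_cost :: "('a set \<Rightarrow> rat) \<Rightarrow> 'a dtree \<Rightarrow> 'a \<Rightarrow> rat" where
  "leaf_cost c (Leaf y) x = 0"
| "leaf_cost c (Node u v l r) x =
     c {u, v} + (if x \<in> set (leaves l) then leaf_cost c l x else leaf_cost c r x)"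

definition cost :: "'a set \<Rightarrow> ('a set \<Rightarrow> rat) \<Rightarrow> 'a dtree \<Rightarrow> rat" where
  "cost V c D = Max (leaf_cost c D ` V)"

definition OPT :: "'a set \<Rightarrow> 'a set set \<Rightarrow> ('a set \<Rightarrow> rat) \<Rightarrow> rat" where
  "OPT V E c = Min (cost V c ` {D. decision_tree V E D})"

text \<open>The minimum in \<^const>\<open>OPT\<close> ranges over a finite set.\<close>

lemma finite_bounded_dtrees:
  assumes "finite V" and "finite L"
  shows "finite {D. set (leaves D) \<subseteq> V \<and> node_labels D \<subseteq> L \<and> length (leaves D) \<le> k}"
    (is "finite (?S k)")
proof (induction k)
  case 0
  have "length (leaves D) > 0" for D :: "'a dtree"
    by (induction D) auto
  then have "?S 0 = {}" by auto
  then show ?case by (simp only: finite.emptyI)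
next
  case (Suc k)
  let ?f = "\<lambda>((u, v), l, r). Node u v l r"
  have pos: "length (leaves D) > 0" for D :: "'a dtree"
    by (induction D) auto
  have "?S (Suc k) \<subseteq> Leaf ` V \<union> ?f ` (L \<times> ?S k \<times> ?S k)"
  proof
    fix D assume D: "D \<in> ?S (Suc k)"
    show "D \<in> Leaf ` V \<union> ?f ` (L \<times> ?S k \<times> ?S k)"
    proof (cases D)
      case (Leaf x)
      then show ?thesis using D by auto
    next
      case (Node u v l r)
      have "l \<in> ?S k" "r \<in> ?S k" "(u, v) \<in> L"
        using D Node pos[of l] pos[of r] by (auto simp del: length_greater_0_conv)
      then have "((u, v), l, r) \<in> L \<times> ?S k \<times> ?S k" by blast
      then have "?f ((u, v), l, r) \<in> ?f ` (L \<times> ?S k \<times> ?S k)" by (rule imageI)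
      then show ?thesis using Node by simp
    qed
  qed
  moreover have "finite (Leaf ` V \<union> ?f ` (L \<times> ?S k \<times> ?S k))"
    using Suc assms by blast
  ultimately show ?case by (rule finite_subset)
qed

lemma finite_decision_trees:
  assumes "simple_graph V E"
  shows "finite {D. decision_tree V E D}"
proof (rule finite_subset)
  have V: "finite V" using assms by (simp add: simple_graph_def)
  show "finite {D. set (leaves D) \<subseteq> V \<and> node_labels D \<subseteq> V \<times> V \<and> length (leaves D) \<le> card V}"
    by (rule finite_bounded_dtrees) (use V in auto)
  show "{D. decision_tree V E D} \<subseteq>
    {D. set (leaves D) \<subseteq> V \<and> node_labels D \<subseteq> V \<times> V \<and> length (leaves D) \<le> card V}"
    using assms by (fastforce simp: decision_tree_def simple_graph_def)
qed

section \<open>Algorithms\<close>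

text \<open>
  Algorithms are programs of a small first-order, call-by-value, Lisp-like language. Data are
  binary trees (S-expressions) whose atoms are rational numbers or the constant \<open>VNil\<close>; a program
  is a finite list of mutually recursive functions. The running time is the number of evaluation
  steps: every language construct costs one unit.

  Arithmetic is deliberately restricted to addition, subtraction and comparison. Intermediate
  numbers are thus integer combinations of the input numbers and the constants of the program
  whose coefficients have at most linearly many bits in the running time; and data structures
  are only built and inspected one cell at a time. Hence unit-cost polynomial time is
  polynomial time on a Turing machine as well.
\<close>

datatype val = VNil | VNum rat | VPair val val

datatype prim = Cons_op | Fst_op | Snd_op | IsPair_op | Add_op | Sub_op | Less_op | Eq_op

text \<open>
  \<open>VNil\<close> is false and every other value is true. Ill-typed applications evaluate to \<open>VNil\<close>.
  \<open>Less_op\<close> and \<open>Eq_op\<close> compare numbers only.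
\<close>

fun bool_val :: "bool \<Rightarrow> val" where
  "bool_val b = (if b then VNum 1 else VNil)"

fun apply_prim :: "prim \<Rightarrow> val list \<Rightarrow> val" where
  "apply_prim Cons_op [x, y] = VPair x y"
| "apply_prim Fst_op [VPair x y] = x"
| "apply_prim Snd_op [VPair x y] = y"
| "apply_prim IsPair_op [VPair x y] = bool_val True"
| "apply_prim Add_op [VNum a, VNum b] = VNum (a + b)"
| "apply_prim Sub_op [VNum a, VNum b] = VNum (a - b)"
| "apply_prim Less_op [VNum a, VNum b] = bool_val (a < b)"
| "apply_prim Eq_op [VNum a, VNum b] = bool_val (a = b)"
| "apply_prim _ _ = VNil"

text \<open>
  Variables are de Bruijn indices into the environment: in the body of a function, they first
  address the variables bound by enclosing \<open>Let\<close>s (innermost first) and then the arguments.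
\<close>

datatype exp =
    Var nat
  | Lit rat
  | NilE
  | Prim prim "exp list"
  | If exp exp exp
  | Let exp exp
  | Call nat "exp list"

type_synonym prog = "exp list"

text \<open>\<open>eval P env e v t\<close>: in program \<open>P\<close>, the expression \<open>e\<close> evaluates to \<open>v\<close> in \<open>t\<close> steps.\<close>

inductive eval :: "prog \<Rightarrow> val list \<Rightarrow> exp \<Rightarrow> val \<Rightarrow> nat \<Rightarrow> bool"
  and evals :: "prog \<Rightarrow> val list \<Rightarrow> exp list \<Rightarrow> val list \<Rightarrow> nat \<Rightarrow> bool"
  for P :: prog
where
  eval_Var: "i < length env \<Longrightarrow> eval P env (Var i) (env ! i) 1"
| eval_Lit: "eval P env (Lit q) (VNum q) 1"
| eval_Nil: "eval P env NilE VNil 1"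
| eval_Prim: "evals P env es vs t \<Longrightarrow> eval P env (Prim f es) (apply_prim f vs) (1 + t)"
| eval_If_true: "eval P env b w s \<Longrightarrow> w \<noteq> VNil \<Longrightarrow> eval P env e1 v t \<Longrightarrow>
    eval P env (If b e1 e2) v (1 + s + t)"
| eval_If_false: "eval P env b VNil s \<Longrightarrow> eval P env e2 v t \<Longrightarrow>
    eval P env (If b e1 e2) v (1 + s + t)"
| eval_Let: "eval P env e1 w s \<Longrightarrow> eval P (w # env) e2 v t \<Longrightarrow>
    eval P env (Let e1 e2) v (1 + s + t)"
| eval_Call: "evals P env es vs s \<Longrightarrow> i < length P \<Longrightarrow> eval P vs (P ! i) v t \<Longrightarrow>
    eval P env (Call i es) v (1 + s + t)"
| evals_Nil: "evals P env [] [] 0"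
| evals_Cons: "eval P env e v s \<Longrightarrow> evals P env es vs t \<Longrightarrow>
    evals P env (e # es) (v # vs) (s + t)"

text \<open>The result and the running time of a program are determined by its input.\<close>

lemma eval_deterministic:
  "eval P env e v t \<Longrightarrow> eval P env e v' t' \<Longrightarrow> v' = v \<and> t' = t"
  "evals P env es vs t \<Longrightarrow> evals P env es vs' t' \<Longrightarrow> vs' = vs \<and> t' = t"
proof (induction arbitrary: v' t' and vs' t' rule: eval_evals.inducts)
  case (eval_Var i env)
  then show ?case by (auto elim: eval.cases)
next
  case (eval_Lit env q)
  then show ?case by (auto elim: eval.cases)
next
  case (eval_Nil env)
  then show ?case by (auto elim: eval.cases)
next
  case (eval_Prim env es vs t f)
  from eval_Prim.prems show ?case
    by (cases rule: eval.cases) (use eval_Prim in blast)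
next
  case (eval_If_true env b w s e1 v t e2)
  from eval_If_true.prems show ?case
    by (cases rule: eval.cases) (use eval_If_true in blast)+
next
  case (eval_If_false env b s e2 v t e1)
  from eval_If_false.prems show ?case
    by (cases rule: eval.cases) (use eval_If_false in blast)+
next
  case (eval_Let env e1 w s e2 v t)
  from eval_Let.prems show ?case
    by (cases rule: eval.cases) (use eval_Let in blast)
next
  case (eval_Call env es vs s i v t)
  from eval_Call.prems show ?case
    by (cases rule: eval.cases) (use eval_Call in blast)
next
  case (evals_Nil env)
  then show ?case by (auto elim: evals.cases)
next
  case (evals_Cons env e v s es vs t)
  from evals_Cons.prems show ?case
    by (cases rule: evals.cases) (use evals_Cons in blast)
qed

text \<open>The function with index 0 is the main function of a program.\<close>

definition runs :: "prog \<Rightarrow> val \<Rightarrow> val \<Rightarrow> nat \<Rightarrow> bool" where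
  "runs P inp out t \<longleftrightarrow> eval P [inp] (Call 0 [Var 0]) out t"

section \<open>Input and output representation\<close>

fun enc_list :: "('a \<Rightarrow> val) \<Rightarrow> 'a list \<Rightarrow> val" where
  "enc_list f [] = VNil"
| "enc_list f (x # xs) = VPair (f x) (enc_list f xs)"

definition enc_nat :: "nat \<Rightarrow> val" where
  "enc_nat n = VNum (of_nat n)"

definition enc_edge :: "(nat set \<Rightarrow> rat) \<Rightarrow> nat \<times> nat \<Rightarrow> val" where
  "enc_edge c = (\<lambda>(u, v). VPair (enc_nat u) (VPair (enc_nat v) (VNum (c {u, v}))))"

definition enc_instance :: "(nat set \<Rightarrow> rat) \<Rightarrow> nat list \<Rightarrow> (nat \<times> nat) list \<Rightarrow> val" where
  "enc_instance c vs es = VPair (enc_list enc_nat vs) (enc_list (enc_edge c) es)"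

text \<open>
  The lists \<open>vs\<close> and \<open>es\<close> enumerate the vertices and the edges without repetition, in any order
  and with any order of the two endpoints of an edge.
\<close>

definition enumerates :: "'a list \<Rightarrow> ('a \<times> 'a) list \<Rightarrow> 'a set \<Rightarrow> 'a set set \<Rightarrow> bool" where
  "enumerates vs es V E \<longleftrightarrow>
     distinct vs \<and> set vs = V \<and>
     distinct (map (\<lambda>(u, v). {u, v}) es) \<and> set (map (\<lambda>(u, v). {u, v}) es) = E"

fun enc_dtree :: "nat dtree \<Rightarrow> val" where
  "enc_dtree (Leaf x) = enc_nat x"
| "enc_dtree (Node u v l r) =
     VPair (VPair (enc_nat u) (enc_nat v)) (VPair (enc_dtree l) (enc_dtree r))"

end

(*
  Let D v be the set of descendants of a vertex v in the tree rooted at some vertex r. In one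
  phase, let X be the set of candidates, m = |X| div t + 1 with t of order sqrt (log n), and
  f v = |X \<inter> D v| div m. The set S of the vertices v such that f w < f v for all proper
  descendants w of v is closed under branching, has at most 2 t elements, and every component of
  T - S contains fewer than m candidates. Since S is that small, an optimal strategy for telling
  the elements of S apart can be found by brute force: among the edges that split S in the same
  way only a cheapest one matters, which leaves at most |S| edges. This strategy costs at most OPT.
  Afterwards only one s in S is possible, and querying all edges at s also costs at most OPT,
  because every decision tree queries all of them on its path to s. Hence a phase costs at most
  2 OPT and divides the number of candidates by t, so that there are O(log n / log t) =
  O(log n / log log n) phases. The brute force search takes (8 t + 4)^(2 t) = n^O(1) steps.

  Neither X nor S has to be connected: all components are measured in the whole tree, and a query
  whose answer is already known is dropped from the decision tree.
*)

theory Submission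
  imports Defs
begin

section \<open>The algorithm\<close>

text \<open>The quotients \<open>f\<close> grow towards the root and are superadditive over disjoint
  subtrees. Where \<open>f\<close> stays constant along a path, fewer than \<open>m\<close>
  candidates branch off; where it grows above a vertex of positive value, the parent lies in
  \<open>S\<close>. So \<open>S\<close> can stay small although it leaves only small components.
  Since the candidates may be scattered, the tree is rooted only once, and connectivity is replaced
  by the invariant \<open>cut_off\<close>: every separator already excluded is split off from the
  remaining vertices by some descendant set. Both bounds of a phase are compared with one fixed
  optimal decision tree of the whole tree, so no optimum of a subproblem ever enters. With
  \<open>t\<close> of order sqrt (log n), the crude estimate t < 2^t already bounds the brute force
  by 2^O(t^2) = n^O(1), while log t is still of order log log n; such a \<open>t\<close> can be
  found by counting doublings. The recursion stays polynomial because the calls of one phase receive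
  disjoint candidate lists, so that all work can be charged linearly to the candidates.\<close>

text \<open>A vertex, its parent, the cost of the edge between them, and the list of its descendants.
  The root is its own parent, at cost 0.\<close>

datatype node = Nd (nv: nat) (np: nat) (nc: rat) (nd: "nat list")

text \<open>\<open>fv\<close> is the function \<open>f\<close> above, \<open>seps N X m N\<close> enumerates \<open>S\<close>, and \<open>best X m s N s\<close> is a
  cheapest edge among those that split \<open>S\<close> like the edge above \<open>s\<close>.\<close>

definition fv :: "nat list \<Rightarrow> nat \<Rightarrow> node \<Rightarrow> nat" where
  "fv X m e = length (filter (\<lambda>x. x \<in> set (nd e)) X) div m"

definition seps :: "node list \<Rightarrow> nat list \<Rightarrow> nat \<Rightarrow> node list \<Rightarrow> node list" where
  "seps N X m L = filter (\<lambda>e. 0 < fv X m e \<and>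
     (\<forall>e'\<in>set N. nv e' \<in> set (nd e) \<longrightarrow> nv e' = nv e \<or> fv X m e' < fv X m e)) L"

fun best :: "nat list \<Rightarrow> nat \<Rightarrow> node \<Rightarrow> node list \<Rightarrow> node \<Rightarrow> node" where
  "best X m s [] b = b"
| "best X m s (e # L) b = best X m s L
     (if nv s \<in> set (nd e) \<and> fv X m e = fv X m s \<and> nc e < nc b then e else b)"

text \<open>The worst-case cost is stored in each node, so that comparing two strategies takes
  constant time.\<close>

datatype strat = PLeaf | PNode rat node strat strat

fun pcost :: "strat \<Rightarrow> rat" where
  "pcost PLeaf = 0"
| "pcost (PNode w e p q) = w"

abbreviation inner :: "node \<Rightarrow> nat list \<Rightarrow> nat list" where
  "inner e X \<equiv> filter (\<lambda>x. x \<in> set (nd e)) X"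

abbreviation outer :: "node \<Rightarrow> nat list \<Rightarrow> nat list" where
  "outer e X \<equiv> filter (\<lambda>x. x \<notin> set (nd e)) X"

lemma length_inner_outer: "length (inner e X) + length (outer e X) = length X"
  by (rule sum_length_filter_compl)

text \<open>Exhaustive search: \<open>K\<close> holds the edges still to be tried for
  \<open>A\<close>, and both recursive calls restart with the full list \<open>K0\<close>. A result
  \<open>PLeaf\<close> for the rest of the list means that no edge there splits \<open>A\<close>;
  its cost 0 must then not win the comparison.\<close>

function plan :: "node list \<Rightarrow> nat list \<Rightarrow> node list \<Rightarrow> strat" where
  "plan K0 A [] = PLeaf"
| "plan K0 A (e # K) =
     (let r = plan K0 A K in
      if inner e A = [] \<or> outer e A = [] then r
      else let p = plan K0 (inner e A) K0; q = plan K0 (outer e A) K0;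
               w = nc e + max (pcost p) (pcost q)
           in if r = PLeaf \<or> w < pcost r then PNode w e p q else r)"
  by pat_completeness auto
termination
proof (relation "measures [\<lambda>(K0, A, K). length A, \<lambda>(K0, A, K). length K]", goal_cases)
  case (3 K0 A e K)
  then have "length (outer e A) \<noteq> 0" by simp
  then have "length (inner e A) < length A" using length_inner_outer[of e A] by linarith
  then show ?case by simp
next
  case (4 K0 A e K)
  then have "length (inner e A) \<noteq> 0" by simp
  then have "length (outer e A) < length A" using length_inner_outer[of e A] by linarith
  then show ?case by simp
qed auto

text \<open>\<open>None\<close> stands for an empty set of candidates, so a query with only one
  possible answer leaves no node behind.\<close>

fun mk :: "node \<Rightarrow> nat dtree option \<Rightarrow> nat dtree option \<Rightarrow> nat dtree option" where
  "mk e None r = r"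
| "mk e (Some l) None = Some l"
| "mk e (Some l) (Some r) = Some (Node (nv e) (np e) l r)"

text \<open>\<open>nv e = s\<close> selects the edge above \<open>s\<close>, \<open>np e = s\<close>
  the edges below it. If \<open>s\<close> is the root, its own record passes both tests; the first
  one applies, and its outer part is empty.\<close>

fun star :: "(nat list \<Rightarrow> nat dtree option) \<Rightarrow> nat \<Rightarrow> node list \<Rightarrow> nat list \<Rightarrow> nat dtree option" where
  "star F s [] X = (case X of [] \<Rightarrow> None | x # _ \<Rightarrow> Some (Leaf x))"
| "star F s (e # L) X =
     (if nv e = s then mk e (star F s L (inner e X)) (F (outer e X))
      else if np e = s then mk e (F (inner e X)) (star F s L (outer e X))
      else star F s L X)"

text \<open>The strategy is planned for the separators alone. They are routed through the queries
  together with the candidates, so that \<open>A\<close> tells at a leaf which separator is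
  left.\<close>

fun expand :: "(nat list \<Rightarrow> nat dtree option) \<Rightarrow> node list \<Rightarrow> nat list \<Rightarrow> strat \<Rightarrow> nat list \<Rightarrow> nat dtree option" where
  "expand F N A PLeaf X = (case A of [] \<Rightarrow> None | s # _ \<Rightarrow> star F s N X)"
| "expand F N A (PNode w e p q) X =
     mk e (expand F N (inner e A) p (inner e X)) (expand F N (outer e A) q (outer e X))"

text \<open>Here and in \<open>build\<close> and \<open>tloop\<close>, the list \<open>k\<close> is a unary counter that bounds the recursion.\<close>

fun solve :: "nat \<Rightarrow> node list \<Rightarrow> 'k list \<Rightarrow> nat list \<Rightarrow> nat dtree option" where
  "solve t N [] X = None"
| "solve t N (_ # k) X =
     (if X = [] then None
      else let m = length X div t + 1; S = seps N X m N;
               K = map (\<lambda>s. best X m s N s) S; A = map nv S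
           in expand (solve t N k) N A (plan K A K) X)"

fun find_edge :: "(nat set \<Rightarrow> rat) \<Rightarrow> (nat \<times> nat) list \<Rightarrow> nat list \<Rightarrow> node option" where
  "find_edge c [] vis = None"
| "find_edge c ((u, v) # es) vis =
     (if u \<in> set vis then
        if v \<in> set vis then find_edge c es vis else Some (Nd v u (c {u, v}) [v])
      else if v \<in> set vis then Some (Nd u v (c {u, v}) [u]) else find_edge c es vis)"

text \<open>The records changed are those of the ancestors of the new leaf
  \<open>nv e\<close>.\<close>

definition upd :: "node list \<Rightarrow> node \<Rightarrow> node list" where
  "upd N e = map (\<lambda>a. if np e \<in> set (nd a) then Nd (nv a) (np a) (nc a) (nv e # nd a) else a) N"

fun build :: "(nat set \<Rightarrow> rat) \<Rightarrow> (nat \<times> nat) list \<Rightarrow> 'k list \<Rightarrow> node list \<Rightarrow> node list" where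
  "build c es [] N = N"
| "build c es (_ # k) N =
     (case find_edge c es (map nv N) of None \<Rightarrow> N | Some e \<Rightarrow> build c es k (e # upd N e))"

text \<open>The power \<open>p\<close> of 2 doubles until it exceeds \<open>n\<close>, and \<open>j\<close> counts the doublings left until \<open>r\<close> is
  increased. As \<open>r\<close> stays the same for \<open>r + 1\<close> steps, the result is about \<open>sqrt (2 * log 2 n)\<close>.\<close>

fun tloop :: "nat \<Rightarrow> 'k list \<Rightarrow> nat \<Rightarrow> nat \<Rightarrow> nat \<Rightarrow> nat" where
  "tloop n [] p j r = r"
| "tloop n (_ # k) p j r =
     (if n < p then r
      else if j = 0 then tloop n k (p + p) (Suc r) (Suc r)
      else tloop n k (p + p) (j - 1) r)"

text \<open>Besides being the initial candidate list, \<open>vs\<close> serves as the unary counter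
  of \<open>build\<close>, \<open>tloop\<close> and \<open>solve\<close>. The summand 2 ensures that
  every phase shrinks the candidate set.\<close>

definition algo :: "(nat set \<Rightarrow> rat) \<Rightarrow> nat list \<Rightarrow> (nat \<times> nat) list \<Rightarrow> nat dtree option" where
  "algo c vs es = (let N = build c es vs [Nd (hd vs) (hd vs) 0 [hd vs]] in
     solve (tloop (length vs) vs 1 0 0 + 2) N vs vs)"

section \<open>Elementary properties of representatives and plans\<close>

lemma best_in: "best X m s L b \<in> insert b (set L)"
  by (induction L arbitrary: b) (auto split: if_splits)

lemma set_bests:
  assumes "set S \<subseteq> set N"
  shows "set (map (\<lambda>s. best X m s N s) S) \<subseteq> set N"
proof -
  have "best X m s N s \<in> set N" if "s \<in> set S" for s
    using that assms best_in[of X m s N s] by auto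
  then show ?thesis by auto
qed

text \<open>This hides the pass through the list \<open>K\<close>; later arguments only need
  induction on the length of \<open>A\<close>.\<close>

lemma plan_cases:
  obtains "plan K0 A K = PLeaf"
  | e where "e \<in> set K" "inner e A \<noteq> []" "outer e A \<noteq> []"
      "plan K0 A K = PNode (nc e + max (pcost (plan K0 (inner e A) K0)) (pcost (plan K0 (outer e A) K0))) e
         (plan K0 (inner e A) K0) (plan K0 (outer e A) K0)"
proof -
  have "plan K0 A K = PLeaf \<or> (\<exists>e\<in>set K. inner e A \<noteq> [] \<and> outer e A \<noteq> [] \<and>
      plan K0 A K = PNode (nc e + max (pcost (plan K0 (inner e A) K0)) (pcost (plan K0 (outer e A) K0))) e
         (plan K0 (inner e A) K0) (plan K0 (outer e A) K0))"
  proof (induction K)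
    case (Cons a K)
    show ?case using Cons.IH by (simp add: Let_def del: filter_False) (smt (verit) filter_empty_conv)
  qed simp
  then show thesis using that by blast
qed

lemma length_outer_less: "inner e A \<noteq> [] \<Longrightarrow> length (outer e A) < length A"
  and length_inner_less: "outer e A \<noteq> [] \<Longrightarrow> length (inner e A) < length A"
  using length_inner_outer[of e A] by (metis length_greater_0_conv less_add_same_cancel2, metis length_greater_0_conv less_add_same_cancel1)

lemma plan_Leaf: "plan K0 A K = PLeaf \<Longrightarrow> e \<in> set K \<Longrightarrow> inner e A = [] \<or> outer e A = []"
proof (induction K)
  case (Cons a K)
  then show ?case by (cases "inner a A = [] \<or> outer a A = []") (auto simp: Let_def split: if_splits)
qed simp

lemma plan_le:
  "e \<in> set K \<Longrightarrow> inner e A \<noteq> [] \<Longrightarrow> outer e A \<noteq> [] \<Longrightarrow>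
    pcost (plan K0 A K) \<le> nc e + max (pcost (plan K0 (inner e A) K0)) (pcost (plan K0 (outer e A) K0))"
proof (induction K)
  case (Cons a K)
  define w where "w = nc a + max (pcost (plan K0 (inner a A) K0)) (pcost (plan K0 (outer a A) K0))"
  have pl: "plan K0 A (a # K) = (if inner a A = [] \<or> outer a A = [] then plan K0 A K
     else if plan K0 A K = PLeaf \<or> w < pcost (plan K0 A K)
     then PNode w a (plan K0 (inner a A) K0) (plan K0 (outer a A) K0) else plan K0 A K)"
    by (simp add: w_def Let_def)
  show ?case
  proof (cases "e = a")
    case True
    then have ne: "inner a A \<noteq> []" "outer a A \<noteq> []" using Cons.prems by auto
    have "pcost (plan K0 A (a # K)) \<le> w" unfolding pl using ne by auto
    then show ?thesis using True by (simp add: w_def)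
  next
    case False
    then have e: "e \<in> set K" using Cons.prems by auto
    \<comment> \<open>A new node could raise the cost only by replacing \<open>PLeaf\<close>, which
      \<open>e\<close> rules out.\<close>
    have "plan K0 A K \<noteq> PLeaf" using plan_Leaf[OF _ e] Cons.prems by blast
    then have "pcost (plan K0 A (a # K)) \<le> pcost (plan K0 A K)" unfolding pl by auto
    then show ?thesis using Cons.IH[OF e] Cons.prems by linarith
  qed
qed simp

lemma best_class:
  "(nv s \<in> set (nd b) \<and> fv X m b = fv X m s) \<Longrightarrow>
    nv s \<in> set (nd (best X m s L b)) \<and> fv X m (best X m s L b) = fv X m s"
  by (induction L arbitrary: b) auto

lemma best_le: "nc (best X m s L b) \<le> nc b"
proof (induction L arbitrary: b)
  case (Cons a L)
  show ?case using Cons.IH[of a] Cons.IH[of b] by auto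
qed simp

lemma best_le_class:
  "e \<in> set L \<Longrightarrow> nv s \<in> set (nd e) \<Longrightarrow> fv X m e = fv X m s \<Longrightarrow> nc (best X m s L b) \<le> nc e"
proof (induction L arbitrary: b)
  case (Cons a L)
  show ?case
  proof (cases "e = a")
    case True
    then show ?thesis using Cons.prems best_le[of X m s L a] best_le[of X m s L b] by auto
  qed (use Cons in auto)
qed simp

section \<open>Rooted trees and separators\<close>

text \<open>\<open>D_iff\<close> unfolds the descendant relation one step towards the root, and
  \<open>dep\<close> is the measure for inductions along such steps.\<close>

locale rtree =
  fixes V :: "'a set" and r :: 'a and par :: "'a \<Rightarrow> 'a" and D :: "'a \<Rightarrow> 'a set" and dep :: "'a \<Rightarrow> nat"
  assumes finite_V: "finite V" and root_in: "r \<in> V" and D_root: "D r = V"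
    and D_subset: "u \<in> V \<Longrightarrow> D u \<subseteq> V"
    and par_in: "v \<in> V \<Longrightarrow> v \<noteq> r \<Longrightarrow> par v \<in> V"
    and dep_par: "v \<in> V \<Longrightarrow> v \<noteq> r \<Longrightarrow> dep (par v) < dep v"
    and D_iff: "u \<in> V \<Longrightarrow> v \<in> V \<Longrightarrow> v \<noteq> r \<Longrightarrow> v \<in> D u \<longleftrightarrow> v = u \<or> par v \<in> D u"
    and root_in_D: "u \<in> V \<Longrightarrow> r \<in> D u \<Longrightarrow> u = r"
begin

lemma D_refl: "u \<in> V \<Longrightarrow> u \<in> D u"
  using D_iff[of u u] D_root root_in by (cases "u = r") auto

lemma D_trans: "u \<in> V \<Longrightarrow> w \<in> D u \<Longrightarrow> D w \<subseteq> D u"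
proof
  fix x assume u: "u \<in> V" "w \<in> D u" and x: "x \<in> D w"
  have w: "w \<in> V" using u D_subset by auto
  from x show "x \<in> D u"
  proof (induction "dep x" arbitrary: x rule: less_induct)
    case less
    have xV: "x \<in> V" using less.prems w D_subset by auto
    show ?case
    proof (cases "x = r \<or> x = w")
      case True
      then show ?thesis using less.prems w u root_in_D[OF w] by auto
    next
      case False
      then have "par x \<in> D w" using D_iff[OF w xV] less.prems by auto
      then have "par x \<in> D u" using less.hyps[of "par x"] dep_par[OF xV] False by auto
      then show ?thesis using D_iff[OF u(1) xV] False by auto
    qed
  qed
qed

text \<open>The ancestors of \<open>x\<close> form a chain: climbing from \<open>x\<close> stays in
  both descendant sets until \<open>u\<close>, \<open>w\<close> or the root is met.\<close>

lemma D_linear: "u \<in> V \<Longrightarrow> w \<in> V \<Longrightarrow> x \<in> D u \<Longrightarrow> x \<in> D w \<Longrightarrow> u \<in> D w \<or> w \<in> D u"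
proof (induction "dep x" arbitrary: x rule: less_induct)
  case less
  have xV: "x \<in> V" using less.prems D_subset by auto
  show ?case
  proof (cases "x = r \<or> x = u \<or> x = w")
    case True
    then show ?thesis using less.prems root_in_D[of u] root_in_D[of w] by auto
  next
    case False
    then have "par x \<in> D u" "par x \<in> D w" using D_iff[of u x] D_iff[of w x] xV less.prems by auto
    then show ?thesis using less.hyps[of "par x"] dep_par[OF xV] less.prems False by auto
  qed
qed

lemma dep_less: "u \<in> V \<Longrightarrow> x \<in> D u \<Longrightarrow> x \<noteq> u \<Longrightarrow> dep u < dep x"
proof (induction "dep x" arbitrary: x rule: less_induct)
  case less
  have xV: "x \<in> V" using less.prems D_subset by auto
  have "x \<noteq> r" using less.prems root_in_D[of u] by auto
  then have p: "par x \<in> D u" "dep (par x) < dep x" using D_iff[of u x] xV less.prems dep_par[of x] by auto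
  then show ?case using less.hyps[of "par x"] less.prems by (cases "par x = u") auto
qed

lemma D_antisym: "u \<in> V \<Longrightarrow> w \<in> V \<Longrightarrow> u \<in> D w \<Longrightarrow> w \<in> D u \<Longrightarrow> u = w"
  using dep_less[of u w] dep_less[of w u] by fastforce

lemma par_notin_D: "v \<in> V \<Longrightarrow> v \<noteq> r \<Longrightarrow> par v \<notin> D v"
  using dep_less[of v "par v"] dep_par[of v] by fastforce

lemma in_D_par: "v \<in> V \<Longrightarrow> v \<noteq> r \<Longrightarrow> v \<in> D (par v)"
  using D_iff[of "par v" v] D_refl[of "par v"] par_in by auto

lemma D_par_cases: "w \<in> V \<Longrightarrow> v \<in> V \<Longrightarrow> v \<noteq> r \<Longrightarrow> v \<in> D w \<Longrightarrow> w \<noteq> v \<Longrightarrow> par v \<in> D w"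
  using D_iff[of w v] by auto

text \<open>If the endpoints were matched crosswise, each of \<open>x\<close> and \<open>v\<close>
  would have smaller depth than the other.\<close>

lemma par_edge_eq:
  assumes "x \<in> V" "x \<noteq> r" "v \<in> V" "v \<noteq> r" "{par x, x} = {par v, v}"
  shows "x = v"
  using assms dep_par[of x] dep_par[of v] by (auto simp: doubleton_eq_iff)

lemma child_towards:
  assumes "s \<in> V" "x \<in> D s" "x \<noteq> s"
  obtains w where "w \<in> V" "w \<noteq> r" "par w = s" "x \<in> D w"
proof -
  have "\<exists>w. w \<in> V \<and> w \<noteq> r \<and> par w = s \<and> x \<in> D w"
    using assms(2,3)
  proof (induction "dep x" arbitrary: x rule: less_induct)
    case less
    have xV: "x \<in> V" using less.prems assms D_subset by auto
    have xr: "x \<noteq> r" using less.prems root_in_D[OF assms(1)] by auto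
    show ?case
    proof (cases "par x = s")
      case True
      then show ?thesis using xV xr D_refl[OF xV] by auto
    next
      case False
      have "par x \<in> D s" using D_iff[OF assms(1) xV xr] less.prems by auto
      then obtain w where w: "w \<in> V" "w \<noteq> r" "par w = s" "par x \<in> D w"
        using less.hyps[of "par x"] dep_par[OF xV xr] False by auto
      then have "x \<in> D w" using D_iff[OF w(1) xV xr] by auto
      then show ?thesis using w by auto
    qed
  qed
  then show thesis using that by auto
qed

end

section \<open>The two components left by deleting an edge\<close>

locale rtree_graph = rtree V r par D dep
  for V :: "'a set" and r par D dep +
  fixes E :: "'a set set"
  assumes edges: "E = (\<lambda>v. {par v, v}) ` (V - {r})"
begin

lemma edge_cases:
  assumes "{x, y} \<in> E"
  obtains v where "v \<in> V" "v \<noteq> r" "{x, y} = {par v, v}" "x = v \<and> y = par v \<or> x = par v \<and> y = v"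
proof -
  obtain v where v: "v \<in> V" "v \<noteq> r" "{x, y} = {par v, v}" using assms edges by auto
  then have "x = v \<and> y = par v \<or> x = par v \<and> y = v" by (auto simp: doubleton_eq_iff)
  then show thesis using that v by blast
qed

lemma adj_sym: "(x, y) \<in> (adj F)\<^sup>* \<Longrightarrow> (y, x) \<in> (adj F)\<^sup>*"
proof -
  have "sym (adj F)" by (auto simp: sym_def adj_def insert_commute)
  then show "(x, y) \<in> (adj F)\<^sup>* \<Longrightarrow> (y, x) \<in> (adj F)\<^sup>*" by (rule symD[OF sym_rtrancl])
qed

text \<open>By \<open>D_iff\<close>, only the edge \<open>{par v, v}\<close> has exactly one
  endpoint in \<open>D v\<close>.\<close>

lemma adj_invariant:
  assumes v: "v \<in> V" "v \<noteq> r" and "(x, y) \<in> (adj (E - {{par v, v}}))\<^sup>*" "x \<in> V"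
  shows "y \<in> V \<and> (y \<in> D v \<longleftrightarrow> x \<in> D v)"
  using assms(3)
proof (induction rule: rtrancl_induct)
  case base
  then show ?case using assms by simp
next
  case (step y z)
  from step(2) have yz: "{y, z} \<in> E" "{y, z} \<noteq> {par v, v}" by (auto simp: adj_def)
  from yz(1) obtain w where w: "w \<in> V" "w \<noteq> r" "{y, z} = {par w, w}" "y = w \<and> z = par w \<or> y = par w \<and> z = w"
    by (rule edge_cases)
  then have "w \<noteq> v" using yz by auto
  then have "w \<in> D v \<longleftrightarrow> par w \<in> D v" using D_iff[OF v(1) w(1,2)] by auto
  then show ?case using step.IH w par_in[OF w(1,2)] by auto
qed

lemma par_adj:
  assumes v: "v \<in> V" "v \<noteq> r" and x: "x \<in> V" "x \<noteq> r" "x \<noteq> v"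
  shows "(par x, x) \<in> adj (E - {{par v, v}})"
  using par_edge_eq[OF x(1,2) v] x by (auto simp: adj_def edges)

lemma side_child:
  assumes v: "v \<in> V" "v \<noteq> r"
  shows "side E {par v, v} v = D v"
proof -
  have "(v, x) \<in> (adj (E - {{par v, v}}))\<^sup>*" if "x \<in> D v" for x
    using that
  proof (induction "dep x" arbitrary: x rule: less_induct)
    case less
    have xV: "x \<in> V" using less.prems D_subset[OF v(1)] by auto
    have xr: "x \<noteq> r" using less.prems root_in_D[OF v(1)] v(2) by auto
    show ?case
    proof (cases "x = v")
      case False
      then have "par x \<in> D v" using D_iff[OF v(1) xV xr] less.prems by auto
      then have "(v, par x) \<in> (adj (E - {{par v, v}}))\<^sup>*" using less.hyps dep_par[OF xV xr] by auto
      then show ?thesis using par_adj[OF v xV xr False] by (rule rtrancl_into_rtrancl)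
    qed simp
  qed
  moreover have "x \<in> D v" if "(v, x) \<in> (adj (E - {{par v, v}}))\<^sup>*" for x
    using adj_invariant[OF v that v(1)] D_refl[OF v(1)] by blast
  ultimately show ?thesis unfolding side_def by blast
qed

lemma side_parent:
  assumes v: "v \<in> V" "v \<noteq> r"
  shows "side E {par v, v} (par v) = V - D v"
proof -
  \<comment> \<open>The parent of a vertex outside \<open>D v\<close> is again outside, so the climb
    to the root avoids the deleted edge. Any two such paths meet at the root.\<close>
  have root: "(r, x) \<in> (adj (E - {{par v, v}}))\<^sup>*" if "x \<in> V - D v" for x
    using that
  proof (induction "dep x" arbitrary: x rule: less_induct)
    case less
    show ?case
    proof (cases "x = r")
      case False
      have xV: "x \<in> V" and xv: "x \<noteq> v" using less.prems D_refl[OF v(1)] by auto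
      have "par x \<in> V - D v" using D_iff[OF v(1) xV False] par_in[OF xV False] less.prems by auto
      then have "(r, par x) \<in> (adj (E - {{par v, v}}))\<^sup>*" using less.hyps dep_par[OF xV False] by auto
      then show ?thesis using par_adj[OF v xV False xv] by (rule rtrancl_into_rtrancl)
    qed simp
  qed
  have pv: "par v \<in> V - D v" using par_in[OF v] par_notin_D[OF v] by auto
  have "(par v, x) \<in> (adj (E - {{par v, v}}))\<^sup>*" if "x \<in> V - D v" for x
    using adj_sym[OF root[OF pv]] root[OF that] by (rule rtrancl_trans)
  moreover have "x \<in> V - D v" if "(par v, x) \<in> (adj (E - {{par v, v}}))\<^sup>*" for x
    using adj_invariant[OF v that] pv by blast
  ultimately show ?thesis unfolding side_def by blast
qed

end

section \<open>Separators of a candidate list\<close>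

lemma div_add_le: "a div m + b div m \<le> (a + b) div (m::nat)"
proof (cases "m = 0")
  case False
  have "(a div m + b div m) * m \<le> a + b" by (simp add: add_mult_distrib add_mono)
  then show ?thesis using False by (simp add: less_eq_div_iff_mult_less_eq)
qed simp

lemma sum_div_le: "(\<Sum>i\<in>I. h i div m) \<le> (\<Sum>i\<in>I. h i) div (m::nat)"
  by (induction I rule: infinite_finite_induct) (auto intro: order_trans[OF add_left_mono div_add_le])

lemma length_filter_disjoint:
  "A \<inter> B = {} \<Longrightarrow> A \<union> B \<subseteq> C \<Longrightarrow> length (filter (\<lambda>x. x \<in> A) X) + length (filter (\<lambda>x. x \<in> B) X) \<le> length (filter (\<lambda>x. x \<in> C) X)"
  by (induction X) auto

locale rtree_weight = rtree V r par D dep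
  for V :: "'a set" and r par D dep +
  fixes X :: "'a list" and m :: nat
  assumes m_pos: "0 < m"
begin

definition g :: "'a \<Rightarrow> nat" where "g v = length (filter (\<lambda>x. x \<in> D v) X)"
definition f :: "'a \<Rightarrow> nat" where "f v = g v div m"
definition S :: "'a set" where "S = {v \<in> V. 0 < f v \<and> (\<forall>w\<in>D v. w = v \<or> f w < f v)}"

lemma S_subset: "S \<subseteq> V" by (auto simp: S_def)

lemma f_mono: "D w \<subseteq> D v \<Longrightarrow> f w \<le> f v"
  unfolding f_def g_def by (intro div_le_mono) (induction X; auto)

lemma f_disjoint: "D u \<inter> D w = {} \<Longrightarrow> D u \<union> D w \<subseteq> D v \<Longrightarrow> f u + f w \<le> f v"
  unfolding f_def g_def using length_filter_disjoint[of "D u" "D w" "D v" X]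
  by (meson div_add_le div_le_mono order_trans)

text \<open>Equal quotients place both counts in the same interval of length
  \<open>m\<close>.\<close>

lemma diff_small:
  assumes "D u \<subseteq> D v" "f u = f v"
  shows "length (filter (\<lambda>x. x \<in> D v \<and> x \<notin> D u) X) < m"
proof -
  have "length (filter (\<lambda>x. x \<in> D v \<and> x \<notin> D u) X) + g u \<le> g v"
    unfolding g_def using length_filter_disjoint[of "D v - D u" "D u" "D v" X] assms(1) by auto
  moreover have "g v < (g u div m) * m + m"
    using dividend_less_div_times[OF m_pos, of "g v"] assms(2) by (simp add: f_def add.commute)
  moreover have "(g u div m) * m \<le> g u" by simp
  ultimately show ?thesis by linarith
qed

text \<open>Take a deepest vertex of \<open>D v\<close> with value \<open>f v\<close>: by
  monotonicity all values below it are strictly smaller.\<close>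

lemma lowest_in_S:
  assumes "v \<in> V" "0 < f v"
  obtains u where "u \<in> S" "u \<in> D v" "f u = f v"
proof -
  define P where "P u \<longleftrightarrow> u \<in> D v \<and> f u = f v" for u
  have fin: "finite {u. P u}" using finite_V D_subset assms by (auto simp: P_def intro: finite_subset[of _ V])
  have ne: "{u. P u} \<noteq> {}" using assms D_refl by (auto simp: P_def)
  \<comment> \<open>The bound required by \<open>arg_max_nat_lemma\<close> is strict, hence the
    \<open>+ 1\<close>.\<close>
  obtain u where u: "P u" "\<And>w. P w \<Longrightarrow> dep w \<le> dep u"
    using arg_max_nat_lemma[of P v dep "Max (dep ` {u. P u}) + 1"] fin ne assms D_refl
    by (metis (mono_tags, lifting) Max_ge P_def Suc_eq_plus1 finite_imageI image_eqI less_Suc_eq_le mem_Collect_eq)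
  have uV: "u \<in> V" using u(1) assms D_subset by (auto simp: P_def)
  have "f w < f u" if "w \<in> D u" "w \<noteq> u" for w
  proof -
    have "dep u < dep w" using dep_less[OF uV that] .
    then have "\<not> P w" using u(2)[of w] by auto
    moreover have "w \<in> D v" using that u D_trans[OF assms(1), of u] by (auto simp: P_def)
    ultimately have "f w \<noteq> f u" using u(1) by (auto simp: P_def)
    then show ?thesis using f_mono[OF D_trans[OF uV that(1)]] by simp
  qed
  then show thesis using that[of u] u(1) uV assms by (auto simp: S_def P_def)
qed

lemma D_disjoint: "u \<in> V \<Longrightarrow> w \<in> V \<Longrightarrow> u \<notin> D w \<Longrightarrow> w \<notin> D u \<Longrightarrow> D u \<inter> D w = {}"
  using D_linear by auto

text \<open>A proper descendant \<open>w\<close> of \<open>par u\<close> either lies in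
  \<open>D u\<close>, where values are at most \<open>f u\<close>, or has a subtree disjoint from
  \<open>D u\<close>; then superadditivity and \<open>0 < f u\<close> make \<open>f w\<close>
  smaller than \<open>f (par u)\<close>. A remaining \<open>w\<close> strictly between
  \<open>u\<close> and \<open>par u\<close> is impossible.\<close>

lemma par_in_S:
  assumes u: "u \<in> V" "u \<noteq> r" and f: "0 < f u" "f (par u) \<noteq> f u"
  shows "par u \<in> S"
proof -
  have p: "par u \<in> V" using u par_in by auto
  have up: "D u \<subseteq> D (par u)" using D_trans[OF p in_D_par[OF u]] .
  then have less: "f u < f (par u)" using f_mono[OF up] f by simp
  have "f w < f (par u)" if w: "w \<in> D (par u)" "w \<noteq> par u" for w
  proof -
    have wV: "w \<in> V" using w p D_subset by auto
    consider "w \<in> D u" | "u \<in> D w" "w \<noteq> u" | "w \<notin> D u" "u \<notin> D w" using D_refl wV by auto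
    then show ?thesis
    proof cases
      case 1
      then show ?thesis using f_mono[OF D_trans[OF u(1)]] less by fastforce
    next
      case 2
      then have "par u \<in> D w" using D_par_cases[OF wV u] by auto
      then show ?thesis using D_antisym[OF wV p] w by auto
    next
      case 3
      then have "f w + f u \<le> f (par u)"
        using D_disjoint[OF wV u(1)] up D_trans[OF p w(1)] by (intro f_disjoint) auto
      then show ?thesis using f by linarith
    qed
  qed
  then show ?thesis using p less by (auto simp: S_def)
qed

text \<open>This is why \<open>best\<close> needs to look only at the value of \<open>f\<close> and
  at one separator below the edge. A separator in \<open>D v\<close> but not in \<open>D u\<close>
  would push \<open>f v\<close> above \<open>f u\<close>: strictly above \<open>u\<close> by the
  definition of \<open>S\<close>, beside \<open>u\<close> by superadditivity.\<close>

lemma same_class: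
  assumes "u \<in> S" "v \<in> V" "u \<in> D v" "f v = f u" "a \<in> S"
  shows "a \<in> D v \<longleftrightarrow> a \<in> D u"
proof
  show "a \<in> D u \<Longrightarrow> a \<in> D v" using D_trans assms by auto
next
  assume a: "a \<in> D v"
  have uV: "u \<in> V" and aV: "a \<in> V" using assms S_subset by auto
  show "a \<in> D u"
  proof (rule ccontr)
    assume na: "a \<notin> D u"
    show False
    proof (cases "u \<in> D a")
      case True
      then have "u \<noteq> a" using na D_refl aV by auto
      then have "f u < f a" using assms(5) True by (auto simp: S_def)
      then show False using f_mono[OF D_trans[OF assms(2) a]] assms by simp
    next
      case False
      then have "f u + f a \<le> f v" using D_disjoint[OF uV aV] na D_trans assms a
        by (intro f_disjoint) auto
      then show False using assms by (auto simp: S_def)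
    qed
  qed
qed

text \<open>\<open>R\<close> is the set of vertices consistent with the answers given so far, each of which
  separates \<open>R\<close> from some separators.\<close>

definition cut_off :: "'a set \<Rightarrow> bool" where
  "cut_off R \<longleftrightarrow> R \<subseteq> V \<and> (\<forall>s\<in>S - R. \<exists>v\<in>V. (R \<subseteq> D v \<and> s \<notin> D v) \<or> (R \<inter> D v = {} \<and> s \<in> D v))"

lemma cut_off_split:
  assumes "cut_off R" "v \<in> V"
  shows "cut_off (R \<inter> D v)" "cut_off (R - D v)"
  using assms unfolding cut_off_def by (blast, blast)

text \<open>Let \<open>u\<close> be the topmost ancestor of \<open>s\<close> with the same value.
  Unless \<open>u\<close> is the root, \<open>par u\<close> is a separator, and the set that cuts it
  off from \<open>R\<close> has to contain \<open>R\<close> and to lie below \<open>u\<close>. Hence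
  \<open>R\<close> is contained in \<open>D u\<close>, and \<open>diff_small\<close> applies to
  \<open>u\<close> and \<open>s\<close>.\<close>

lemma up_small:
  assumes R: "cut_off R" "R \<inter> S = {s}"
  shows "length (filter (\<lambda>x. x \<in> R \<and> x \<notin> D s) X) < m"
proof -
  have s: "s \<in> S" "s \<in> V" "s \<in> R" using R S_subset by auto
  define P where "P u \<longleftrightarrow> u \<in> V \<and> s \<in> D u \<and> f u = f s" for u
  have "P s" using s D_refl by (auto simp: P_def)
  then obtain u where u: "P u" "\<And>w. P w \<Longrightarrow> dep u \<le> dep w"
    using arg_min_nat_lemma[of P s dep] by (metis)
  then have uV: "u \<in> V" and su: "s \<in> D u" and fu: "f u = f s" by (auto simp: P_def)
  have Ru: "R \<subseteq> D u"
  proof (cases "u = r")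
    case True
    then show ?thesis using R D_root by (auto simp: cut_off_def)
  next
    case False
    define a where "a = par u"
    have aV: "a \<in> V" and ua: "u \<in> D a" and au: "dep a < dep u"
      using par_in in_D_par dep_par uV False by (auto simp: a_def)
    have sa: "s \<in> D a" using D_trans[OF aV ua] su by auto
    have "\<not> P a" using u(2)[of a] au by auto
    then have "f a \<noteq> f u" using sa aV fu by (auto simp: P_def)
    then have aS: "a \<in> S" using par_in_S[OF uV False] fu s by (auto simp: a_def S_def)
    have "a \<noteq> s" using su dep_less[OF uV su] au by (cases "s = u") auto
    then have "a \<notin> R" using R aS by auto
    then obtain v where v: "v \<in> V" "(R \<subseteq> D v \<and> a \<notin> D v) \<or> (R \<inter> D v = {} \<and> a \<in> D v)"
      using R(1) aS unfolding cut_off_def by blast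
    have "R \<subseteq> D v" and av: "a \<notin> D v" using v D_trans[OF v(1), of a] sa s by auto
    then have "s \<in> D v" using s by auto
    then have "u \<in> D v \<or> v \<in> D u" using D_linear su v(1) uV by auto
    moreover have "v \<in> D u" if "u \<in> D v"
    proof (rule ccontr)
      assume "v \<notin> D u"
      then have "v \<noteq> u" using D_refl uV by auto
      then show False using D_par_cases[OF v(1) uV False that] av by (auto simp: a_def)
    qed
    ultimately show ?thesis using D_trans[OF uV, of v] \<open>R \<subseteq> D v\<close> by auto
  qed
  have "length (filter (\<lambda>x. x \<in> R \<and> x \<notin> D s) X) \<le> length (filter (\<lambda>x. x \<in> D u \<and> x \<notin> D s) X)"
    using Ru by (induction X) auto
  also have "\<dots> < m" using diff_small[OF D_trans[OF uV su]] fu by simp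
  finally show ?thesis .
qed

text \<open>If \<open>f w\<close> is positive, a separator \<open>u\<close> below \<open>w\<close>
  has the same value. As \<open>R\<close> contains \<open>s\<close> above \<open>w\<close>,
  \<open>u\<close> can only be cut off by a descendant set that contains \<open>u\<close> and avoids
  \<open>R\<close>. What remains of \<open>R\<close> lies in \<open>D w\<close> outside
  \<open>D u\<close>.\<close>

lemma down_small:
  assumes R: "cut_off R" "R \<inter> S = {s}" and w: "w \<in> V" "w \<noteq> r" "par w = s"
  shows "length (filter (\<lambda>x. x \<in> R \<and> x \<in> D w) X) < m"
proof -
  have s: "s \<in> S" "s \<in> V" "s \<in> R" using R S_subset by auto
  have sw: "s \<notin> D w" using par_notin_D[of w] w by auto
  show ?thesis
  proof (cases "f w = 0")
    case True
    have "length (filter (\<lambda>x. x \<in> R \<and> x \<in> D w) X) \<le> g w" unfolding g_def by (induction X) auto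
    also have "\<dots> < m" using True m_pos by (auto simp: f_def div_eq_0_iff)
    finally show ?thesis .
  next
    case False
    then obtain u where u: "u \<in> S" "u \<in> D w" "f u = f w" using lowest_in_S[OF w(1)] by auto
    have uV: "u \<in> V" using u S_subset by auto
    have "u \<notin> R" using u sw R by auto
    then obtain v where v: "v \<in> V" "(R \<subseteq> D v \<and> u \<notin> D v) \<or> (R \<inter> D v = {} \<and> u \<in> D v)"
      using R(1) u(1) unfolding cut_off_def by blast
    have "\<not> (R \<subseteq> D v \<and> u \<notin> D v)"
    proof
      assume a: "R \<subseteq> D v \<and> u \<notin> D v"
      have "w \<in> D s" using in_D_par[of w] w by simp
      then have "w \<in> D v" using D_trans[OF v(1), of s] a s by auto
      then show False using a D_trans[OF v(1), of w] u by auto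
    qed
    then have v2: "R \<inter> D v = {}" "u \<in> D v" using v by auto
    have Duv: "D u \<subseteq> D v" using D_trans[OF v(1) v2(2)] .
    have "length (filter (\<lambda>x. x \<in> R \<and> x \<in> D w) X) \<le> length (filter (\<lambda>x. x \<in> D w \<and> x \<notin> D u) X)"
      using v2 Duv by (induction X) auto
    also have "\<dots> < m" using diff_small[OF D_trans[OF w(1) u(2)] u(3)] .
    finally show ?thesis .
  qed
qed

text \<open>The summand 1 is slack that pays for \<open>v\<close> itself. If \<open>v\<close> is in
  \<open>S\<close> and at least two children have positive value, their combined slack covers
  \<open>v\<close>; with one such child, its value is strictly below \<open>f v\<close>; with none,
  \<open>0 < f v\<close> suffices.\<close>

lemma card_S_le:
  "v \<in> V \<Longrightarrow> 0 < f v \<Longrightarrow> card (S \<inter> D v) + 1 \<le> 2 * f v"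
proof (induction "card (D v)" arbitrary: v rule: less_induct)
  case less
  define C where "C = {w \<in> V - {r}. par w = v}"
  have fin: "finite C" "finite S" using finite_V S_subset by (auto simp: C_def intro: finite_subset)
  have CV: "w \<in> V" "w \<noteq> r" "par w = v" if "w \<in> C" for w using that by (auto simp: C_def)
  have CD: "D w \<subset> D v" if "w \<in> C" for w
    using in_D_par[of w] D_trans[OF less.prems(1), of w] par_notin_D[of w] D_refl[OF less.prems(1)] CV[OF that]
    by blast
  have disj: "D w \<inter> D w' = {}" if "w \<in> C" "w' \<in> C" "w \<noteq> w'" for w w'
  proof (rule D_disjoint)
    show "w \<in> V" "w' \<in> V" using CV that by auto
    show "w \<notin> D w'" using that(3) CV[OF that(1)] CV[OF that(2)] D_par_cases[of w' w] par_notin_D[of w'] by metis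
    show "w' \<notin> D w" using that(3) CV[OF that(1)] CV[OF that(2)] D_par_cases[of w w'] par_notin_D[of w] by metis
  qed
  have DC: "D v = insert v (\<Union>w\<in>C. D w)"
  proof
    show "D v \<subseteq> insert v (\<Union>w\<in>C. D w)"
    proof
      fix x assume x: "x \<in> D v"
      show "x \<in> insert v (\<Union>w\<in>C. D w)"
      proof (cases "x = v")
        case False
        then obtain w where "w \<in> V" "w \<noteq> r" "par w = v" "x \<in> D w" using child_towards[OF less.prems(1) x] by blast
        then show ?thesis by (auto simp: C_def)
      qed simp
    qed
    show "insert v (\<Union>w\<in>C. D w) \<subseteq> D v" using CD D_refl[OF less.prems(1)] by blast
  qed
  \<comment> \<open>Children of value 0 have no separators below them and provide no slack, so only
    the others are counted.\<close>
  define C1 where "C1 = {w \<in> C. 0 < f w}"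
  have C1: "finite C1" "C1 \<subseteq> C" using fin by (auto simp: C1_def)
  have SC: "S \<inter> D v \<subseteq> (if v \<in> S then {v} else {}) \<union> (\<Union>w\<in>C1. S \<inter> D w)"
  proof
    fix x assume x: "x \<in> S \<inter> D v"
    show "x \<in> (if v \<in> S then {v} else {}) \<union> (\<Union>w\<in>C1. S \<inter> D w)"
    proof (cases "x = v")
      case False
      then obtain w where w: "w \<in> C" "x \<in> D w" using x DC by auto
      have "w \<in> V" using w by (auto simp: C_def)
      then have "0 < f w" using f_mono[OF D_trans[OF _ w(2)]] x by (auto simp: S_def)
      then show ?thesis using w x by (auto simp: C1_def)
    qed (use x in auto)
  qed
  have "card (S \<inter> D v) \<le> card ((if v \<in> S then {v} else {}) \<union> (\<Union>w\<in>C1. S \<inter> D w))"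
    using fin C1 by (intro card_mono SC) auto
  also have "\<dots> \<le> (if v \<in> S then 1 else 0) + card (\<Union>w\<in>C1. S \<inter> D w)"
    by (rule order_trans[OF card_Un_le]) auto
  also have "card (\<Union>w\<in>C1. S \<inter> D w) \<le> (\<Sum>w\<in>C1. card (S \<inter> D w))"
    by (rule card_UN_le[OF C1(1)])
  finally have 1: "card (S \<inter> D v) \<le> (if v \<in> S then 1 else 0) + (\<Sum>w\<in>C1. card (S \<inter> D w))" by simp
  have "(\<Sum>w\<in>C1. card (S \<inter> D w) + 1) \<le> (\<Sum>w\<in>C1. 2 * f w)"
  proof (rule sum_mono)
    fix w assume w: "w \<in> C1"
    have "card (D w) < card (D v)" using CD[of w] w finite_subset[OF D_subset[OF less.prems(1)] finite_V] C1
      by (intro psubset_card_mono) auto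
    then show "card (S \<inter> D w) + 1 \<le> 2 * f w" by (rule less.hyps) (use w CV C1_def in auto)
  qed
  then have 2: "(\<Sum>w\<in>C1. card (S \<inter> D w)) + card C1 \<le> 2 * (\<Sum>w\<in>C1. f w)"
    by (simp only: sum.distrib sum_distrib_left) simp
  have g: "(\<Sum>w\<in>C'. g w) \<le> g v" if "finite C'" "C' \<subseteq> C" for C'
  proof -
    have "(\<Sum>w\<in>C'. g w) = length (filter (\<lambda>x. x \<in> (\<Union>w\<in>C'. D w)) X)" using that
    proof (induction C' rule: finite_induct)
      case (insert w C')
      have "D w \<inter> D w' = {}" if "w' \<in> C'" for w' using disj[of w w'] insert that by auto
      then have "D w \<inter> (\<Union>w\<in>C'. D w) = {}" by blast
      then have "length (filter (\<lambda>x. x \<in> D w \<union> (\<Union>w\<in>C'. D w)) X) = g w + length (filter (\<lambda>x. x \<in> (\<Union>w\<in>C'. D w)) X)"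
        unfolding g_def by (induction X) auto
      then show ?case using insert by simp
    qed simp
    also have "\<dots> \<le> g v" unfolding g_def using that CD by (induction X) auto
    finally show ?thesis .
  qed
  have 3: "(\<Sum>w\<in>C1. f w) \<le> f v"
    unfolding f_def by (rule order_trans[OF sum_div_le div_le_mono[OF g[OF C1]]])
  show ?case
  proof (cases "v \<in> S")
    case False
    show ?thesis
    proof (cases "C1 = {}")
      case True
      then show ?thesis using 1 False less.prems by simp
    next
      case False
      then have "1 \<le> card C1" using C1 by (simp add: Suc_le_eq card_gt_0_iff)
      then show ?thesis using 1 2 3 \<open>v \<notin> S\<close> by simp
    qed
  next
    case True
    consider "card C1 = 0" | "card C1 = 1" | "2 \<le> card C1" by linarith
    then show ?thesis
    proof cases
      case c: 1
      then have "C1 = {}" using C1 by simp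
      then show ?thesis using 1 True less.prems by simp
    next
      case c: 2
      then obtain w where w: "C1 = {w}" using card_1_singletonE by auto
      then have wC: "w \<in> C" using C1 by auto
      have "w \<in> D v" using CD[OF wC] D_refl[OF CV(1)[OF wC]] by blast
      moreover have "w \<noteq> v" using CD[OF wC] by blast
      ultimately      have "f w < f v" using True by (auto simp: S_def)
      then show ?thesis using 1 2 w True by simp
    next
      case c: 3
      then show ?thesis using 1 2 3 True by simp
    qed
  qed
qed

end

section \<open>Rooting the input tree\<close>

lemma rtrancl_imp_distinct_path:
  assumes "(a, b) \<in> R\<^sup>*"
  obtains xs where "xs \<noteq> []" "hd xs = a" "last xs = b" "distinct xs" "successively (\<lambda>x y. (x, y) \<in> R) xs"
proof -
  have "\<exists>xs. xs \<noteq> [] \<and> hd xs = a \<and> last xs = b \<and> distinct xs \<and> successively (\<lambda>x y. (x, y) \<in> R) xs"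
    using assms
  proof (induction rule: converse_rtrancl_induct)
    case base
    show ?case by (intro exI[of _ "[b]"]) simp
  next
    case (step y z)
    then obtain xs where xs: "xs \<noteq> []" "hd xs = z" "last xs = b" "distinct xs" "successively (\<lambda>x y. (x, y) \<in> R) xs"
      by auto
    show ?case
    proof (cases "y \<in> set xs")
      case True
      \<comment> \<open>A path that returns to \<open>y\<close> is shortened to its part from
        \<open>y\<close> on.\<close>
      then obtain ys zs where "xs = ys @ y # zs" by (auto dest: split_list)
      then show ?thesis using xs by (intro exI[of _ "y # zs"]) (auto simp: successively_append_iff)
    next
      case False
      then show ?thesis using xs step(1) by (intro exI[of _ "y # xs"]) (cases xs; auto)
    qed
  qed
  then show thesis using that by blast
qed

lemma cycle_from_edge:
  assumes e: "{a, b} \<in> E" "a \<noteq> b" and "(a, b) \<in> (adj (E - {{a, b}}))\<^sup>*"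
  shows "\<exists>xs. is_cycle E xs"
proof -
  obtain xs where xs: "xs \<noteq> []" "hd xs = a" "last xs = b" "distinct xs"
    "successively (\<lambda>x y. (x, y) \<in> adj (E - {{a, b}})) xs"
    using rtrancl_imp_distinct_path[OF assms(3)] by blast
  have "length xs \<ge> 3"
  proof (rule ccontr)
    assume "\<not> length xs \<ge> 3"
    then consider "length xs = 1" | "length xs = 2" using xs(1) by (cases xs) (auto simp: not_le less_Suc_eq numeral_3_eq_3)
    then show False
    proof cases
      case 1
      then show False using xs e by (auto simp: length_Suc_conv)
    next
      case 2
      then obtain x y where "xs = [x, y]" by (auto simp: length_Suc_conv numeral_2_eq_2)
      then show False using xs by (auto simp: adj_def)
    qed
  qed
  moreover have "{xs ! i, xs ! (Suc i mod length xs)} \<in> E" if i: "i < length xs" for i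
  proof (cases "Suc i < length xs")
    case True
    then show ?thesis using xs(5) by (auto simp: successively_conv_nth adj_def)
  next
    case False
    then have "Suc i = length xs" using i by simp
    then have "xs ! i = b" "xs ! (Suc i mod length xs) = a"
      using xs(1,2,3) by (metis diff_Suc_1 last_conv_nth, metis hd_conv_nth mod_self)
    then show ?thesis using e by (simp add: insert_commute)
  qed
  ultimately show ?thesis using xs(4) by (auto simp: is_cycle_def)
qed

lemma rtree_singleton: "rtree {r} r par (\<lambda>_. {r}) dep"
  by unfold_locales auto

text \<open>The abstract counterpart of the step from \<open>N\<close> to \<open>e # upd N e\<close>
  in \<open>build\<close>.\<close>

lemma rtree_insert:
  assumes "rtree V r par D dep" and v: "v \<notin> V" and p: "p \<in> V"
  shows "rtree (insert v V) r (par(v := p)) (\<lambda>w. if w = v then {v} else if p \<in> D w then insert v (D w) else D w)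
    (dep(v := Suc (dep p)))"
proof -
  interpret rtree V r par D dep by fact
  have vD: "v \<notin> D w" if "w \<in> V" for w using D_subset[OF that] v by auto
  have rv: "r \<noteq> v" using v root_in by auto
  have pv: "p \<noteq> v" using v p by auto
  show ?thesis
  proof
    show "finite (insert v V)" using finite_V by simp
    show "r \<in> insert v V" using root_in by simp
    show "(if r = v then {v} else if p \<in> D r then insert v (D r) else D r) = insert v V"
      using rv D_root p by simp
    show "(if u = v then {v} else if p \<in> D u then insert v (D u) else D u) \<subseteq> insert v V" if "u \<in> insert v V" for u
      using D_subset[of u] that by auto
    show "(par(v := p)) x \<in> insert v V" if "x \<in> insert v V" "x \<noteq> r" for x
      using par_in[of x] that p by auto
    show "(dep(v := Suc (dep p))) ((par(v := p)) x) < (dep(v := Suc (dep p))) x"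
      if "x \<in> insert v V" "x \<noteq> r" for x
    proof (cases "x = v")
      case False
      then have "par x \<noteq> v" "dep (par x) < dep x" using that par_in[of x] dep_par[of x] v by auto
      then show ?thesis using False by simp
    qed (use pv in simp)
    show "x \<in> (if u = v then {v} else if p \<in> D u then insert v (D u) else D u) \<longleftrightarrow>
      x = u \<or> (par(v := p)) x \<in> (if u = v then {v} else if p \<in> D u then insert v (D u) else D u)"
      if "u \<in> insert v V" "x \<in> insert v V" "x \<noteq> r" for u x
    proof (cases "x = v")
      case True
      then show ?thesis using that vD[of u] pv by auto
    next
      case False
      then have "x \<in> V" "par x \<noteq> v" using that par_in[of x] v by auto
      then show ?thesis using D_iff[of u x] False that by auto
    qed
    show "u = r" if "u \<in> insert v V" "r \<in> (if u = v then {v} else if p \<in> D u then insert v (D u) else D u)" for u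
      using root_in_D[of u] that rv by (auto split: if_splits)
  qed
qed

definition tree_nodes :: "node list \<Rightarrow> nat set \<Rightarrow> nat \<Rightarrow> (nat \<Rightarrow> nat) \<Rightarrow> (nat \<Rightarrow> nat set) \<Rightarrow> (nat set \<Rightarrow> rat) \<Rightarrow> bool" where
  "tree_nodes N V r par D c \<longleftrightarrow> distinct (map nv N) \<and> nv ` set N = V \<and>
     (\<forall>e\<in>set N. set (nd e) = D (nv e) \<and>
        (if nv e = r then np e = r \<and> nc e = 0 else np e = par (nv e) \<and> nc e = c {par (nv e), nv e}))"

lemma find_edge_Some:
  "find_edge c es vis = Some e \<Longrightarrow> {np e, nv e} \<in> set (map (\<lambda>(u, v). {u, v}) es) \<and> np e \<in> set vis \<and>
     nv e \<notin> set vis \<and> nc e = c {np e, nv e} \<and> nd e = [nv e]"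
  by (induction c es vis rule: find_edge.induct) (auto split: if_splits simp: insert_commute)

lemma find_edge_None:
  "find_edge c es vis = None \<Longrightarrow> {x, y} \<in> set (map (\<lambda>(u, v). {u, v}) es) \<Longrightarrow> x \<in> set vis \<Longrightarrow> y \<in> set vis"
proof -
  assume "find_edge c es vis = None"
  then have "(u, v) \<in> set es \<Longrightarrow> u \<in> set vis \<longleftrightarrow> v \<in> set vis" for u v
    by (induction c es vis rule: find_edge.induct) (auto split: if_splits)
  then show "{x, y} \<in> set (map (\<lambda>(u, v). {u, v}) es) \<Longrightarrow> x \<in> set vis \<Longrightarrow> y \<in> set vis"
    by (auto simp: doubleton_eq_iff)
qed

definition build_inv :: "node list \<Rightarrow> nat set \<Rightarrow> nat set \<Rightarrow> nat set set \<Rightarrow> nat \<Rightarrow> (nat set \<Rightarrow> rat) \<Rightarrow> bool" where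
  "build_inv N V0 V E r c \<longleftrightarrow> (\<exists>par D dep. rtree V0 r par D dep \<and> tree_nodes N V0 r par D c \<and> V0 \<subseteq> V \<and>
     (\<forall>v\<in>V0 - {r}. {par v, v} \<in> E))"

lemma build_step:
  assumes inv: "build_inv N V0 V E r c" and E: "simple_graph V E" "set (map (\<lambda>(u, v). {u, v}) es) = E"
    and e: "find_edge c es (map nv N) = Some e"
  shows "build_inv (e # upd N e) (insert (nv e) V0) V E r c"
proof -
  obtain par D dep where t: "rtree V0 r par D dep" "tree_nodes N V0 r par D c" "V0 \<subseteq> V"
     "\<forall>v\<in>V0 - {r}. {par v, v} \<in> E"
    using inv by (auto simp: build_inv_def)
  have N: "distinct (map nv N)" "nv ` set N = V0" using t(2) by (auto simp: tree_nodes_def)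
  define v p where "v = nv e" and "p = np e"
  have ep: "{p, v} \<in> E" "p \<in> V0" "v \<notin> V0" "nc e = c {p, v}" "nd e = [v]"
    using find_edge_Some[OF e] E N by (auto simp: v_def p_def)
  have vV: "v \<in> V" using ep(1) E(1) by (auto simp: simple_graph_def)
  have r: "r \<in> V0" using rtree.root_in[OF t(1)] .
  have pr: "par x \<noteq> v" if "x \<in> V0" "x \<noteq> r" for x using rtree.par_in[OF t(1) that] ep(3) by auto
  let ?par = "par(v := p)"
  let ?D = "\<lambda>w. if w = v then {v} else if p \<in> D w then insert v (D w) else D w"
  have rt: "rtree (insert v V0) r ?par ?D (dep(v := Suc (dep p)))"
    using rtree_insert[OF t(1) ep(3,2)] .
  have u: "map nv (upd N e) = map nv N" by (auto simp: upd_def)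
  then have "nv ` set (upd N e) = V0" using N by (metis set_map)
  note u = u this
  have "tree_nodes (e # upd N e) (insert v V0) r ?par ?D c"
    unfolding tree_nodes_def
  proof (intro conjI ballI)
    show "distinct (map nv (e # upd N e))" using u N ep by (simp add: v_def)
    show "nv ` set (e # upd N e) = insert v V0" using u by (simp add: v_def)
  next
    fix a assume "a \<in> set (e # upd N e)"
    then consider "a = e" | b where "b \<in> set N" "a = (if p \<in> set (nd b) then Nd (nv b) (np b) (nc b) (v # nd b) else b)"
      by (auto simp: upd_def v_def p_def)
    note ab = this
    have nvb: "nv b \<in> V0" "nv b \<noteq> v" if "b \<in> set N" for b using that N ep(3) by auto
    have b: "set (nd b) = D (nv b)" "if nv b = r then np b = r \<and> nc b = 0 else np b = par (nv b) \<and> nc b = c {par (nv b), nv b}"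
      if "b \<in> set N" for b using t(2) that by (auto simp: tree_nodes_def)
    from ab show "set (nd a) = ?D (nv a)"
    proof cases
      case 1
      then show ?thesis using ep by (simp add: v_def)
    next
      case (2 b)
      then show ?thesis using b(1)[OF 2(1)] nvb[OF 2(1)] by auto
    qed
    from ab show "if nv a = r then np a = r \<and> nc a = 0 else np a = ?par (nv a) \<and> nc a = c {?par (nv a), nv a}"
    proof cases
      case 1
      then show ?thesis using ep r by (auto simp: v_def p_def)
    next
      case (2 b)
      then show ?thesis using b(2)[OF 2(1)] nvb[OF 2(1)] by auto
    qed
  qed
  moreover have "\<forall>x\<in>insert v V0 - {r}. {?par x, x} \<in> E" using t(4) ep by auto
  ultimately show ?thesis using rt t(3) vV unfolding build_inv_def v_def by blast
qed

lemma build_closed: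
  assumes c: "connected_graph V E" and V0: "V0 \<subseteq> V" "r \<in> V0"
    and closed: "\<And>x y. {x, y} \<in> E \<Longrightarrow> x \<in> V0 \<Longrightarrow> y \<in> V0"
  shows "V0 = V"
proof
  show "V \<subseteq> V0"
  proof
    fix x assume "x \<in> V"
    then have "(r, x) \<in> (adj E)\<^sup>*" using c V0 by (auto simp: connected_graph_def)
    then show "x \<in> V0" by (induction rule: rtrancl_induct) (use V0 closed in \<open>auto simp: adj_def\<close>)
  qed
qed fact

text \<open>Every successful round adds one vertex, so the counter cannot run out before
  \<open>V\<close> is covered. If no edge is found, \<open>V0\<close> is closed under adjacency and
  equals \<open>V\<close> by connectedness.\<close>

lemma build_correct:
  assumes V: "simple_graph V E" "connected_graph V E" and es: "set (map (\<lambda>(u, v). {u, v}) es) = E"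
  shows "build_inv N V0 V E r c \<Longrightarrow> card V \<le> card V0 + length k \<Longrightarrow> build_inv (build c es k N) V V E r c"
proof (induction k arbitrary: N V0)
  case Nil
  then have "V0 \<subseteq> V" by (auto simp: build_inv_def)
  then have "V0 = V" using Nil V by (intro card_subset_eq) (auto simp: simple_graph_def dest: card_mono)
  then show ?case using Nil by simp
next
  case (Cons x k)
  have V0: "V0 \<subseteq> V" "nv ` set N = V0" "r \<in> V0" "finite V0"
    using Cons.prems rtree.root_in rtree.finite_V by (fastforce simp: build_inv_def tree_nodes_def)+
  show ?case
  proof (cases "find_edge c es (map nv N)")
    case None
    have "V0 = V"
      by (rule build_closed[OF V(2) V0(1,3)]) (use find_edge_None[OF None] es V0(2) in auto)
    then show ?thesis using Cons.prems None by simp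
  next
    case (Some e)
    have "nv e \<notin> V0" using find_edge_Some[OF Some] V0 by auto
    then have "card V \<le> card (insert (nv e) V0) + length k" using Cons.prems V0 by simp
    then show ?thesis using Cons.IH[OF build_step[OF Cons.prems(1) V(1) es Some]] Some by simp
  qed
qed

text \<open>The parent edges connect the endpoints of any edge through the root, so an edge of
  \<open>E\<close> that is not a parent edge would close a cycle.\<close>

lemma rtree_graph_of_tree:
  assumes tree: "is_tree V E" and rt: "rtree V r par D dep" and sub: "\<forall>v\<in>V - {r}. {par v, v} \<in> E"
  shows "rtree_graph V r par D dep E"
proof -
  interpret rtree V r par D dep by fact
  define F where "F = (\<lambda>v. {par v, v}) ` (V - {r})"
  have FE: "F \<subseteq> E" using sub by (auto simp: F_def)
  have root: "(r, x) \<in> (adj F)\<^sup>*" if "x \<in> V" for x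
    using that
  proof (induction "dep x" arbitrary: x rule: less_induct)
    case less
    show ?case
    proof (cases "x = r")
      case False
      then have "(r, par x) \<in> (adj F)\<^sup>*" using less.hyps dep_par par_in less.prems by auto
      moreover have "(par x, x) \<in> adj F" using less.prems False by (auto simp: adj_def F_def)
      ultimately show ?thesis by (rule rtrancl_into_rtrancl)
    qed simp
  qed
  have "E \<subseteq> F"
  proof
    fix e assume e: "e \<in> E"
    then have "card e = 2" "e \<subseteq> V" using tree by (auto simp: is_tree_def simple_graph_def)
    then obtain a b where ab: "e = {a, b}" "a \<noteq> b" "a \<in> V" "b \<in> V" by (auto simp: card_2_iff)
    show "e \<in> F"
    proof (rule ccontr)
      assume "e \<notin> F"
      then have "adj F \<subseteq> adj (E - {e})" using FE by (auto simp: adj_def)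
      moreover have "sym (adj F)" by (auto simp: sym_def adj_def insert_commute)
      then have "(a, r) \<in> (adj F)\<^sup>*" using root[OF ab(3)] by (metis symD sym_rtrancl)
      then have "(a, b) \<in> (adj F)\<^sup>*" using root[OF ab(4)] by (rule rtrancl_trans)
      ultimately have "(a, b) \<in> (adj (E - {e}))\<^sup>*" using rtrancl_mono by blast
      then show False using cycle_from_edge[of a b E] e ab tree by (auto simp: is_tree_def)
    qed
  qed
  then show ?thesis using FE by unfold_locales (auto simp: F_def)
qed

lemma build_tree:
  assumes tree: "is_tree V E" and en: "enumerates vs es V E"
  defines "r \<equiv> hd vs"
  obtains par D dep where "rtree_graph V r par D dep E"
    "tree_nodes (build c es vs [Nd r r 0 [r]]) V r par D c"
proof -
  have V: "simple_graph V E" "connected_graph V E" using tree by (auto simp: is_tree_def)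
  have vs: "set vs = V" "distinct vs" "set (map (\<lambda>(u, v). {u, v}) es) = E" using en by (auto simp: enumerates_def)
  have "vs \<noteq> []" using V(2) vs by (auto simp: connected_graph_def)
  then have r: "r \<in> V" using vs by (auto simp: r_def)
  have "build_inv [Nd r r 0 [r]] {r} V E r c"
    unfolding build_inv_def using r rtree_singleton[of r id "\<lambda>_. 0"]
    by (intro exI[of _ id] exI[of _ "\<lambda>_. {r}"] exI[of _ "\<lambda>_. 0"]) (auto simp: tree_nodes_def)
  moreover have "card V \<le> length vs" using vs card_length by metis
  ultimately have "build_inv (build c es vs [Nd r r 0 [r]]) V V E r c"
    by (intro build_correct[OF V vs(3)]) auto
  then show thesis using that rtree_graph_of_tree[OF tree] unfolding build_inv_def by blast
qed

section \<open>Correctness and cost\<close>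

text \<open>In contrast to \<open>leaf_cost\<close>, this follows the answers and not the leaf
  labels. It therefore makes sense for arbitrary subtrees of a decision tree, to which the lower
  bounds descend by induction.\<close>

fun path_cost :: "'a set set \<Rightarrow> ('a set \<Rightarrow> rat) \<Rightarrow> 'a dtree \<Rightarrow> 'a \<Rightarrow> rat" where
  "path_cost E c (Leaf y) x = 0"
| "path_cost E c (Node u v l r) x =
     c {u, v} + (if x \<in> side E {u, v} u then path_cost E c l x else path_cost E c r x)"

lemma search_in_leaves: "search E T x \<in> set (leaves T)"
  by (induction T) auto

lemma leaf_cost_eq_path_cost:
  "distinct (leaves T) \<Longrightarrow> search E T x = x \<Longrightarrow> leaf_cost c T x = path_cost E c T x"
proof (induction T)
  case (Node u v l r)
  show ?case
  proof (cases "x \<in> side E {u, v} u")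
    case True
    then have "x \<in> set (leaves l)" using Node.prems search_in_leaves[of E l x] by auto
    then show ?thesis using Node True by auto
  next
    case False
    then have "x \<in> set (leaves r)" using Node.prems search_in_leaves[of E r x] by auto
    then have "x \<notin> set (leaves l)" using Node.prems by auto
    then show ?thesis using Node False by auto
  qed
qed simp

definition sound :: "'a set set \<Rightarrow> ('a set \<Rightarrow> rat) \<Rightarrow> 'a set \<Rightarrow> rat \<Rightarrow> 'a dtree option \<Rightarrow> bool" where
  "sound E c X b R = (case R of None \<Rightarrow> X = {}
     | Some T \<Rightarrow> set (leaves T) = X \<and> distinct (leaves T) \<and> (\<forall>(u, v)\<in>node_labels T. {u, v} \<in> E) \<and>
         (\<forall>x\<in>X. search E T x = x \<and> path_cost E c T x \<le> b))"

lemma sound_mono: "sound E c X b R \<Longrightarrow> b \<le> b' \<Longrightarrow> sound E c X b' R"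
  by (fastforce simp: sound_def split: option.splits)

definition star_cost :: "nat \<Rightarrow> node list \<Rightarrow> rat" where
  "star_cost s L = sum_list (map nc (filter (\<lambda>e. nv e = s \<or> np e = s) L))"

locale node_tree = rtree_graph V r par D dep E
  for V :: "nat set" and r par D dep E +
  fixes N :: "node list" and c :: "nat set \<Rightarrow> rat"
  assumes nodes: "tree_nodes N V r par D c" and c_nonneg: "\<forall>e\<in>E. 0 \<le> c e"
begin

lemma node:
  assumes "e \<in> set N"
  shows "nv e \<in> V" "set (nd e) = D (nv e)" "nv e = r \<Longrightarrow> np e = r \<and> nc e = 0"
    "nv e \<noteq> r \<Longrightarrow> np e = par (nv e) \<and> nc e = c {par (nv e), nv e}"
  using nodes assms by (auto simp: tree_nodes_def split: if_splits)

lemma node_exists: "v \<in> V \<Longrightarrow> \<exists>e\<in>set N. nv e = v"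
  using nodes by (auto simp: tree_nodes_def)

lemma distinct_nodes: "distinct (map nv N)"
  using nodes by (auto simp: tree_nodes_def)

lemma edge_nonneg: "v \<in> V \<Longrightarrow> v \<noteq> r \<Longrightarrow> 0 \<le> c {par v, v}"
  using c_nonneg edges by auto

lemma nc_nonneg: "e \<in> set N \<Longrightarrow> 0 \<le> nc e"
  using node[of e] edge_nonneg[of "nv e"] by (cases "nv e = r") auto

lemma sound_mk:
  assumes e: "e \<in> set N" and X: "set X \<subseteq> V"
    and l: "sound E c (set (inner e X)) b1 l" and r': "sound E c (set (outer e X)) b2 r'"
  shows "sound E c (set X) (nc e + max b1 b2) (mk e l r')"
proof -
  note nd = node(2)[OF e]
  have le: "b1 \<le> nc e + max b1 b2" "b2 \<le> nc e + max b1 b2" using nc_nonneg[OF e] by auto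
  show ?thesis
  proof (cases l)
    case None
    then have "set X = set (outer e X)" using l by (auto simp: sound_def)
    then show ?thesis using sound_mono[OF r' le(2)] None by simp
  next
    case l: (Some T1)
    show ?thesis
    proof (cases r')
      case None
      then have "set X = set (inner e X)" using r' by (auto simp: sound_def)
      then show ?thesis using sound_mono[OF \<open>sound E c _ b1 l\<close> le(1)] None l by simp
    next
      case r: (Some T2)
      have s1: "set (leaves T1) = set (inner e X)" "distinct (leaves T1)" "\<forall>(u, v)\<in>node_labels T1. {u, v} \<in> E"
         "\<forall>x\<in>set (inner e X). search E T1 x = x \<and> path_cost E c T1 x \<le> b1"
        and s2: "set (leaves T2) = set (outer e X)" "distinct (leaves T2)" "\<forall>(u, v)\<in>node_labels T2. {u, v} \<in> E"
         "\<forall>x\<in>set (outer e X). search E T2 x = x \<and> path_cost E c T2 x \<le> b2"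
        using \<open>sound E c _ b1 l\<close> \<open>sound E c _ b2 r'\<close> l r by (auto simp: sound_def)
      have "set (outer e X) \<noteq> {}" using s2(1) search_in_leaves[of E T2] by force
      \<comment> \<open>The record of the root has all of \<open>V\<close> as descendants and splits
        nothing; a node that is really built thus carries a genuine edge.\<close>
      then have ne: "nv e \<noteq> r" using nd X D_root by auto
      note ed = node(4)[OF e ne] node(1)[OF e]
      have sd: "side E {nv e, np e} (nv e) = D (nv e)"
        using side_child[OF ed(2) ne] ed(1) by (simp add: insert_commute)
      have ced: "{nv e, np e} \<in> E" "c {nv e, np e} = nc e" using ed ne edges by (auto simp: insert_commute)
      have "search E (Node (nv e) (np e) T1 T2) x = x \<and> path_cost E c (Node (nv e) (np e) T1 T2) x \<le> nc e + max b1 b2"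
        if "x \<in> set X" for x
        using s1(4) s2(4) that sd nd ced by (cases "x \<in> D (nv e)") (auto simp: le_max_iff_disj)
      then show ?thesis using s1(1,2,3) s2(1,2,3) ced l r unfolding sound_def by auto
    qed
  qed
qed

text \<open>The edges at \<open>s\<close> are queried one after another, and at most one component
  is entered, so \<open>B\<close> is paid once. For the induction over \<open>L\<close>, the last
  assumption says that each remaining candidate other than \<open>s\<close> is still separated from
  \<open>s\<close> by an edge to come.\<close>

lemma sound_star:
  assumes F: "\<And>Y. length Y < M \<Longrightarrow> set Y \<subseteq> V \<Longrightarrow> distinct Y \<Longrightarrow> sound E c (set Y) B (F Y)" and B: "0 \<le> B"
  shows "set L \<subseteq> set N \<Longrightarrow> set X \<subseteq> V \<Longrightarrow> distinct X \<Longrightarrow>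
    \<forall>e\<in>set L. nv e = s \<longrightarrow> length (outer e X) < M \<Longrightarrow>
    \<forall>e\<in>set L. nv e \<noteq> s \<and> np e = s \<longrightarrow> length (inner e X) < M \<Longrightarrow>
    \<forall>x\<in>set X. x = s \<or> (\<exists>e\<in>set L. nv e = s \<and> x \<notin> set (nd e) \<or> nv e \<noteq> s \<and> np e = s \<and> x \<in> set (nd e)) \<Longrightarrow>
    sound E c (set X) (star_cost s L + B) (star F s L X)"
proof (induction L arbitrary: X)
  case Nil
  then have "set X \<subseteq> {s}" by auto
  then have "X = [] \<or> X = [s]" using Nil(3) by (cases X; cases "tl X") auto
  then show ?case using B by (auto simp: sound_def star_cost_def)
next
  case (Cons e L)
  have e: "e \<in> set N" and L: "set L \<subseteq> set N" using Cons.prems by auto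
  have filt: "length (filter P (filter Q X)) \<le> length (filter P X)" for P Q by (induction X) auto
  have IH: "sound E c (set (filter Q X)) (star_cost s L + B) (star F s L (filter Q X))"
    if "\<And>x. x \<in> set X \<Longrightarrow> Q x \<Longrightarrow> x = s \<or> (\<exists>e\<in>set L. nv e = s \<and> x \<notin> set (nd e) \<or> nv e \<noteq> s \<and> np e = s \<and> x \<in> set (nd e))" for Q
  proof (rule Cons.IH[OF L])
    show "set (filter Q X) \<subseteq> V" "distinct (filter Q X)" using Cons.prems by auto
    show "\<forall>e\<in>set L. nv e = s \<longrightarrow> length (outer e (filter Q X)) < M"
      "\<forall>e\<in>set L. nv e \<noteq> s \<and> np e = s \<longrightarrow> length (inner e (filter Q X)) < M"
      using Cons.prems(4,5) by (meson filt le_less_trans list.set_intros(2))+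
    show "\<forall>x\<in>set (filter Q X). x = s \<or> (\<exists>e\<in>set L. nv e = s \<and> x \<notin> set (nd e) \<or> nv e \<noteq> s \<and> np e = s \<and> x \<in> set (nd e))"
      using that by simp
  qed
  have sc: "0 \<le> star_cost s L" unfolding star_cost_def using nc_nonneg L by (intro sum_list_nonneg) auto
  consider "nv e = s" | "nv e \<noteq> s" "np e = s" | "nv e \<noteq> s" "np e \<noteq> s" by blast
  then show ?case
  proof cases
    case 1
    have "sound E c (set X) (nc e + max (star_cost s L + B) B) (mk e (star F s L (inner e X)) (F (outer e X)))"
    proof (rule sound_mk[OF e Cons.prems(2)])
      show "sound E c (set (inner e X)) (star_cost s L + B) (star F s L (inner e X))"
        by (rule IH) (use Cons.prems(6) 1 in auto)
      show "sound E c (set (outer e X)) B (F (outer e X))" by (rule F) (use Cons.prems 1 in auto)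
    qed
    moreover have "max (star_cost s L + B) B = star_cost s L + B" using sc by simp
    ultimately show ?thesis using 1 by (simp add: star_cost_def add.assoc)
  next
    case 2
    have "sound E c (set X) (nc e + max B (star_cost s L + B)) (mk e (F (inner e X)) (star F s L (outer e X)))"
    proof (rule sound_mk[OF e Cons.prems(2)])
      show "sound E c (set (outer e X)) (star_cost s L + B) (star F s L (outer e X))"
        by (rule IH) (use Cons.prems(6) 2 in auto)
      show "sound E c (set (inner e X)) B (F (inner e X))" by (rule F) (use Cons.prems 2 in auto)
    qed
    moreover have "max B (star_cost s L + B) = star_cost s L + B" using sc by simp
    ultimately show ?thesis using 2 by (simp add: star_cost_def add.assoc)
  next
    case 3
    have "sound E c (set (filter (\<lambda>_. True) X)) (star_cost s L + B) (star F s L (filter (\<lambda>_. True) X))"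
      by (rule IH) (use Cons.prems(6) 3 in auto)
    then show ?thesis using 3 by (simp add: star_cost_def)
  qed
qed

text \<open>Only the edge \<open>{par v, v}\<close> separates its endpoints, so every edge at \<open>s\<close> is queried on
  the path to \<open>s\<close>.\<close>

lemma star_lower_bound:
  assumes s: "s \<in> V"
  shows "\<forall>(u, v)\<in>node_labels T. {u, v} \<in> E \<Longrightarrow> B \<subseteq> {v \<in> V - {r}. v = s \<or> par v = s} \<Longrightarrow>
    \<forall>v\<in>B. search E T s \<noteq> search E T (if v = s then par s else v) \<Longrightarrow>
    (\<Sum>v\<in>B. c {par v, v}) \<le> path_cost E c T s"
proof (induction T arbitrary: B)
  case (Leaf x)
  then have "B = {}" by auto
  then show ?case by simp
next
  case (Node u w T1 T2)
  define o' where "o' v = (if v = s then par s else v)" for v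
  have fin: "finite B" by (rule finite_subset[OF Node.prems(2)]) (use finite_V in simp)
  have BV: "v \<in> V" "v \<noteq> r" "v = s \<or> par v = s" "search E (Node u w T1 T2) s \<noteq> search E (Node u w T1 T2) (o' v)"
    if "v \<in> B" for v
    using that Node.prems(2,3) unfolding o'_def by blast+
  have "{u, w} \<in> E" using Node.prems by auto
  then obtain v0 where v0: "v0 \<in> V" "v0 \<noteq> r" "{u, w} = {par v0, v0}" "u = v0 \<and> w = par v0 \<or> u = par v0 \<and> w = v0"
    by (rule edge_cases)
  have side: "side E {u, w} u = D v0 \<or> side E {u, w} u = V - D v0"
    using v0(4)
  proof
    assume "u = v0 \<and> w = par v0"
    then show ?thesis using side_child[OF v0(1,2)] v0(3) by simp
  next
    assume "u = par v0 \<and> w = v0"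
    then show ?thesis using side_parent[OF v0(1,2)] by simp
  qed
  have same: "s \<in> side E {u, w} u \<longleftrightarrow> o' v \<in> side E {u, w} u" if "v \<in> B - {v0}" for v
  proof -
    have v: "v \<in> V" "v \<noteq> r" "v \<noteq> v0" "v = s \<or> par v = s" using that BV by auto
    have "v \<in> D v0 \<longleftrightarrow> par v \<in> D v0" using D_iff[OF v0(1) v(1,2)] v(3) by auto
    then have "s \<in> D v0 \<longleftrightarrow> o' v \<in> D v0" "o' v \<in> V" using v(1,4) par_in[OF v(1,2)] by (auto simp: o'_def)
    then show ?thesis using side s by blast
  qed
  have "(\<Sum>v\<in>B. c {par v, v}) \<le> c {par v0, v0} + (\<Sum>v\<in>B - {v0}. c {par v, v})"
    using edge_nonneg[OF v0(1,2)] fin by (cases "v0 \<in> B") (auto simp: sum.remove)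
  also have "(\<Sum>v\<in>B - {v0}. c {par v, v}) \<le> (if s \<in> side E {u, w} u then path_cost E c T1 s else path_cost E c T2 s)"
  proof (cases "s \<in> side E {u, w} u")
    case True
    have "search E T1 s \<noteq> search E T1 (o' v)" if "v \<in> B - {v0}" for v
      using BV(4)[of v] same[OF that] True that by simp
    then have "(\<Sum>v\<in>B - {v0}. c {par v, v}) \<le> path_cost E c T1 s"
      unfolding o'_def by (intro Node.IH(1)) (use Node.prems(1,2) in auto)
    then show ?thesis using True by simp
  next
    case False
    have "search E T2 s \<noteq> search E T2 (o' v)" if "v \<in> B - {v0}" for v
      using BV(4)[of v] same[OF that] False that by simp
    then have "(\<Sum>v\<in>B - {v0}. c {par v, v}) \<le> path_cost E c T2 s"
      unfolding o'_def by (intro Node.IH(2)) (use Node.prems(1,2) in auto)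
    then show ?thesis using False by simp
  qed
  finally show ?case using v0(3) by simp
qed

lemma star_cost_le:
  assumes T: "decision_tree V E T" and s: "s \<in> V"
  shows "star_cost s N \<le> path_cost E c T s"
proof -
  define P where "P e \<longleftrightarrow> nv e = s \<or> np e = s" for e
  define B where "B = {v \<in> V - {r}. v = s \<or> par v = s}"
  have inj: "inj_on nv (set N)" and dN: "distinct N" using distinct_nodes by (auto simp: distinct_map)
  have "star_cost s N = (\<Sum>e\<in>{e \<in> set N. P e}. nc e)"
    using dN by (simp add: star_cost_def P_def sum_list_distinct_conv_sum_set)
  also have "\<dots> = (\<Sum>e\<in>{e \<in> set N. P e \<and> nv e \<noteq> r}. nc e)"
    by (rule sum.mono_neutral_right) (use node(3) in auto)
  also have "\<dots> = (\<Sum>e\<in>{e \<in> set N. P e \<and> nv e \<noteq> r}. c {par (nv e), nv e})"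
    by (rule sum.cong) (use node(4) in auto)
  also have "\<dots> = (\<Sum>v\<in>nv ` {e \<in> set N. P e \<and> nv e \<noteq> r}. c {par v, v})"
    using inj by (subst sum.reindex) (auto intro: inj_on_subset)
  also have "nv ` {e \<in> set N. P e \<and> nv e \<noteq> r} = B"
  proof
    show "nv ` {e \<in> set N. P e \<and> nv e \<noteq> r} \<subseteq> B" 
      using node(1,4) by (force simp: B_def P_def)
    show "B \<subseteq> nv ` {e \<in> set N. P e \<and> nv e \<noteq> r}"
    proof
      fix v assume v: "v \<in> B"
      then obtain e where e: "e \<in> set N" "nv e = v" using node_exists by (auto simp: B_def)
      then show "v \<in> nv ` {e \<in> set N. P e \<and> nv e \<noteq> r}" using v node(4)[OF e(1)] by (auto simp: B_def P_def)
    qed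
  qed
  also have "(\<Sum>v\<in>B. c {par v, v}) \<le> path_cost E c T s"
  proof (rule star_lower_bound[OF s])
    show "\<forall>(u, v)\<in>node_labels T. {u, v} \<in> E" using T by (auto simp: decision_tree_def)
    show "B \<subseteq> {v \<in> V - {r}. v = s \<or> par v = s}" by (simp add: B_def)
    show "\<forall>v\<in>B. search E T s \<noteq> search E T (if v = s then par s else v)"
    proof
      fix v assume v: "v \<in> B"
      then have v': "v \<in> V" "v \<noteq> r" by (auto simp: B_def)
      then have "par v \<noteq> v" "par v \<in> V" using dep_par[of v] par_in[of v] by auto
      then have o': "(if v = s then par s else v) \<in> V" "(if v = s then par s else v) \<noteq> s"
        using v' by auto
      have "search E T x = x" if "x \<in> V" for x using T that by (simp add: decision_tree_def)
      from this[OF o'(1)] this[OF s] o'(2) show "search E T s \<noteq> search E T (if v = s then par s else v)"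
        by metis
    qed
  qed
  finally show ?thesis .
qed

end

section \<open>Lower bound for telling the separators apart\<close>

context node_tree
begin

lemma incident_separates:
  assumes s: "s \<in> V"
  shows "x = s \<or> (\<exists>e\<in>set N. nv e = s \<and> x \<notin> set (nd e) \<or> nv e \<noteq> s \<and> np e = s \<and> x \<in> set (nd e))"
proof -
  obtain es where es: "es \<in> set N" "nv es = s" using node_exists[OF s] by auto
  consider "x = s" | "x \<notin> D s" | "x \<noteq> s" "x \<in> D s" by blast
  then show ?thesis
  proof cases
    case 2
    then show ?thesis using es node(2)[OF es(1)] by auto
  next
    case 3
    then obtain w where w: "w \<in> V" "w \<noteq> r" "par w = s" "x \<in> D w" using child_towards[OF s] by metis
    obtain e where e: "e \<in> set N" "nv e = w" using node_exists[OF w(1)] by auto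
    have "w \<noteq> s" using w dep_par[of w] by auto
    then show ?thesis using e w node(2,4)[OF e(1)] by auto
  qed simp
qed

text \<open>The second assumption says that \<open>K\<close> has, for every edge \<open>{par v, v}\<close>, a cheapest edge that
  splits \<open>S\<close> in the same way.\<close>

lemma plan_lower_bound:
  assumes K: "set K \<subseteq> set N"
    and rep: "\<And>v. v \<in> V \<Longrightarrow> v \<noteq> r \<Longrightarrow> S \<inter> D v \<noteq> {} \<Longrightarrow>
      \<exists>e\<in>set K. nc e \<le> c {par v, v} \<and> (\<forall>a\<in>S. a \<in> D (nv e) \<longleftrightarrow> a \<in> D v)"
    and S: "S \<subseteq> V"
  shows "\<forall>(u, v)\<in>node_labels T. {u, v} \<in> E \<Longrightarrow> set A \<subseteq> S \<Longrightarrow> A \<noteq> [] \<Longrightarrow> inj_on (search E T) (set A) \<Longrightarrow>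
    \<exists>x\<in>set A. pcost (plan K A K) \<le> path_cost E c T x"
proof (induction T arbitrary: A)
  case (Leaf y)
  have eq: "x = x'" if "x \<in> set A" "x' \<in> set A" for x x'
    using inj_onD[OF Leaf.prems(4) _ that] by simp
  have "plan K A K = PLeaf"
  proof (cases rule: plan_cases[of K A K])
    case (2 e)
    then obtain x x' where "x \<in> set A" "x \<in> set (nd e)" "x' \<in> set A" "x' \<notin> set (nd e)"
      by (auto simp: filter_empty_conv)
    then show ?thesis using eq[of x x'] by simp
  qed
  moreover obtain x where "x \<in> set A" using Leaf.prems(3) by (cases A) auto
  ultimately show ?case by auto
next
  case (Node u w T1 T2)
  let ?Q = "side E {u, w} u"
  have "{u, w} \<in> E" using Node.prems by auto
  then obtain v where v: "v \<in> V" "v \<noteq> r" "{u, w} = {par v, v}" "u = v \<and> w = par v \<or> u = par v \<and> w = v"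
    by (rule edge_cases)
  have cuw: "0 \<le> c {u, w}" using edge_nonneg[OF v(1,2)] v(3) by simp
  have AV: "set A \<subseteq> V" using Node.prems(2) S by auto
  have labels: "\<forall>(u, v)\<in>node_labels T1. {u, v} \<in> E" "\<forall>(u, v)\<in>node_labels T2. {u, v} \<in> E"
    using Node.prems(1) by auto
  have inj: "search E (Node u w T1 T2) x \<noteq> search E (Node u w T1 T2) y" if "x \<in> set A" "y \<in> set A" "x \<noteq> y" for x y
    using inj_onD[OF Node.prems(4) _ that(1,2)] that(3) by blast
  have IH1: "\<exists>x\<in>set B. pcost (plan K B K) \<le> path_cost E c T1 x" if "B \<noteq> []" "set B \<subseteq> set A" "set B \<subseteq> ?Q" for B
  proof (rule Node.IH(1)[OF labels(1) _ that(1)])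
    show "set B \<subseteq> S" using that Node.prems by auto
    show "inj_on (search E T1) (set B)"
    proof (rule inj_onI, rule ccontr)
      fix x y assume xy: "x \<in> set B" "y \<in> set B" "search E T1 x = search E T1 y" "x \<noteq> y"
      have "x \<in> ?Q" "y \<in> ?Q" "x \<in> set A" "y \<in> set A" using xy that by auto
      then show False using inj[of x y] xy by simp
    qed
  qed
  have IH2: "\<exists>x\<in>set B. pcost (plan K B K) \<le> path_cost E c T2 x" if "B \<noteq> []" "set B \<subseteq> set A" "set B \<inter> ?Q = {}" for B
  proof (rule Node.IH(2)[OF labels(2) _ that(1)])
    show "set B \<subseteq> S" using that Node.prems by auto
    show "inj_on (search E T2) (set B)"
    proof (rule inj_onI, rule ccontr)
      fix x y assume xy: "x \<in> set B" "y \<in> set B" "search E T2 x = search E T2 y" "x \<noteq> y"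
      have "x \<notin> ?Q" "y \<notin> ?Q" "x \<in> set A" "y \<in> set A" using xy that by auto
      then show False using inj[of x y] xy by simp
    qed
  qed
  define A1 A2 where "A1 = filter (\<lambda>x. x \<in> ?Q) A" and "A2 = filter (\<lambda>x. x \<notin> ?Q) A"
  show ?case
  \<comment> \<open>A query of \<open>T\<close> that does not split \<open>A\<close> is skipped,
    which cannot raise the cost. Any other query is replaced by a representative in
    \<open>K\<close>, which splits \<open>A\<close> alike and is not more expensive.\<close>
  proof (cases "A1 = [] \<or> A2 = []")
    case True
    then consider "set A \<subseteq> ?Q" | "set A \<inter> ?Q = {}" by (auto simp: A1_def A2_def filter_empty_conv)
    then show ?thesis
    proof cases
      case 1
      then obtain x where "x \<in> set A" "pcost (plan K A K) \<le> path_cost E c T1 x"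
        using IH1[of A] Node.prems(3) by auto
      then show ?thesis using 1 cuw by (intro bexI[of _ x]) auto
    next
      case 2
      then obtain x where x: "x \<in> set A" "pcost (plan K A K) \<le> path_cost E c T2 x"
        using IH2[of A] Node.prems(3) by auto
      then have "x \<notin> ?Q" using 2 by auto
      then show ?thesis using x cuw by (intro bexI[of _ x]) auto
    qed
  next
    case False
    obtain x1 where x1: "x1 \<in> set A1" "pcost (plan K A1 K) \<le> path_cost E c T1 x1"
      using IH1[of A1] False by (auto simp: A1_def)
    obtain x2 where x2: "x2 \<in> set A2" "pcost (plan K A2 K) \<le> path_cost E c T2 x2"
      using IH2[of A2] False by (auto simp: A2_def)
    have io: "A1 = filter (\<lambda>x. x \<in> D v) A \<and> A2 = filter (\<lambda>x. x \<notin> D v) A \<or>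
      A2 = filter (\<lambda>x. x \<in> D v) A \<and> A1 = filter (\<lambda>x. x \<notin> D v) A"
      using v(4)
    proof
      assume "u = v \<and> w = par v"
      then have "?Q = D v" using side_child[OF v(1,2)] v(3) by simp
      then show ?thesis by (simp add: A1_def A2_def)
    next
      assume "u = par v \<and> w = v"
      then have "?Q = V - D v" using side_parent[OF v(1,2)] by simp
      then show ?thesis using AV by (auto simp: A1_def A2_def intro!: filter_cong)
    qed
    have "filter (\<lambda>x. x \<in> D v) A \<noteq> []" using io False by metis
    then have "S \<inter> D v \<noteq> {}" using Node.prems(2) by (auto simp: filter_empty_conv)
    then obtain e where e: "e \<in> set K" "nc e \<le> c {par v, v}" "\<forall>a\<in>S. a \<in> D (nv e) \<longleftrightarrow> a \<in> D v"
      using rep[OF v(1,2)] by blast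
    have nd: "set (nd e) = D (nv e)" using node(2) e(1) K by auto
    have "inner e A = filter (\<lambda>x. x \<in> D v) A" "outer e A = filter (\<lambda>x. x \<notin> D v) A"
      using nd e(3) Node.prems(2) by (auto intro!: filter_cong)
    then have io': "inner e A = A1 \<and> outer e A = A2 \<or> inner e A = A2 \<and> outer e A = A1" using io by metis
    have "pcost (plan K A K) \<le> nc e + max (pcost (plan K (inner e A) K)) (pcost (plan K (outer e A) K))"
      using False io' by (intro plan_le[OF e(1)]) auto
    also have "max (pcost (plan K (inner e A) K)) (pcost (plan K (outer e A) K)) =
        max (pcost (plan K A1 K)) (pcost (plan K A2 K))"
      using io' by (auto simp: max.commute)
    finally have le: "pcost (plan K A K) \<le> c {u, w} + max (pcost (plan K A1 K)) (pcost (plan K A2 K))"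
      using e(2) v(3) by simp
    have "x1 \<in> ?Q" "x1 \<in> set A" "x2 \<notin> ?Q" "x2 \<in> set A" using x1 x2 by (auto simp: A1_def A2_def)
    then show ?thesis
    proof (cases "pcost (plan K A1 K) \<le> pcost (plan K A2 K)")
      case True
      then show ?thesis using le x2 \<open>x2 \<notin> ?Q\<close> \<open>x2 \<in> set A\<close> by (intro bexI[of _ x2]) auto
    next
      case False
      then show ?thesis using le x1 \<open>x1 \<in> ?Q\<close> \<open>x1 \<in> set A\<close> by (intro bexI[of _ x1]) auto
    qed
  qed
qed

end

section \<open>A single phase\<close>

locale weighted_node_tree = node_tree + rtree_weight V r par D dep X0 m for X0 m
begin

lemma fv_eq: "e \<in> set N \<Longrightarrow> fv X0 m e = f (nv e)"
  using node(2)[of e] by (simp add: fv_def f_def g_def)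

lemma set_seps: "nv ` set (seps N X0 m N) = S"
proof
  show "nv ` set (seps N X0 m N) \<subseteq> S"
  proof
    fix v assume "v \<in> nv ` set (seps N X0 m N)"
    then obtain e where e: "e \<in> set N" "nv e = v" "0 < fv X0 m e"
      "\<forall>e'\<in>set N. nv e' \<in> set (nd e) \<longrightarrow> nv e' = nv e \<or> fv X0 m e' < fv X0 m e"
      by (auto simp: seps_def)
    have v: "v \<in> V" using node(1)[OF e(1)] e(2) by simp
    have "w = v \<or> f w < f v" if w: "w \<in> D v" for w
    proof -
      have "w \<in> V" using w v D_subset by auto
      then obtain e' where e': "e' \<in> set N" "nv e' = w" using node_exists by auto
      then have "nv e' \<in> set (nd e)" using w node(2)[OF e(1)] e(2) by simp
      then show ?thesis using e(4) e' e(2) fv_eq[OF e(1)] fv_eq[OF e'(1)] by force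
    qed
    then show "v \<in> S" using v e fv_eq[OF e(1)] by (auto simp: S_def)
  qed
  show "S \<subseteq> nv ` set (seps N X0 m N)"
  proof
    fix v assume v: "v \<in> S"
    then have "v \<in> V" using S_subset by auto
    then obtain e where e: "e \<in> set N" "nv e = v" using node_exists by auto
    have "nv e' = nv e \<or> fv X0 m e' < fv X0 m e" if "e' \<in> set N" "nv e' \<in> set (nd e)" for e'
      using that v e node(2)[OF e(1)] fv_eq[OF e(1)] fv_eq[OF that(1)] by (auto simp: S_def)
    then have "e \<in> set (seps N X0 m N)" using e v fv_eq[OF e(1)] by (auto simp: seps_def S_def)
    then show "v \<in> nv ` set (seps N X0 m N)" using e by auto
  qed
qed

lemma distinct_seps: "distinct (map nv (seps N X0 m N))"
  using distinct_nodes by (simp add: seps_def distinct_map_filter)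

lemma length_seps: "length (seps N X0 m N) = card S"
  using distinct_card[OF distinct_seps] set_seps by simp

lemma card_S_le_div: "card S \<le> 2 * (length X0 div m)"
proof (cases "f r = 0")
  case True
  have "0 < f s \<and> f s \<le> f r" if "s \<in> S" for s
    using that S_subset D_root D_subset[of s] by (auto simp: S_def intro: f_mono)
  then have "S = {}" using True by fastforce
  then show ?thesis by simp
next
  case False
  have "S \<inter> D r = S" using S_subset D_root by auto
  then have "card S \<le> 2 * f r" using card_S_le[OF root_in] False by simp
  also have "f r \<le> length X0 div m" unfolding f_def g_def by (intro div_le_mono) simp
  finally show ?thesis by simp
qed

definition K where "K = map (\<lambda>s. best X0 m s N s) (seps N X0 m N)"

lemma K_nodes: "set K \<subseteq> set N"
  unfolding K_def by (rule set_bests) (auto simp: seps_def)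

text \<open>For \<open>u\<close> the lowest vertex of \<open>D v\<close> with value
  \<open>f v\<close>, the record of \<open>v\<close> itself competes in the search of
  \<open>best\<close> for \<open>u\<close>. By \<open>same_class\<close>, both the winner and
  \<open>v\<close> split \<open>S\<close> exactly like \<open>u\<close>.\<close>

lemma K_representatives:
  assumes v: "v \<in> V" "v \<noteq> r" and ne: "S \<inter> D v \<noteq> {}"
  shows "\<exists>e\<in>set K. nc e \<le> c {par v, v} \<and> (\<forall>a\<in>S. a \<in> D (nv e) \<longleftrightarrow> a \<in> D v)"
proof -
  obtain a where a: "a \<in> S" "a \<in> D v" using ne by auto
  then have "0 < f v" using f_mono[OF D_trans[OF v(1) a(2)]] by (auto simp: S_def)
  then obtain u where u: "u \<in> S" "u \<in> D v" "f u = f v" using lowest_in_S[OF v(1)] by auto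
  obtain s where s: "s \<in> set (seps N X0 m N)" "nv s = u" using u(1) set_seps by (metis imageE)
  then have sN: "s \<in> set N" by (auto simp: seps_def)
  define e where "e = best X0 m s N s"
  have e: "e \<in> set K" using s(1) by (auto simp: K_def e_def)
  then have eN: "e \<in> set N" using K_nodes by auto
  have "nv s \<in> set (nd s)" using node(1,2)[OF sN] D_refl by simp
  then have cl: "nv s \<in> set (nd e)" "fv X0 m e = fv X0 m s" using best_class[of s s X0 m N] by (auto simp: e_def)
  obtain ev where ev: "ev \<in> set N" "nv ev = v" using node_exists[OF v(1)] by auto
  have "nc e \<le> nc ev" unfolding e_def
    by (rule best_le_class[OF ev(1)]) (use ev s u node(2)[OF ev(1)] fv_eq[OF ev(1)] fv_eq[OF sN] in auto)
  also have "nc ev = c {par v, v}" using node(4)[OF ev(1)] ev(2) v(2) by simp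
  finally have le: "nc e \<le> c {par v, v}" .
  have ue: "u \<in> D (nv e)" "f (nv e) = f u"
    using cl s(2) node(2)[OF eN] fv_eq[OF eN] fv_eq[OF sN] by auto
  have "b \<in> D (nv e) \<longleftrightarrow> b \<in> D v" if "b \<in> S" for b
    using same_class[OF u(1) node(1)[OF eN] ue that] same_class[OF u(1) v(1) u(2) u(3)[symmetric] that] by simp
  then show ?thesis using e le by auto
qed

text \<open>\<open>R\<close> collects the vertices consistent with the answers so far;
  \<open>A\<close> and \<open>X\<close> are its separators and candidates. At a leaf one separator
  is left, so \<open>up_small\<close> and \<open>down_small\<close> show that the components around
  it are small enough for \<open>F\<close>.\<close>

lemma sound_expand:
  assumes F: "\<And>Y. length Y < m \<Longrightarrow> set Y \<subseteq> V \<Longrightarrow> distinct Y \<Longrightarrow> sound E c (set Y) B (F Y)" and B: "0 \<le> B"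
    and star: "\<And>s. s \<in> V \<Longrightarrow> star_cost s N \<le> M" and X0: "set X0 \<subseteq> V" "distinct X0"
  shows "cut_off R \<Longrightarrow> set A = R \<inter> S \<Longrightarrow> A \<noteq> [] \<Longrightarrow> X = filter (\<lambda>x. x \<in> R) X0 \<Longrightarrow>
    sound E c (set X) (pcost (plan K A K) + (M + B)) (expand F N A (plan K A K) X)"
proof (induction "length A" arbitrary: A R X rule: less_induct)
  case less
  show ?case
  proof (cases rule: plan_cases[of K A K])
    case 1
    \<comment> \<open>Of two distinct separators one is not below the other, so some representative
      splits them, which contradicts \<open>PLeaf\<close>.\<close>
    have eq: "a = b" if ab: "a \<in> set A" "b \<in> set A" for a b
    proof (rule ccontr)
      assume "a \<noteq> b"
      moreover have abS: "a \<in> S" "b \<in> S" "a \<in> V" "b \<in> V" using ab less.prems(2) S_subset by auto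
      ultimately have "a \<notin> D b \<or> b \<notin> D a" using D_antisym[of a b] by auto
      then obtain x y where xy: "x \<in> set A" "y \<in> set A" "y \<notin> D x" "x \<in> V" "y \<in> V" "x \<in> S" "y \<in> S"
        using ab abS by blast
      have xr: "x \<noteq> r" using xy D_root by auto
      have "S \<inter> D x \<noteq> {}" using xy D_refl by auto
      then obtain e where e: "e \<in> set K" "\<forall>a\<in>S. a \<in> D (nv e) \<longleftrightarrow> a \<in> D x"
        using K_representatives[OF xy(4) xr] by auto
      have "set (nd e) = D (nv e)" using node(2) K_nodes e(1) by auto
      then have "x \<in> set (inner e A)" "y \<in> set (outer e A)" using e(2) xy D_refl by auto
      then have "inner e A \<noteq> []" "outer e A \<noteq> []" by (metis empty_iff empty_set)+
      then show False using plan_Leaf[OF 1 e(1)] by auto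
    qed
    obtain s A' where A: "A = s # A'" using less.prems(3) by (cases A) auto
    have "set A = {s}" using eq[of _ s] A by auto
    then have Rs: "R \<inter> S = {s}" using less.prems(2) by simp
    then have s: "s \<in> V" "s \<in> R" using S_subset by auto
    have "sound E c (set X) (star_cost s N + B) (star F s N X)"
    proof (rule sound_star[OF F B])
      show "set N \<subseteq> set N" by simp
      show "set X \<subseteq> V" "distinct X" using X0 less.prems(4) by auto
      show "\<forall>e\<in>set N. nv e = s \<longrightarrow> length (outer e X) < m"
        using up_small[OF less.prems(1) Rs] node(2) less.prems(4) by (auto simp: conj_commute)
      show "\<forall>e\<in>set N. nv e \<noteq> s \<and> np e = s \<longrightarrow> length (inner e X) < m"
      proof (intro ballI impI)
        fix e assume e: "e \<in> set N" "nv e \<noteq> s \<and> np e = s"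
        then have "nv e \<noteq> r" using node(3)[OF e(1)] by auto
        then show "length (inner e X) < m"
          using down_small[OF less.prems(1) Rs node(1)[OF e(1)]] node(2,4)[OF e(1)] e(2) less.prems(4)
          by (simp add: conj_commute)
      qed
      show "\<forall>x\<in>set X. x = s \<or> (\<exists>e\<in>set N. nv e = s \<and> x \<notin> set (nd e) \<or> nv e \<noteq> s \<and> np e = s \<and> x \<in> set (nd e))"
        using incident_separates[OF s(1)] by blast
    qed auto
    then have "sound E c (set X) (M + B) (star F s N X)"
      by (rule sound_mono) (use star[OF s(1)] in simp)
    then show ?thesis using A 1 by simp
  next
    case (2 e)
    have eN: "e \<in> set N" using 2(1) K_nodes by auto
    note nd = node(1,2)[OF eN]
    have i: "sound E c (set (inner e X)) (pcost (plan K (inner e A) K) + (M + B))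
       (expand F N (inner e A) (plan K (inner e A) K) (inner e X))"
    proof (rule less.hyps[of _ "R \<inter> D (nv e)"])
      show "length (inner e A) < length A" using length_inner_less[OF 2(3)] .
      show "cut_off (R \<inter> D (nv e))" by (rule cut_off_split(1)[OF less.prems(1) nd(1)])
      show "set (inner e A) = R \<inter> D (nv e) \<inter> S" using less.prems(2) nd(2) by auto
      show "inner e X = filter (\<lambda>x. x \<in> R \<inter> D (nv e)) X0"
        using less.prems(4) nd(2) by (simp add: conj_commute)
    qed fact
    have o: "sound E c (set (outer e X)) (pcost (plan K (outer e A) K) + (M + B))
       (expand F N (outer e A) (plan K (outer e A) K) (outer e X))"
    proof (rule less.hyps[of _ "R - D (nv e)"])
      show "length (outer e A) < length A" using length_outer_less[OF 2(2)] .
      show "cut_off (R - D (nv e))" by (rule cut_off_split(2)[OF less.prems(1) nd(1)])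
      show "set (outer e A) = (R - D (nv e)) \<inter> S" using less.prems(2) nd(2) by auto
      show "outer e X = filter (\<lambda>x. x \<in> R - D (nv e)) X0"
        using less.prems(4) nd(2) by (simp add: conj_commute)
    qed fact
    have "set X \<subseteq> V" using X0 less.prems(4) by auto
    from sound_mk[OF eN this i o] show ?thesis
      unfolding 2(4) by (simp add: add.assoc max_add_distrib_left[symmetric])
  qed
qed

end

section \<open>All phases together\<close>

context node_tree
begin

text \<open>Components have fewer than \<open>m\<close> candidates, so a phase lowers the exponent
  \<open>j\<close> by one. It costs at most \<open>opt\<close> for the plan and \<open>opt\<close>
  for the star, both measured against the same \<open>T\<close>.\<close>

lemma sound_solve:
  assumes T: "decision_tree V E T" and opt: "\<And>x. x \<in> V \<Longrightarrow> path_cost E c T x \<le> opt" and t: "2 \<le> t"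
  shows "length X < t ^ j \<Longrightarrow> j \<le> length k \<Longrightarrow> set X \<subseteq> V \<Longrightarrow> distinct X \<Longrightarrow>
    sound E c (set X) (2 * of_nat j * opt) (solve t N k X)"
proof (induction k arbitrary: X j)
  case Nil
  then show ?case by (simp add: sound_def)
next
  case (Cons a k)
  show ?case
  proof (cases "X = []")
    case True
    then show ?thesis by (simp add: sound_def)
  next
    case False
    define m where "m = length X div t + 1"
    obtain i where j: "j = Suc i" using Cons.prems(1) False by (cases j) auto
    interpret weighted_node_tree V r par D dep E N c X m
      by unfold_locales (simp add: m_def)
    have path0: "0 \<le> path_cost E c U x" if "\<forall>(u, v)\<in>node_labels U. {u, v} \<in> E" for U :: "nat dtree" and x
      using that c_nonneg by (induction U) auto
    have labels: "\<forall>(u, v)\<in>node_labels T. {u, v} \<in> E" and id: "\<And>x. x \<in> V \<Longrightarrow> search E T x = x"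
      using T by (auto simp: decision_tree_def)
    have opt0: "0 \<le> opt" using path0[OF labels, of r] opt[OF root_in] by linarith
    have F: "sound E c (set Y) (2 * of_nat i * opt) (solve t N k Y)"
      if "length Y < m" "set Y \<subseteq> V" "distinct Y" for Y
    proof (rule Cons.IH[OF _ _ that(2,3)])
      have "length X div t < t ^ i" using Cons.prems(1) t j by (simp add: less_mult_imp_div_less mult.commute)
      then show "length Y < t ^ i" using that(1) by (simp add: m_def)
      show "i \<le> length k" using Cons.prems(2) j by simp
    qed
    define A where "A = map nv (seps N X m N)"
    have SA: "set A = S" using set_seps by (simp add: A_def)
    have "g r = length X" using Cons.prems(3) D_root by (simp add: g_def filter_id_conv subset_iff)
    \<comment> \<open>This uses \<open>2 \<le> t\<close>. It makes \<open>f r\<close> positive, so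
      \<open>S\<close> is nonempty and \<open>expand\<close> does not start with an empty
      \<open>A\<close>.\<close>
    moreover have "m \<le> length X"
    proof -
      have "length X div t \<le> length X div 2" using t by (rule div_le_mono2[rotated]) simp
      then show ?thesis using False unfolding m_def by (cases X) auto
    qed
    ultimately have "0 < f r" using m_pos by (simp add: f_def div_greater_zero_iff)
    then have "S \<noteq> {}" using lowest_in_S[OF root_in] by blast
    then have A: "A \<noteq> []" using SA by auto
    have cV: "cut_off V" using S_subset by (auto simp: cut_off_def)
    have "sound E c (set X) (pcost (plan K A K) + (opt + 2 * of_nat i * opt)) (expand (solve t N k) N A (plan K A K) X)"
    proof (rule sound_expand[OF F _ _ Cons.prems(3,4) cV])
      show "0 \<le> 2 * of_nat i * opt" using opt0 by simp
      show "star_cost s N \<le> opt" if "s \<in> V" for s using star_cost_le[OF T that] opt[OF that] by simp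
      show "set A = V \<inter> S" using SA S_subset by auto
      show "X = filter (\<lambda>x. x \<in> V) X" using Cons.prems(3) by (simp add: filter_id_conv subset_iff)
    qed (use A in auto)
    moreover have "pcost (plan K A K) \<le> opt"
    proof -
      have "inj_on (search E T) (set A)" using id SA S_subset by (auto simp: inj_on_def subset_iff)
      then obtain x where "x \<in> set A" "pcost (plan K A K) \<le> path_cost E c T x"
        using plan_lower_bound[OF K_nodes K_representatives S_subset labels _ A] SA by blast
      then show ?thesis using opt[of x] SA S_subset by fastforce
    qed
    ultimately have "sound E c (set X) (2 * of_nat j * opt) (expand (solve t N k) N A (plan K A K) X)"
      by (elim sound_mono) (simp add: j algebra_simps)
    moreover have "solve t N (a # k) X = expand (solve t N k) N A (plan K A K) X"
      using False unfolding K_def A_def by (simp add: Let_def m_def)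
    ultimately show ?thesis by simp
  qed
qed

text \<open>By the choice of \<open>m\<close>, \<open>length X\<close> is below
  \<open>t * m\<close>, so the quotient at the root is below \<open>t\<close>.\<close>

lemma length_seps_le:
  assumes t: "0 < t"
  shows "length (seps N X (length X div t + 1) N) \<le> 2 * t"
proof -
  interpret weighted_node_tree V r par D dep E N c X "length X div t + 1"
    by unfold_locales simp
  have "length X < t * (length X div t + 1)"
    using dividend_less_times_div[OF t, of "length X"] by simp
  then have "length X div (length X div t + 1) < t" by (simp add: less_mult_imp_div_less)
  then show ?thesis using card_S_le_div length_seps by linarith
qed

end

section \<open>The program\<close>

abbreviation "Cons_e a b \<equiv> Prim Cons_op [a, b]"
abbreviation "Fst_e a \<equiv> Prim Fst_op [a]"
abbreviation "Snd_e a \<equiv> Prim Snd_op [a]"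
abbreviation "Add_e a b \<equiv> Prim Add_op [a, b]"
abbreviation "Sub_e a b \<equiv> Prim Sub_op [a, b]"
abbreviation "Less_e a b \<equiv> Prim Less_op [a, b]"
abbreviation "Eq_e a b \<equiv> Prim Eq_op [a, b]"
abbreviation "nv_e a \<equiv> Fst_e a"
abbreviation "np_e a \<equiv> Fst_e (Snd_e a)"
abbreviation "nc_e a \<equiv> Fst_e (Snd_e (Snd_e a))"
abbreviation "nd_e a \<equiv> Snd_e (Snd_e (Snd_e a))"
abbreviation "Nd_e v p c d \<equiv> Cons_e v (Cons_e p (Cons_e c d))"

text \<open>Each comment gives the index of a function, its counterpart above, and its arguments in the
  order of their de Bruijn indices. In functions 16 and 17, \<open>t\<close>, \<open>N\<close> and \<open>k\<close> stand for the argument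
  \<open>solve t N k\<close> of \<open>expand\<close> and \<open>star\<close>.\<close>

definition prog :: prog where
  "prog = [
   \<comment> \<open>0: main (instance)\<close>
   Let (Call 21 [Fst_e (Var 0), Snd_e (Var 0),
          Cons_e (Nd_e (Fst_e (Fst_e (Var 0))) (Fst_e (Fst_e (Var 0))) (Lit 0)
            (Cons_e (Fst_e (Fst_e (Var 0))) NilE)) NilE])
     (Let (Add_e (Call 18 [Call 4 [Fst_e (Var 1)], Fst_e (Var 1), Lit 1, Lit 0, Lit 0]) (Lit 2))
       (Call 15 [Var 0, Var 1, Fst_e (Var 2), Fst_e (Var 2)])),
   \<comment> \<open>1: member (x, L)\<close>
   If (Var 1)
     (If (Eq_e (Var 0) (Fst_e (Var 1))) (Lit 1) (Call 1 [Var 0, Snd_e (Var 1)]))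
     NilE,
   \<comment> \<open>2: intersection (X, D)\<close>
   If (Var 0)
     (Let (Call 2 [Snd_e (Var 0), Var 1])
       (If (Call 1 [Fst_e (Var 1), Var 2]) (Cons_e (Fst_e (Var 1)) (Var 0)) (Var 0)))
     NilE,
   \<comment> \<open>3: difference (X, D)\<close>
   If (Var 0)
     (Let (Call 3 [Snd_e (Var 0), Var 1])
       (If (Call 1 [Fst_e (Var 1), Var 2]) (Var 0) (Cons_e (Fst_e (Var 1)) (Var 0))))
     NilE,
   \<comment> \<open>4: length (X)\<close>
   If (Var 0) (Add_e (Lit 1) (Call 4 [Snd_e (Var 0)])) (Lit 0),
   \<comment> \<open>5: div (a, m)\<close>
   If (Less_e (Var 0) (Var 1)) (Lit 0) (Add_e (Lit 1) (Call 5 [Sub_e (Var 0) (Var 1), Var 1])),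
   \<comment> \<open>6: fv (X, m, e)\<close>
   Call 5 [Call 4 [Call 2 [Var 0, nd_e (Var 2)]], Var 1],
   \<comment> \<open>7: the separator test (L, X, m, e, fv e)\<close>
   If (Var 0)
     (If (Call 1 [nv_e (Fst_e (Var 0)), nd_e (Var 3)])
        (If (Eq_e (nv_e (Fst_e (Var 0))) (nv_e (Var 3)))
           (Call 7 [Snd_e (Var 0), Var 1, Var 2, Var 3, Var 4])
           (If (Less_e (Call 6 [Var 1, Var 2, Fst_e (Var 0)]) (Var 4))
              (Call 7 [Snd_e (Var 0), Var 1, Var 2, Var 3, Var 4])
              NilE))
        (Call 7 [Snd_e (Var 0), Var 1, Var 2, Var 3, Var 4]))
     (Lit 1),
   \<comment> \<open>8: seps (L, N, X, m)\<close>
   If (Var 0)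
     (Let (Call 8 [Snd_e (Var 0), Var 1, Var 2, Var 3])
       (Let (Call 6 [Var 3, Var 4, Fst_e (Var 1)])
         (If (Less_e (Lit 0) (Var 0))
            (If (Call 7 [Var 3, Var 4, Var 5, Fst_e (Var 2), Var 0])
               (Cons_e (Fst_e (Var 2)) (Var 1))
               (Var 1))
            (Var 1))))
     NilE,
   \<comment> \<open>9: map nv (L)\<close>
   If (Var 0) (Cons_e (nv_e (Fst_e (Var 0))) (Call 9 [Snd_e (Var 0)])) NilE,
   \<comment> \<open>10: best (L, X, m, s, fv s, b)\<close>
   If (Var 0)
     (Call 10 [Snd_e (Var 0), Var 1, Var 2, Var 3, Var 4,
        If (Call 1 [nv_e (Var 3), nd_e (Fst_e (Var 0))])
          (If (Eq_e (Call 6 [Var 1, Var 2, Fst_e (Var 0)]) (Var 4))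
             (If (Less_e (nc_e (Fst_e (Var 0))) (nc_e (Var 5))) (Fst_e (Var 0)) (Var 5))
             (Var 5))
          (Var 5)])
     (Var 5),
   \<comment> \<open>11: map best (S, N, X, m)\<close>
   If (Var 0)
     (Cons_e
        (Call 10 [Var 1, Var 2, Var 3, Fst_e (Var 0), Call 6 [Var 2, Var 3, Fst_e (Var 0)], Fst_e (Var 0)])
        (Call 11 [Snd_e (Var 0), Var 1, Var 2, Var 3]))
     NilE,
   \<comment> \<open>12: plan (K0, A, K)\<close>
   If (Var 2)
     (Let (Call 12 [Var 0, Var 1, Snd_e (Var 2)])
     (Let (Call 2 [Var 2, nd_e (Fst_e (Var 3))])
     (Let (Call 3 [Var 3, nd_e (Fst_e (Var 4))])
       (If (Var 1)
         (If (Var 0)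
           (Let (Call 12 [Var 3, Var 1, Var 3])
           (Let (Call 12 [Var 4, Var 1, Var 4])
           (Let (Call 13 [Var 1])
           (Let (Call 13 [Var 1])
           (Let (Add_e (nc_e (Fst_e (Var 9))) (If (Less_e (Var 1) (Var 0)) (Var 0) (Var 1)))
             (If (Var 7)
               (If (Less_e (Var 0) (Fst_e (Var 7)))
                 (Cons_e (Var 0) (Cons_e (Fst_e (Var 10)) (Cons_e (Var 4) (Var 3))))
                 (Var 7))
               (Cons_e (Var 0) (Cons_e (Fst_e (Var 10)) (Cons_e (Var 4) (Var 3))))))))))
           (Var 2))
         (Var 2)))))
     NilE,
   \<comment> \<open>13: pcost (p)\<close>
   If (Var 0) (Fst_e (Var 0)) (Lit 0),
   \<comment> \<open>14: mk (e, l, r)\<close>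
   If (Var 1)
     (If (Var 2)
        (Cons_e (Cons_e (nv_e (Var 0)) (np_e (Var 0))) (Cons_e (Var 1) (Var 2)))
        (Var 1))
     (Var 2),
   \<comment> \<open>15: solve (t, N, k, X)\<close>
   If (Var 2)
     (If (Var 3)
        (Let (Add_e (Lit 1) (Call 5 [Call 4 [Var 3], Var 0]))
        (Let (Call 8 [Var 2, Var 2, Var 4, Var 0])
        (Let (Call 11 [Var 0, Var 3, Var 5, Var 1])
        (Let (Call 9 [Var 1])
          (Call 16 [Var 4, Var 5, Snd_e (Var 6), Var 0, Call 12 [Var 1, Var 0, Var 1], Var 7])))))
        NilE)
     NilE,
   \<comment> \<open>16: expand (t, N, k, A, p, X)\<close>
   If (Var 4)
     (Let (Fst_e (Snd_e (Var 4)))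
       (Call 14 [Var 0,
          Call 16 [Var 1, Var 2, Var 3, Call 2 [Var 4, nd_e (Var 0)],
            Fst_e (Snd_e (Snd_e (Var 5))), Call 2 [Var 6, nd_e (Var 0)]],
          Call 16 [Var 1, Var 2, Var 3, Call 3 [Var 4, nd_e (Var 0)],
            Snd_e (Snd_e (Snd_e (Var 5))), Call 3 [Var 6, nd_e (Var 0)]]]))
     (If (Var 3) (Call 17 [Var 0, Var 1, Var 2, Fst_e (Var 3), Var 1, Var 5]) NilE),
   \<comment> \<open>17: star (t, N, k, s, L, X)\<close>
   If (Var 4)
     (Let (Fst_e (Var 4))
       (If (Eq_e (nv_e (Var 0)) (Var 4))
          (Call 14 [Var 0,
             Call 17 [Var 1, Var 2, Var 3, Var 4, Snd_e (Var 5), Call 2 [Var 6, nd_e (Var 0)]],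
             Call 15 [Var 1, Var 2, Var 3, Call 3 [Var 6, nd_e (Var 0)]]])
          (If (Eq_e (np_e (Var 0)) (Var 4))
             (Call 14 [Var 0,
                Call 15 [Var 1, Var 2, Var 3, Call 2 [Var 6, nd_e (Var 0)]],
                Call 17 [Var 1, Var 2, Var 3, Var 4, Snd_e (Var 5), Call 3 [Var 6, nd_e (Var 0)]]])
             (Call 17 [Var 1, Var 2, Var 3, Var 4, Snd_e (Var 5), Var 6]))))
     (If (Var 5) (Fst_e (Var 5)) NilE),
   \<comment> \<open>18: tloop (n, k, p, j, r)\<close>
   If (Var 1)
     (If (Less_e (Var 0) (Var 2))
        (Var 4)
        (If (Eq_e (Var 3) (Lit 0))
           (Call 18 [Var 0, Snd_e (Var 1), Add_e (Var 2) (Var 2), Add_e (Lit 1) (Var 4), Add_e (Lit 1) (Var 4)])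
           (Call 18 [Var 0, Snd_e (Var 1), Add_e (Var 2) (Var 2), Sub_e (Var 3) (Lit 1), Var 4])))
     (Var 4),
   \<comment> \<open>19: upd (N, e)\<close>
   If (Var 0)
     (Cons_e
        (If (Call 1 [np_e (Var 1), nd_e (Fst_e (Var 0))])
           (Nd_e (nv_e (Fst_e (Var 0))) (np_e (Fst_e (Var 0))) (nc_e (Fst_e (Var 0)))
              (Cons_e (nv_e (Var 1)) (nd_e (Fst_e (Var 0)))))
           (Fst_e (Var 0)))
        (Call 19 [Snd_e (Var 0), Var 1]))
     NilE,
   \<comment> \<open>20: find_edge (es, vis)\<close>
   If (Var 0)
     (Let (Fst_e (Var 0))
       (If (Call 1 [Fst_e (Var 0), Var 2])
          (If (Call 1 [Fst_e (Snd_e (Var 0)), Var 2])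
             (Call 20 [Snd_e (Var 1), Var 2])
             (Nd_e (Fst_e (Snd_e (Var 0))) (Fst_e (Var 0)) (Snd_e (Snd_e (Var 0)))
                (Cons_e (Fst_e (Snd_e (Var 0))) NilE)))
          (If (Call 1 [Fst_e (Snd_e (Var 0)), Var 2])
             (Nd_e (Fst_e (Var 0)) (Fst_e (Snd_e (Var 0))) (Snd_e (Snd_e (Var 0)))
                (Cons_e (Fst_e (Var 0)) NilE))
             (Call 20 [Snd_e (Var 1), Var 2]))))
     NilE,
   \<comment> \<open>21: build (k, es, N)\<close>
   If (Var 0)
     (Let (Call 20 [Var 1, Call 9 [Var 2]])
       (If (Var 0)
          (Call 21 [Snd_e (Var 1), Var 2, Cons_e (Var 0) (Call 19 [Var 3, Var 0])])
          (Var 3)))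
     (Var 2)]"

text \<open>Weakest preconditions turn evaluation into rewriting with \<open>wp_simps\<close>, which stops at function
  calls. These are resolved with facts of the form \<open>ret i vs v B\<close>: function \<open>i\<close> applied to \<open>vs\<close> returns
  \<open>v\<close> after at most \<open>B\<close> steps.\<close>

definition wp :: "val list \<Rightarrow> exp \<Rightarrow> (val \<Rightarrow> nat \<Rightarrow> bool) \<Rightarrow> bool" where
  "wp env e Q \<longleftrightarrow> (\<exists>v t. eval prog env e v t \<and> Q v t)"

definition wps :: "val list \<Rightarrow> exp list \<Rightarrow> (val list \<Rightarrow> nat \<Rightarrow> bool) \<Rightarrow> bool" where
  "wps env es Q \<longleftrightarrow> (\<exists>vs t. evals prog env es vs t \<and> Q vs t)"

definition call :: "nat \<Rightarrow> val list \<Rightarrow> (val \<Rightarrow> nat \<Rightarrow> bool) \<Rightarrow> bool" where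
  "call i vs Q \<longleftrightarrow> i < length prog \<and> wp vs (prog ! i) Q"

inductive_cases eval_VarE: "eval P env (Var i) v t"
inductive_cases eval_LitE: "eval P env (Lit q) v t"
inductive_cases eval_NilEE: "eval P env NilE v t"
inductive_cases eval_PrimE: "eval P env (Prim f es) v t"
inductive_cases eval_IfE: "eval P env (If b e1 e2) v t"
inductive_cases eval_LetE: "eval P env (Let e1 e2) v t"
inductive_cases eval_CallE: "eval P env (Call i es) v t"
inductive_cases evals_NilE: "evals P env [] vs t"
inductive_cases evals_ConsE: "evals P env (e # es) vs t"

lemma wp_simps:
  "wp env (Var i) Q \<longleftrightarrow> i < length env \<and> Q (env ! i) 1"
  "wp env (Lit q) Q \<longleftrightarrow> Q (VNum q) 1"
  "wp env NilE Q \<longleftrightarrow> Q VNil 1"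
  "wp env (Prim f es) Q \<longleftrightarrow> wps env es (\<lambda>vs t. Q (apply_prim f vs) (Suc t))"
  "wp env (exp.If b e1 e2) Q \<longleftrightarrow> wp env b (\<lambda>w s. if w = VNil
     then wp env e2 (\<lambda>v t. Q v (Suc (s + t))) else wp env e1 (\<lambda>v t. Q v (Suc (s + t))))"
  "wp env (exp.Let e1 e2) Q \<longleftrightarrow> wp env e1 (\<lambda>w s. wp (w # env) e2 (\<lambda>v t. Q v (Suc (s + t))))"
  "wp env (Call i es) Q \<longleftrightarrow> wps env es (\<lambda>vs s. call i vs (\<lambda>v t. Q v (Suc (s + t))))"
  "wps env [] P \<longleftrightarrow> P [] 0"
  "wps env (e # es) P \<longleftrightarrow> wp env e (\<lambda>v s. wps env es (\<lambda>vs t. P (v # vs) (s + t)))"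
          apply (fastforce simp: wp_def intro: eval_evals.intros elim: eval_VarE)
         apply (fastforce simp: wp_def intro: eval_evals.intros elim: eval_LitE)
        apply (fastforce simp: wp_def intro: eval_evals.intros elim: eval_NilEE)
       apply (fastforce simp: wp_def wps_def intro: eval_evals.intros[simplified] elim: eval_PrimE)
      apply (auto simp: wp_def elim!: eval_IfE; metis eval_If_true[simplified] eval_If_false[simplified])
     apply (fastforce simp: wp_def intro: eval_evals.intros[simplified] elim: eval_LetE)
    apply (fastforce simp: wp_def wps_def call_def intro: eval_evals.intros[simplified] elim: eval_CallE)
   apply (fastforce simp: wps_def intro: eval_evals.intros[simplified] elim: evals_NilE)
  apply (fastforce simp: wp_def wps_def intro: eval_evals.intros[simplified] elim: evals_ConsE)
  done

definition ret :: "nat \<Rightarrow> val list \<Rightarrow> val \<Rightarrow> nat \<Rightarrow> bool" where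
  "ret i vs v B \<longleftrightarrow> call i vs (\<lambda>v' t. v' = v \<and> t \<le> B)"

lemma ret_iff: "ret i vs v B \<longleftrightarrow> i < length prog \<and> wp vs (prog ! i) (\<lambda>v' t. v' = v \<and> t \<le> B)"
  by (simp add: ret_def call_def)

lemma call_ret: "ret i vs v B \<Longrightarrow> (\<And>t. t \<le> B \<Longrightarrow> Q v t) \<Longrightarrow> call i vs Q"
  by (auto simp: ret_def call_def wp_def)

lemma ret_mono: "ret i vs v B \<Longrightarrow> B \<le> B' \<Longrightarrow> ret i vs v B'"
  by (auto simp: ret_def call_def wp_def intro: order_trans)

definition enc_node :: "node \<Rightarrow> val" where
  "enc_node e = VPair (enc_nat (nv e)) (VPair (enc_nat (np e)) (VPair (VNum (nc e)) (enc_list enc_nat (nd e))))"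

abbreviation "enc_nats \<equiv> enc_list enc_nat"
abbreviation "enc_nodes \<equiv> enc_list enc_node"

fun enc_strat :: "strat \<Rightarrow> val" where
  "enc_strat PLeaf = VNil"
| "enc_strat (PNode w e p q) = VPair (VNum w) (VPair (enc_node e) (VPair (enc_strat p) (enc_strat q)))"

text \<open>\<open>VNil\<close> is free to represent \<open>None\<close>, because no node or
  decision tree is encoded by it; programs can thus test for \<open>None\<close> with a
  conditional.\<close>

definition enc_opt :: "('b \<Rightarrow> val) \<Rightarrow> 'b option \<Rightarrow> val" where
  "enc_opt f x = (case x of None \<Rightarrow> VNil | Some y \<Rightarrow> f y)"

lemma enc_simps [simp]:
  "enc_nat a \<noteq> VNil"
  "enc_node e \<noteq> VNil"
  "enc_dtree D \<noteq> VNil"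
  "enc_list f xs = VNil \<longleftrightarrow> xs = []"
  "enc_strat p = VNil \<longleftrightarrow> p = PLeaf"
  "enc_opt f None = VNil"
  "enc_opt f (Some y) = f y"
  by (auto simp: enc_nat_def enc_node_def enc_opt_def elim: enc_list.elims enc_dtree.elims)
     (cases D; simp add: enc_nat_def; fail | cases xs; simp; fail | cases p; simp; fail)+

lemma prim_simps [simp]:
  "apply_prim Fst_op [enc_node e] = enc_nat (nv e)"
  "apply_prim Snd_op [enc_node e] = VPair (enc_nat (np e)) (VPair (VNum (nc e)) (enc_nats (nd e)))"
  "apply_prim Eq_op [enc_nat a, enc_nat b] = bool_val (a = b)"
  "apply_prim Less_op [enc_nat a, enc_nat b] = bool_val (a < b)"
  "apply_prim Less_op [VNum 0, enc_nat b] = bool_val (0 < b)"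
  "apply_prim Eq_op [enc_nat a, VNum 0] = bool_val (a = 0)"
  "apply_prim Add_op [enc_nat a, enc_nat b] = enc_nat (a + b)"
  "apply_prim Add_op [VNum 1, enc_nat b] = enc_nat (Suc b)"
  "apply_prim Add_op [enc_nat b, VNum 2] = enc_nat (Suc (Suc b))"
  "b \<le> a \<Longrightarrow> apply_prim Sub_op [enc_nat a, enc_nat b] = enc_nat (a - b)"
  "0 < a \<Longrightarrow> apply_prim Sub_op [enc_nat a, VNum 1] = enc_nat (a - Suc 0)"
  by (auto simp: enc_node_def enc_nat_def of_nat_diff)

lemma VNum_0: "VNum 0 = enc_nat 0" and VNum_1: "VNum 1 = enc_nat 1"
  by (auto simp: enc_nat_def)

section \<open>Results and step counts of the functions of the program\<close>

lemma spec_mem: "ret (Suc 0) [enc_nat x, enc_nats L] (bool_val (x \<in> set L)) (20 * (length L + 1))"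
proof (induction L)
  case Nil
  show ?case by (subst ret_iff) (simp add: prog_def wp_simps)
next
  case (Cons y L)
  show ?case
    by (subst ret_iff, simp add: prog_def wp_simps) (auto intro!: call_ret[OF Cons.IH])
qed

text \<open>Here and below, \<open>z\<close> exceeds the lengths of the lists involved; bounds in
  powers of \<open>z\<close> are easy to add up.\<close>

lemma spec_inter:
  assumes "length (nd e) < z"
  shows "ret 2 [enc_nats X, enc_nats (nd e)] (enc_nats (inner e X)) ((length X + 1) * (40 * z))"
proof (induction X)
  case Nil
  show ?case using assms by (subst ret_iff) (simp add: prog_def wp_simps)
next
  case (Cons y X)
  show ?case using assms
    by (subst ret_iff, simp add: prog_def wp_simps) (auto intro!: call_ret[OF Cons.IH] call_ret[OF spec_mem])
qed

lemma spec_inter':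
  assumes "length X < z" "length (nd e) < z"
  shows "ret 2 [enc_nats X, enc_nats (nd e)] (enc_nats (inner e X)) (40 * z\<^sup>2)"
proof -
  have "(length X + 1) * (40 * z) \<le> z * (40 * z)" using assms by (intro mult_right_mono) auto
  then show ?thesis using ret_mono[OF spec_inter[OF assms(2), of X]] by (simp add: power2_eq_square)
qed

lemma spec_diff:
  assumes "length (nd e) < z"
  shows "ret 3 [enc_nats X, enc_nats (nd e)] (enc_nats (outer e X)) ((length X + 1) * (40 * z))"
proof (induction X)
  case Nil
  show ?case using assms by (subst ret_iff) (simp add: prog_def wp_simps)
next
  case (Cons y X)
  show ?case using assms
    by (subst ret_iff, simp add: prog_def wp_simps) (auto intro!: call_ret[OF Cons.IH] call_ret[OF spec_mem])
qed

lemma spec_diff':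
  assumes "length X < z" "length (nd e) < z"
  shows "ret 3 [enc_nats X, enc_nats (nd e)] (enc_nats (outer e X)) (40 * z\<^sup>2)"
proof -
  have "(length X + 1) * (40 * z) \<le> z * (40 * z)" using assms by (intro mult_right_mono) auto
  then show ?thesis using ret_mono[OF spec_diff[OF assms(2), of X]] by (simp add: power2_eq_square)
qed

lemma spec_length: "ret 4 [enc_nats X] (enc_nat (length X)) (10 * (length X + 1))"
proof (induction X)
  case Nil
  show ?case by (subst ret_iff) (simp add: prog_def wp_simps enc_nat_def)
next
  case (Cons y X)
  show ?case
    by (subst ret_iff, simp add: prog_def wp_simps) (auto intro!: call_ret[OF Cons.IH])
qed

lemma spec_div:
  assumes "0 < m"
  shows "ret 5 [enc_nat a, enc_nat m] (enc_nat (a div m)) (15 * (a + 1))"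
proof (induction a rule: less_induct)
  case (less a)
  show ?case
  proof (cases "a < m")
    case True
    then show ?thesis by (subst ret_iff) (simp add: prog_def wp_simps enc_nat_def)
  next
    case False
    have a: "a div m = Suc ((a - m) div m)" using False assms by (simp add: div_if)
    have "a - m < a" using False assms by simp
    from less.IH[OF this] False assms show ?thesis
      by (subst ret_iff, simp add: prog_def wp_simps) (auto simp: a intro!: call_ret)
  qed
qed

lemma powers:
  fixes z :: nat
  assumes "0 < z"
  shows "1 \<le> z" "z \<le> z\<^sup>2" "z\<^sup>2 \<le> z^3" "z^3 \<le> z^4" "z * z = z\<^sup>2" "z * z\<^sup>2 = z^3" "z * z^3 = z^4"
  using assms by (auto simp: power2_eq_square power3_eq_cube numeral_eq_Suc)

lemma spec_fv:
  assumes "0 < m" "length (nd e) < z" "length X < z"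
  shows "ret 6 [enc_nats X, enc_nat m, enc_node e] (enc_nat (fv X m e)) (80 * z\<^sup>2)"
proof -
  have "length (inner e X) < z" using assms(3) le_less_trans length_filter_le by blast
  then show ?thesis using assms powers[of z]
    by (subst ret_iff, simp add: prog_def wp_simps)
       (auto simp: fv_def intro!: call_ret[OF spec_inter'[OF assms(3,2)]] call_ret[OF spec_length] call_ret[OF spec_div])
qed

lemma spec_low:
  assumes "0 < m" "length (nd e) < z" "length X < z" "\<forall>a\<in>set L. length (nd a) < z"
  shows "ret 7 [enc_nodes L, enc_nats X, enc_nat m, enc_node e, enc_nat f]
    (bool_val (\<forall>a\<in>set L. nv a \<in> set (nd e) \<longrightarrow> nv a = nv e \<or> fv X m a < f)) ((length L + 1) * (150 * z\<^sup>2))"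
  using assms(4)
proof (induction L)
  case Nil
  show ?case using assms powers[of z] by (subst ret_iff) (simp add: prog_def wp_simps)
next
  case (Cons a L)
  then have IH: "ret 7 [enc_nodes L, enc_nats X, enc_nat m, enc_node e, enc_nat f]
    (bool_val (\<forall>a\<in>set L. nv a \<in> set (nd e) \<longrightarrow> nv a = nv e \<or> fv X m a < f)) ((length L + 1) * (150 * z\<^sup>2))"
    and a: "length (nd a) < z" by auto
  show ?case using assms(2) powers[of z]
    by (subst ret_iff, simp add: prog_def wp_simps)
       (auto intro!: call_ret[OF IH] call_ret[OF spec_mem] call_ret[OF spec_fv[OF assms(1) a assms(3)]])
qed

lemma spec_seps:
  assumes "0 < m" "length X < z" "\<forall>a\<in>set N. length (nd a) < z" "length N < z" "set L \<subseteq> set N"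
  shows "ret 8 [enc_nodes L, enc_nodes N, enc_nats X, enc_nat m]
    (enc_nodes (seps N X m L)) ((length L + 1) * (300 * z^3))"
  using assms(5)
proof (induction L)
  case Nil
  show ?case using assms powers[of z] by (subst ret_iff) (simp add: prog_def wp_simps seps_def)
next
  case (Cons a L)
  then have IH: "ret 8 [enc_nodes L, enc_nodes N, enc_nats X, enc_nat m]
    (enc_nodes (seps N X m L)) ((length L + 1) * (300 * z^3))"
    and a: "length (nd a) < z" using assms by auto
  have le: "(length N + 1) * (150 * z\<^sup>2) \<le> z * (150 * z\<^sup>2)" using assms by (intro mult_right_mono) auto
  have s: "ret 7 [enc_nodes N, enc_nats X, enc_nat m, enc_node a, enc_nat f]
    (bool_val (\<forall>e'\<in>set N. nv e' \<in> set (nd a) \<longrightarrow> nv e' = nv a \<or> fv X m e' < f)) (150 * z^3)" for f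
    using ret_mono[OF spec_low[OF assms(1) a assms(2,3), of f]] le
    by (simp add: power2_eq_square power3_eq_cube)
  show ?case using assms(2) powers[of z]
    by (subst ret_iff, simp add: prog_def wp_simps)
       (auto simp: seps_def split: if_splits intro!: call_ret[OF IH[unfolded seps_def]] call_ret[OF s] call_ret[OF spec_fv[OF assms(1) a assms(2)]])
qed

lemma spec_map_nv: "ret 9 [enc_nodes L] (enc_nats (map nv L)) (15 * (length L + 1))"
proof (induction L)
  case Nil
  show ?case by (subst ret_iff) (simp add: prog_def wp_simps)
next
  case (Cons y L)
  show ?case
    by (subst ret_iff, simp add: prog_def wp_simps) (auto intro!: call_ret[OF Cons.IH])
qed

lemma spec_best:
  assumes "0 < m" "length X < z" "\<forall>a\<in>set L. length (nd a) < z"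
  shows "ret 10 [enc_nodes L, enc_nats X, enc_nat m, enc_node s, enc_nat (fv X m s), enc_node b]
    (enc_node (best X m s L b)) ((length L + 1) * (200 * z\<^sup>2))"
  using assms(3)
proof (induction L arbitrary: b)
  case Nil
  show ?case using assms powers[of z] by (subst ret_iff) (simp add: prog_def wp_simps)
next
  case (Cons a L)
  then have a: "length (nd a) < z"
    and IH: "ret 10 [enc_nodes L, enc_nats X, enc_nat m, enc_node s, enc_nat (fv X m s), enc_node b]
      (enc_node (best X m s L b)) ((length L + 1) * (200 * z\<^sup>2))" for b
    by auto
  show ?case using assms(2) a powers[of z]
    by (subst ret_iff, simp add: prog_def wp_simps)
       (auto intro!: call_ret[OF IH] call_ret[OF spec_mem] call_ret[OF spec_fv[OF assms(1) a assms(2)]])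
qed

lemma spec_bests:
  assumes "0 < m" "length X < z" "\<forall>a\<in>set N. length (nd a) < z" "length N < z" "set S \<subseteq> set N"
  shows "ret 11 [enc_nodes S, enc_nodes N, enc_nats X, enc_nat m]
    (enc_nodes (map (\<lambda>s. best X m s N s) S)) ((length S + 1) * (320 * z^3))"
  using assms(5)
proof (induction S)
  case Nil
  show ?case using assms powers[of z] by (subst ret_iff) (simp add: prog_def wp_simps)
next
  case (Cons a S)
  then have IH: "ret 11 [enc_nodes S, enc_nodes N, enc_nats X, enc_nat m]
    (enc_nodes (map (\<lambda>s. best X m s N s) S)) ((length S + 1) * (320 * z^3))"
    and a: "length (nd a) < z" using assms by auto
  have le: "(length N + 1) * (200 * z\<^sup>2) \<le> z * (200 * z\<^sup>2)" using assms by (intro mult_right_mono) auto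
  have s: "ret 10 [enc_nodes N, enc_nats X, enc_nat m, enc_node a, enc_nat (fv X m a), enc_node a]
    (enc_node (best X m a N a)) (200 * z^3)"
    using ret_mono[OF spec_best[OF assms(1,2,3)]] le
    by (simp add: power2_eq_square power3_eq_cube)
  show ?case using assms(2) powers[of z]
    by (subst ret_iff, simp add: prog_def wp_simps)
       (auto intro!: call_ret[OF IH] call_ret[OF s] call_ret[OF spec_fv[OF assms(1) a assms(2)]])
qed

lemma spec_pcost: "ret 13 [enc_strat p] (VNum (pcost p)) 5"
  by (cases p; subst ret_iff; simp add: prog_def wp_simps)

lemma spec_mk:
  "ret 14 [enc_node e, enc_opt enc_dtree l, enc_opt enc_dtree r] (enc_opt enc_dtree (mk e l r)) 30"
  by (cases l; cases r; subst ret_iff; simp add: prog_def wp_simps)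

text \<open>Each edge of \<open>K\<close> causes two calls on shorter lists with all of
  \<open>K0\<close>. The factor 4 in the base makes either call fit into a quarter of the 400 units
  granted per edge; the other half pays for splitting \<open>A\<close> and comparing costs.\<close>

lemma spec_plan:
  fixes z :: nat
  shows "length A < z \<Longrightarrow> \<forall>a\<in>set K0. length (nd a) < z \<Longrightarrow> set K \<subseteq> set K0 \<Longrightarrow> ret 12 [enc_nodes K0, enc_nats A, enc_nodes K] (enc_strat (plan K0 A K))
    ((length K + 1) * (400 * z\<^sup>2 * (4 * (length K0 + 1)) ^ length A))"
proof (induction K0 A K rule: plan.induct)
  case (1 K0 A)
  then have "0 < z" by simp
  then have "0 < z\<^sup>2 * (4 * (length K0 + 1)) ^ length A" by simp
  then have "3 \<le> 400 * z\<^sup>2 * (4 * (length K0 + 1)) ^ length A" unfolding mult.assoc by linarith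
  then show ?case by (subst ret_iff) (simp add: prog_def wp_simps)
next
  case (2 K0 A e K)
  have "z > 0" using "2.prems"(1) by simp
  note pw = powers[OF this]
  define M where "M = 4 * (length K0 + 1)"
  define G where "G = z\<^sup>2 * M ^ length A"
  have M: "M > 0" by (simp add: M_def)
  have G: "z\<^sup>2 \<le> G" using M by (simp add: G_def)
  have e: "length (nd e) < z" using "2.prems"(2,3) by auto
  have i: "ret 2 [enc_nats A, enc_nats (nd e)] (enc_nats (inner e A)) (40 * G)"
    using ret_mono[OF spec_inter'[OF "2.prems"(1) e], of "40 * G"] G by simp
  have d: "ret 3 [enc_nats A, enc_nats (nd e)] (enc_nats (outer e A)) (40 * G)"
    using ret_mono[OF spec_diff'[OF "2.prems"(1) e], of "40 * G"] G by simp
  have r: "ret 12 [enc_nodes K0, enc_nats A, enc_nodes K] (enc_strat (plan K0 A K)) ((length K + 1) * (400 * G))"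
    using "2.IH"(1) "2.prems" by (simp add: G_def M_def mult.assoc)
  have sub: "(length K0 + 1) * (400 * z\<^sup>2 * M ^ l) \<le> 100 * G" if "l < length A" for l
  proof -
    have "M * M ^ l \<le> M ^ length A" using power_increasing[of "Suc l" "length A" M] that M by simp
    then have "z\<^sup>2 * (M * M ^ l) \<le> G" unfolding G_def by (rule mult_left_mono) simp
    then show ?thesis by (simp add: M_def algebra_simps)
  qed
  have p: "ret 12 [enc_nodes K0, enc_nats (inner e A), enc_nodes K0] (enc_strat (plan K0 (inner e A) K0)) (100 * G)"
    if "inner e A \<noteq> []" "outer e A \<noteq> []"
  proof -
    have "length (outer e A) \<noteq> 0" using that by simp
    then have l: "length (inner e A) < length A" using length_inner_outer[of e A] by linarith
    show ?thesis by (rule ret_mono[OF "2.IH"(2)[OF refl] sub[OF l, unfolded M_def]]) (simp_all add: that l less_trans[OF l "2.prems"(1)] "2.prems")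
  qed
  have q: "ret 12 [enc_nodes K0, enc_nats (outer e A), enc_nodes K0] (enc_strat (plan K0 (outer e A) K0)) (100 * G)"
    if "inner e A \<noteq> []" "outer e A \<noteq> []"
  proof -
    have "length (inner e A) \<noteq> 0" using that by simp
    then have l: "length (outer e A) < length A" using length_inner_outer[of e A] by linarith
    show ?thesis by (rule ret_mono[OF "2.IH"(3)[OF refl _ refl] sub[OF l, unfolded M_def]]) (simp_all add: that l less_trans[OF l "2.prems"(1)] "2.prems")
  qed
  define R where "R = plan K0 A K"
  define P where "P = plan K0 (inner e A) K0"
  define Q where "Q = plan K0 (outer e A) K0"
  define w where "w = nc e + max (pcost P) (pcost Q)"
  have fst: "apply_prim Fst_op [enc_strat R] = VNum (pcost R)" if "R \<noteq> PLeaf"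
    using that by (cases R) auto
  note specs = call_ret[OF r] call_ret[OF i] call_ret[OF d] call_ret[OF p] call_ret[OF q] call_ret[OF spec_pcost]
  have max: "(if pcost P < pcost Q then VNum (nc e + pcost Q) else VNum (nc e + pcost P)) = VNum w"
    by (simp add: w_def max_def)
  have "ret 12 [enc_nodes K0, enc_nats A, enc_nodes (e # K)] (enc_strat (plan K0 A (e # K)))
    ((length (e # K) + 1) * (400 * G))"
  proof (cases "inner e A = [] \<or> outer e A = []")
    case True
    then have pl: "plan K0 A (e # K) = R" by (simp add: R_def)
    show ?thesis unfolding pl using pw G True
      by (subst ret_iff, simp add: prog_def wp_simps)
         (intro call_ret[OF r[folded R_def]] call_ret[OF i] call_ret[OF d]; auto)
  next
    case False
    then have ne: "inner e A \<noteq> []" "outer e A \<noteq> []" by auto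
    define T where "T = plan K0 A (e # K)"
    have T: "T = (if R = PLeaf \<or> w < pcost R then PNode w e P Q else R)"
      using False by (simp add: T_def R_def P_def Q_def w_def Let_def)
    show ?thesis unfolding T_def[symmetric] using pw G
      apply (subst ret_iff, simp add: prog_def wp_simps)
      apply (intro call_ret[OF r[folded R_def]] call_ret[OF i] call_ret[OF d])
      apply (simp add: ne)
      apply (rule call_ret[OF p[OF ne, folded P_def]])
      apply (rule call_ret[OF q[OF ne, folded Q_def]])
      apply (rule call_ret[OF spec_pcost])+
      apply (cases "R = PLeaf"; cases "pcost P < pcost Q"; simp add: fst T)
         apply (auto simp add: w_def max_def)
      done
  qed
  then show ?case by (simp add: G_def M_def mult.assoc)
qed

text \<open>The bound for \<open>F\<close> has a constant part and a part linear in the number of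
  candidates. As \<open>inner\<close> and \<open>outer\<close> partition \<open>X\<close>, the
  linear parts of all calls add up to at most \<open>W * length X\<close>.\<close>

lemma spec_star:
  assumes F: "\<And>X. length X < z \<Longrightarrow> ret 15 [t, N, k, enc_nats X] (enc_opt enc_dtree (F X)) (B + W * length X)"
    and L: "\<forall>a\<in>set L. length (nd a) < z"
  shows "length X < z \<Longrightarrow> ret 17 [t, N, k, enc_nat s, enc_nodes L, enc_nats X] (enc_opt enc_dtree (star F s L X))
    ((length L + 1) * (B + 200 * z\<^sup>2) + W * length X)"
  using L
proof (induction L arbitrary: X s)
  case Nil
  then have "z > 0" by simp
  from powers(1,2)[OF this] Nil show ?case
    by (subst ret_iff, cases X) (auto simp add: prog_def wp_simps)
next
  case (Cons e L)
  then have "z > 0" and e: "length (nd e) < z" by auto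
  note pw = powers(1,2)[OF this(1)]
  have i: "ret 2 [enc_nats X, enc_nats (nd e)] (enc_nats (inner e X)) (40 * z\<^sup>2)"
    by (rule spec_inter'[OF Cons.prems(1) e])
  have d: "ret 3 [enc_nats X, enc_nats (nd e)] (enc_nats (outer e X)) (40 * z\<^sup>2)"
    by (rule spec_diff'[OF Cons.prems(1) e])
  have li: "length (inner e X) < z" and lo: "length (outer e X) < z"
    using length_inner_outer[of e X] Cons.prems by auto
  have L: "\<forall>a\<in>set L. length (nd a) < z" using Cons.prems by auto
  have W: "W * length X = W * length (inner e X) + W * length (outer e X)"
    by (metis length_inner_outer distrib_left)
  show ?case using pw
    by (subst ret_iff, simp add: prog_def wp_simps)
       (auto simp: W intro!: call_ret[OF i] call_ret[OF d] call_ret[OF Cons.IH[OF li L]] call_ret[OF Cons.IH[OF lo L]]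
          call_ret[OF Cons.IH[OF Cons.prems(1) L]] call_ret[OF F[OF li]] call_ret[OF F[OF lo]] call_ret[OF spec_mk])
qed

fun strat_size :: "strat \<Rightarrow> nat" where
  "strat_size PLeaf = 1"
| "strat_size (PNode w e p q) = 1 + strat_size p + strat_size q"

fun strat_nodes :: "strat \<Rightarrow> node set" where
  "strat_nodes PLeaf = {}"
| "strat_nodes (PNode w e p q) = insert e (strat_nodes p \<union> strat_nodes q)"

text \<open>A leaf of the strategy runs \<open>star\<close> over all of \<open>N\<close>, with at
  most one call of \<open>F\<close> per record; this explains the factor \<open>z\<close> at
  \<open>B\<close>. The part with \<open>W\<close> again adds up over a partition of
  \<open>X\<close>.\<close>

lemma spec_expand:
  assumes F: "\<And>X. length X < z \<Longrightarrow> ret 15 [t, enc_nodes N, k, enc_nats X] (enc_opt enc_dtree (F X)) (B + W * length X)"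
    and N: "\<forall>a\<in>set N. length (nd a) < z" and lN: "length N < z"
  shows "length X < z \<Longrightarrow> length A < z \<Longrightarrow> strat_nodes p \<subseteq> set N \<Longrightarrow>
    ret 16 [t, enc_nodes N, k, enc_nats A, enc_strat p, enc_nats X] (enc_opt enc_dtree (expand F N A p X))
    (strat_size p * (z * B + 400 * z^3) + W * length X)"
proof (induction p arbitrary: A X)
  case PLeaf
  then have "z > 0" by simp
  note pw = powers(1,2,3)[OF this]
  have "(length N + 1) * (B + 200 * z\<^sup>2) \<le> z * (B + 200 * z\<^sup>2)"
    using lN by (intro mult_right_mono) auto
  then have s: "ret 17 [t, enc_nodes N, k, enc_nat s, enc_nodes N, enc_nats X] (enc_opt enc_dtree (star F s N X))
    (z * B + 200 * z^3 + W * length X)" for s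
    by (intro ret_mono[OF spec_star[OF F N PLeaf(1)]])
       (auto simp: power2_eq_square power3_eq_cube algebra_simps)
  show ?case using pw
    by (subst ret_iff, cases A) (auto simp add: prog_def wp_simps intro!: call_ret[OF s])
next
  case (PNode w e p q)
  then have "z > 0" and e: "length (nd e) < z" using N by auto
  note pw = powers(1,2,3)[OF this(1)]
  have i: "ret 2 [enc_nats X, enc_nats (nd e)] (enc_nats (inner e X)) (40 * z\<^sup>2)" if "length X < z" for X
    by (rule spec_inter'[OF that e])
  have d: "ret 3 [enc_nats X, enc_nats (nd e)] (enc_nats (outer e X)) (40 * z\<^sup>2)" if "length X < z" for X
    by (rule spec_diff'[OF that e])
  have li: "length (inner e X) < z" "length (outer e X) < z" "length (inner e A) < z" "length (outer e A) < z"
    using length_inner_outer[of e X] length_inner_outer[of e A] PNode.prems by auto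
  have W: "W * length X = W * length (inner e X) + W * length (outer e X)"
    by (metis length_inner_outer distrib_left)
  have pq: "strat_nodes p \<subseteq> set N" "strat_nodes q \<subseteq> set N" using PNode.prems by auto
  show ?case using pw
    by (subst ret_iff, simp add: prog_def wp_simps)
       (auto simp: W algebra_simps intro!: call_ret[OF i[OF PNode.prems(1)]] call_ret[OF d[OF PNode.prems(1)]]
          call_ret[OF i[OF PNode.prems(2)]] call_ret[OF d[OF PNode.prems(2)]]
          call_ret[OF PNode.IH(1)[OF li(1,3) pq(1)]] call_ret[OF PNode.IH(2)[OF li(2,4) pq(2)]]
          call_ret[OF spec_mk])
qed

lemma spec_tloop:
  "ret 18 [enc_nat n, enc_list f k, enc_nat p, enc_nat j, enc_nat r] (enc_nat (tloop n k p j r)) (40 * (length k + 1))"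
proof (induction k arbitrary: p j r)
  case Nil
  show ?case by (subst ret_iff) (simp add: prog_def wp_simps)
next
  case (Cons x k)
  show ?case
    by (subst ret_iff, simp add: prog_def wp_simps) (auto intro!: call_ret[OF Cons.IH] call_ret[OF Cons.IH, simplified])
qed

lemma spec_upd:
  assumes "0 < z" "\<forall>a\<in>set N. length (nd a) < z"
  shows "ret 19 [enc_nodes N, enc_node e] (enc_nodes (upd N e)) ((length N + 1) * (100 * z))"
  using assms(2)
proof (induction N)
  case Nil
  show ?case by (subst ret_iff) (use assms(1) in \<open>simp add: prog_def wp_simps upd_def\<close>)
next
  case (Cons a N)
  then have IH: "ret 19 [enc_nodes N, enc_node e] (enc_nodes (upd N e)) ((length N + 1) * (100 * z))"
    and a: "length (nd a) < z" by auto
  show ?case using a assms(1)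
    by (subst ret_iff, simp add: prog_def wp_simps)
       (auto simp: upd_def enc_node_def[of "Nd _ _ _ _"] intro!: call_ret[OF IH[unfolded upd_def]] call_ret[OF spec_mem])
qed

lemma spec_find:
  shows "ret 20 [enc_list (enc_edge c) es, enc_nats vis] (enc_opt enc_node (find_edge c es vis))
     ((length es + 1) * (100 * (length vis + 1)))"
proof (induction es)
  case Nil
  show ?case by (subst ret_iff) (simp add: prog_def wp_simps)
next
  case (Cons a es)
  obtain u v where a: "a = (u, v)" by force
  show ?case
    by (subst ret_iff, simp add: prog_def wp_simps a enc_edge_def)
       (auto simp: enc_node_def insert_commute intro!: call_ret[OF Cons.IH[unfolded enc_edge_def]] call_ret[OF spec_mem])
qed


lemma spec_find':
  assumes "length es < z" "length vis < z"
  shows "ret 20 [enc_list (enc_edge c) es, enc_nats vis] (enc_opt enc_node (find_edge c es vis)) (100 * z\<^sup>2)"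
proof -
  have "(length es + 1) * (100 * (length vis + 1)) \<le> z * (100 * z)"
    using assms by (intro mult_mono) auto
  then show ?thesis using ret_mono[OF spec_find] by (simp add: power2_eq_square)
qed

lemma spec_build:
  assumes "length es < z"
  shows "length N + length k < z \<Longrightarrow> \<forall>a\<in>set N. length (nd a) \<le> length N \<Longrightarrow>
    ret 21 [enc_list f k, enc_list (enc_edge c) es, enc_nodes N] (enc_nodes (build c es k N))
     ((length k + 1) * (300 * z\<^sup>2))"
proof (induction k arbitrary: N)
  case Nil
  then have "0 < z" by simp
  from powers(1,2)[OF this] show ?case by (subst ret_iff) (simp add: prog_def wp_simps)
next
  case (Cons x k)
  then have z: "0 < z" by simp
  note pw = powers(1,2)[OF this]
  have f: "ret 20 [enc_list (enc_edge c) es, enc_nats (map nv N)] (enc_opt enc_node (find_edge c es (map nv N))) (100 * z\<^sup>2)"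
    using assms Cons.prems by (intro spec_find') auto
  have v: "ret 9 [enc_nodes N] (enc_nats (map nv N)) (15 * z)"
    by (rule ret_mono[OF spec_map_nv]) (use Cons.prems in auto)
  have u: "ret 19 [enc_nodes N, enc_node e] (enc_nodes (upd N e)) (100 * z\<^sup>2)" for e
  proof -
    have "(length N + 1) * (100 * z) \<le> z * (100 * z)" using Cons.prems by (intro mult_right_mono) auto
    then show ?thesis using ret_mono[OF spec_upd[OF z, of N e]] Cons.prems by (force simp: power2_eq_square)
  qed
  show ?case
  proof (cases "find_edge c es (map nv N)")
    case None
    show ?thesis using pw
      by (subst ret_iff, simp add: prog_def wp_simps None)
         (auto intro!: call_ret[OF v] call_ret[OF f[unfolded None]])
  next
    case (Some e)
    have l: "length (nd e) = 1" using Some by (induction c es "map nv N" rule: find_edge.induct) (auto split: if_splits)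
    have IH: "ret 21 [enc_list f k, enc_list (enc_edge c) es, enc_nodes (e # upd N e)] (enc_nodes (build c es k (e # upd N e)))
     ((length k + 1) * (300 * z\<^sup>2))"
      using Cons.prems l by (intro Cons.IH) (auto simp: upd_def le_Suc_eq Suc_le_eq)
    show ?thesis using pw
      by (subst ret_iff, simp add: prog_def wp_simps Some)
         (auto simp: Some intro!: call_ret[OF v] call_ret[OF f[unfolded Some]] call_ret[OF u] call_ret[OF IH, simplified])
  qed
qed

lemma strat_nodes_plan: "set K \<subseteq> set K0 \<Longrightarrow> strat_nodes (plan K0 A K) \<subseteq> set K0"
proof (induction "length A" arbitrary: A K rule: less_induct)
  case less
  show ?case
  proof (cases rule: plan_cases[of K0 A K])
    case (2 e)
    then show ?thesis using less.prems less.hyps[OF length_outer_less, of e K0] less.hyps[OF length_inner_less, of e K0]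
      by auto
  qed simp
qed

text \<open>Every inner node splits \<open>A\<close> into two nonempty parts, so there are at most
  \<open>length A\<close> leaves.\<close>

lemma strat_size_plan: "A \<noteq> [] \<Longrightarrow> Suc (strat_size (plan K0 A K)) \<le> 2 * length A"
proof (induction "length A" arbitrary: A K rule: less_induct)
  case less
  show ?case
  proof (cases rule: plan_cases[of K0 A K])
    case 1
    then show ?thesis using less.prems by (cases A) auto
  next
    case (2 e)
    then show ?thesis using less.hyps[OF length_outer_less, of e K0] less.hyps[OF length_inner_less, of e K0]
      length_inner_outer[of e A]
      by auto
  qed
qed

text \<open>\<open>H\<close> bounds the exponential factor of the brute force search. The constant
  10 pays for calls that return at once; the work of any other call is charged to its candidates,
  each of which is charged at most once per level, and \<open>k\<close> bounds the number of
  levels.\<close>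

lemma spec_solve:
  assumes t: "0 < t" and N: "\<forall>a\<in>set N. length (nd a) < z" "length N < z"
    and H: "\<And>X S. S = seps N X (length X div t + 1) N \<Longrightarrow> (4 * (length S + 1)) ^ length S \<le> H"
  shows "length X < z \<Longrightarrow> ret 15 [enc_nat t, enc_nodes N, enc_list f k, enc_nats X] (enc_opt enc_dtree (solve t N k X))
     (10 + (length k * (3000 * (z^4 * H))) * length X)"
proof (induction k arbitrary: X)
  case Nil
  show ?case by (subst ret_iff) (simp add: prog_def wp_simps)
next
  case (Cons a k)
  define m where "m = length X div t + 1"
  define S where "S = seps N X m N"
  define K where "K = map (\<lambda>s. best X m s N s) S"
  define A where "A = map nv S"
  define p where "p = plan K A K"
  have z: "0 < z" using Cons.prems by simp
  have m: "0 < m" by (simp add: m_def)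
  have mS: "Suc (length X div t) = m" by (simp add: m_def)
  have S: "set S \<subseteq> set N" "length S < z"
    using N(2) by (auto simp: S_def seps_def intro: le_less_trans[OF length_filter_le])
  have K: "set K \<subseteq> set N" "length K < z"
    using set_bests[OF S(1)] S(2) by (auto simp: K_def)
  have A: "length A < z" using S by (simp add: A_def)
  have HS: "(4 * (length K + 1)) ^ length A \<le> H" using H[of S X] by (simp add: K_def A_def S_def m_def)
  then have H1: "1 \<le> H" by (rule order_trans[rotated]) simp
  have l: "ret 4 [enc_nats X] (enc_nat (length X)) (10 * z)"
    by (rule ret_mono[OF spec_length]) (use Cons.prems in auto)
  have d: "ret 5 [enc_nat (length X), enc_nat t] (enc_nat (length X div t)) (15 * z)"
    by (rule ret_mono[OF spec_div[OF t]]) (use Cons.prems in auto)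
  have "(length N + 1) * (300 * z^3) \<le> z * (300 * z^3)" using N by (intro mult_right_mono) auto
  then have s: "ret 8 [enc_nodes N, enc_nodes N, enc_nats X, enc_nat m] (enc_nodes S) (300 * z^4)"
    using ret_mono[OF spec_seps[OF m Cons.prems N subset_refl]] by (simp add: S_def power4_eq_xxxx power3_eq_cube)
  have "(length S + 1) * (320 * z^3) \<le> z * (320 * z^3)" using S by (intro mult_right_mono) auto
  then have b: "ret 11 [enc_nodes S, enc_nodes N, enc_nats X, enc_nat m] (enc_nodes K) (320 * z^4)"
    using ret_mono[OF spec_bests[OF m Cons.prems N S(1)]] by (simp add: K_def power4_eq_xxxx power3_eq_cube)
  have v: "ret 9 [enc_nodes S] (enc_nats A) (15 * z)"
    unfolding A_def by (rule ret_mono[OF spec_map_nv]) (use S in auto)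
  have "(length K + 1) * (400 * z\<^sup>2 * (4 * (length K + 1)) ^ length A) \<le> z * (400 * z\<^sup>2 * H)"
    using HS K by (intro mult_mono) auto
  then have p: "ret 12 [enc_nodes K, enc_nats A, enc_nodes K] (enc_strat p) (400 * (z^3 * H))"
    using ret_mono[OF spec_plan[OF A _ subset_refl]] K N by (force simp: p_def power2_eq_square power3_eq_cube)
  have pn: "strat_nodes p \<subseteq> set N" using strat_nodes_plan[of K K A] K by (auto simp: p_def)
  have ps: "strat_size p \<le> 2 * z" using strat_size_plan[of A K K] A by (cases "A = []") (auto simp: p_def K_def A_def)
  define W where "W = length k * (3000 * (z^4 * H))"
  have "strat_size p * (z * 10 + 400 * z^3) \<le> 2 * z * (z * 10 + 400 * z^3)" using ps by (rule mult_right_mono) simp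
  then have e: "ret 16 [enc_nat t, enc_nodes N, enc_list f k, enc_nats A, enc_strat p, enc_nats X]
     (enc_opt enc_dtree (expand (solve t N k) N A p X)) (2 * z * (z * 10 + 400 * z^3) + W * length X)"
    by (intro ret_mono[OF spec_expand[OF _ N Cons.prems A pn, where B = 10 and W = W]])
       (use Cons.IH in \<open>auto simp: W_def\<close>)
  have so: "solve t N (a # k) X = expand (solve t N k) N A p X" if "X \<noteq> []"
    using that by (simp add: Let_def p_def K_def A_def S_def m_def)
  have pw: "1 \<le> z^4 * H" "z \<le> z^4 * H" "z^2 \<le> z^4 * H" "z^3 * H \<le> z^4 * H" "z^4 \<le> z^4 * H"
    using z H1 power_increasing[of 1 4 z] power_increasing[of 2 4 z] power_increasing[of 3 4 z]
    by (auto simp: Suc_le_eq intro: order_trans[of _ "z^4"])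
  define G where "G = z^4 * H"
  define G3 where "G3 = z^3 * H"
  have tot: "60 + 10 * z + 15 * z + 300 * z^4 + 320 * z^4 + 15 * z + 400 * G3 + 2 * z * (z * 10 + 400 * z^3) \<le> 3000 * G"
  proof -
    have "2 * z * (z * 10 + 400 * z^3) = 20 * z^2 + 800 * z^4"
      by (simp add: power2_eq_square power3_eq_cube power4_eq_xxxx algebra_simps)
    then show ?thesis using pw[folded G_def G3_def] by linarith
  qed
  have X: "3000 * G + W * length X \<le> length (a # k) * (3000 * G) * length X" if "X \<noteq> []"
  proof -
    have "1 \<le> length X" using that by (simp add: Suc_le_eq)
    then have "3000 * G * 1 \<le> 3000 * G * length X" by (rule mult_left_mono) simp
    then show ?thesis by (simp add: W_def G_def algebra_simps)
  qed
  show ?case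
  proof (cases "X = []")
    case True
    then show ?thesis by (subst ret_iff) (simp add: prog_def wp_simps)
  next
    case False
    define T where "T = length (a # k) * (3000 * G) * length X"
    define E where "E = 2 * z * (z * 10 + 400 * z^3)"
    show ?thesis unfolding so[OF False] G_def[symmetric] T_def[symmetric]
      apply (subst ret_iff)
      apply (simp add: prog_def wp_simps False)
      apply (rule call_ret[OF l])
      apply (rule call_ret[OF d])
      apply (simp only: prim_simps mS)
      apply (rule call_ret[OF s])
      apply (rule call_ret[OF b])
      apply (rule call_ret[OF v])
      apply (rule call_ret[OF p[folded G3_def]])
      apply (rule call_ret[OF e[folded E_def]])
      using tot X[OF False, folded T_def] unfolding E_def[symmetric] apply simp
      done
  qed
qed

lemma length_build:
  "\<forall>a\<in>set N. length (nd a) \<le> length N \<Longrightarrow> length (build c es k N) \<le> length N + length k \<and>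
    (\<forall>a\<in>set (build c es k N). length (nd a) \<le> length N + length k)"
proof (induction k arbitrary: N)
  case (Cons x k)
  show ?case
  proof (cases "find_edge c es (map nv N)")
    case (Some e)
    have "length (nd e) = 1" using Some by (induction c es "map nv N" rule: find_edge.induct) (auto split: if_splits)
    then have "\<forall>a\<in>set (e # upd N e). length (nd a) \<le> length (e # upd N e)"
      using Cons.prems by (auto simp: upd_def)
    moreover have "length (upd N e) = length N" by (simp add: upd_def)
    ultimately show ?thesis using Cons.IH[of "e # upd N e"] Some by simp
  qed (use Cons.prems in \<open>auto intro: trans_le_add1\<close>)
qed auto

text \<open>\<open>build\<close> starts with one record and adds at most one per element of
  \<open>vs\<close>, so \<open>z = length vs + 2\<close> exceeds all lengths. Of the exponent 6, the
  work per candidate and level takes 4, and the numbers of levels and of candidates take 1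
  each.\<close>

lemma runs_algo:
  assumes vs: "vs \<noteq> []" and es: "length es \<le> length vs"
    and N: "N = build c es vs [Nd (hd vs) (hd vs) 0 [hd vs]]"
    and t: "t = tloop (length vs) vs 1 0 0 + 2"
    and H: "\<And>X S. S = seps N X (length X div t + 1) N \<Longrightarrow> (4 * (length S + 1)) ^ length S \<le> H"
    and D: "algo c vs es = Some D"
  shows "\<exists>T. runs prog (enc_instance c vs es) (enc_dtree D) T \<and> T \<le> 5000 * (length vs + 2) ^ 6 * H"
proof -
  define z where "z = length vs + 2"
  have z: "0 < z" by (simp add: z_def)
  have hd: "apply_prim Fst_op [enc_nats vs] = enc_nat (hd vs)" using vs by (cases vs) auto
  have b: "ret 21 [enc_nats vs, enc_list (enc_edge c) es, enc_nodes [Nd (hd vs) (hd vs) 0 [hd vs]]]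
     (enc_nodes N) (300 * z^3)"
  proof -
    have "(length vs + 1) * (300 * z\<^sup>2) \<le> z * (300 * z\<^sup>2)" by (intro mult_right_mono) (auto simp: z_def)
    then have "(length vs + 1) * (300 * z\<^sup>2) \<le> 300 * z^3" by (simp add: power2_eq_square power3_eq_cube)
    then show ?thesis unfolding N
      by (intro ret_mono[OF spec_build[of es z "[Nd (hd vs) (hd vs) 0 [hd vs]]" vs enc_nat c]])
         (use es in \<open>simp_all add: z_def\<close>)
  qed
  have l: "ret 4 [enc_nats vs] (enc_nat (length vs)) (10 * z)"
    by (rule ret_mono[OF spec_length]) (simp add: z_def)
  have tl: "ret 18 [enc_nat (length vs), enc_nats vs, VNum 1, VNum 0, VNum 0]
    (enc_nat (tloop (length vs) vs 1 0 0)) (40 * z)"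
    using ret_mono[OF spec_tloop[of "length vs" enc_nat vs 1 0 0]] by (simp add: z_def VNum_0 VNum_1)
  have H1: "1 \<le> H" by (rule order_trans[OF _ H[OF refl, of "[]"]]) simp
  have lN: "length N < z" "\<forall>a\<in>set N. length (nd a) < z"
    using length_build[of "[Nd (hd vs) (hd vs) 0 [hd vs]]" c es vs] by (auto simp: N z_def)
  have "length vs * (3000 * (z ^ 4 * H)) * length vs \<le> z * (3000 * (z ^ 4 * H)) * z"
    by (intro mult_mono) (auto simp: z_def)
  moreover have "z^6 = z^4 * (z * z)" by (simp add: power2_eq_square[symmetric] power_add[symmetric])
  ultimately have "10 + length vs * (3000 * (z ^ 4 * H)) * length vs \<le> 10 + 3000 * (z^6 * H)"
    by (simp add: algebra_simps)
  then have s: "ret 15 [enc_nat t, enc_nodes N, enc_nats vs, enc_nats vs] (enc_dtree D) (10 + 3000 * (z^6 * H))"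
    using ret_mono[OF spec_solve[of t N z H vs enc_nat vs]] lN H D N t by (simp add: z_def algo_def Let_def)
  have pw: "1 \<le> z^6 * H" "z \<le> z^6 * H" "z^3 \<le> z^6 * H"
    using z H1 power_increasing[of 1 6 z] power_increasing[of 3 6 z]
    by (auto simp: Suc_le_eq intro: order_trans[of _ "z^6"])
  define G where "G = z^6 * H"
  have "wp [enc_instance c vs es] (Call 0 [Var 0]) (\<lambda>v T. v = enc_dtree D \<and> T \<le> 5000 * G)"
    apply (simp add: wp_simps call_def[of 0])
    apply (simp add: prog_def)
    apply (simp add: wp_simps enc_instance_def hd)
    apply (rule call_ret[OF b[simplified, unfolded enc_node_def[of "Nd _ _ _ _"], simplified]])
    apply (rule call_ret[OF l])
    apply (rule call_ret[OF tl])
    apply simp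
    apply (rule call_ret[OF s[unfolded t, simplified, folded G_def]])
    using pw[folded G_def] apply simp
    done
  then show ?thesis by (auto simp: wp_def runs_def G_def z_def mult.assoc)
qed

section \<open>The approximation ratio\<close>

text \<open>A value \<open>r\<close> is entered with \<open>j = r\<close> and
  \<open>2 * i = r * (r + 1)\<close> and kept until \<open>j = 0\<close>, where
  \<open>2 * i = r * (r + 3)\<close>. The last assumption ensures that the doubling exceeds
  \<open>n\<close> before the counter runs out.\<close>

lemma tloop_spec:
  assumes "p = 2 ^ i" "2 * i + 2 * j = r * (r + 1) + 2 * r" "j \<le> r" "i = 0 \<or> 2 ^ (i - 1) \<le> n" "n < 2 ^ (i + length k)"
  obtains l where "n < 2 ^ l" "l = 0 \<or> 2 ^ (l - 1) \<le> n"
    "tloop n k p j r * (tloop n k p j r + 1) \<le> 2 * l" "2 * l \<le> tloop n k p j r * (tloop n k p j r + 3)"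
proof -
  have stop: "r * (r + 1) \<le> 2 * i" "2 * i \<le> r * (r + 3)"
    if "2 * i + 2 * j = r * (r + 1) + 2 * r" "j \<le> r" for i j r :: nat
    using that by (auto simp: algebra_simps)
  have "\<exists>l. n < 2 ^ l \<and> (l = 0 \<or> 2 ^ (l - 1) \<le> n) \<and>
    tloop n k p j r * (tloop n k p j r + 1) \<le> 2 * l \<and> 2 * l \<le> tloop n k p j r * (tloop n k p j r + 3)"
    using assms
  proof (induction k arbitrary: p i j r)
    case Nil
    then show ?case using stop[OF Nil(2,3)] by (intro exI[of _ i]) auto
  next
    case (Cons a k)
    show ?case
    proof (cases "n < p")
      case True
      then show ?thesis using stop[OF Cons.prems(2,3)] Cons.prems by (intro exI[of _ i]) auto
    next
      case False
      then have next': "p + p = 2 ^ Suc i" "Suc i = 0 \<or> 2 ^ (Suc i - 1) \<le> n" "n < 2 ^ (Suc i + length k)"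
        using Cons.prems by auto
      show ?thesis
      proof (cases "j = 0")
        case True
        have "2 * Suc i + 2 * Suc r = Suc r * (Suc r + 1) + 2 * Suc r" using Cons.prems(2) True by (simp add: algebra_simps)
        from Cons.IH[OF next'(1) this _ next'(2,3)] show ?thesis using False True by simp
      next
        case j: False
        have "2 * Suc i + 2 * (j - 1) = r * (r + 1) + 2 * r" "j - 1 \<le> r" using Cons.prems(2,3) j by auto
        from Cons.IH[OF next'(1) this next'(2,3)] show ?thesis using False j by simp
      qed
    qed
  qed
  then show thesis using that by blast
qed

lemma tloop_length:
  assumes "0 < length vs"
  obtains l where "length vs < 2 ^ l" "2 ^ l \<le> 2 * length vs"
    "tloop (length vs) vs 1 0 0 * (tloop (length vs) vs 1 0 0 + 1) \<le> 2 * l"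
    "2 * l \<le> tloop (length vs) vs 1 0 0 * (tloop (length vs) vs 1 0 0 + 3)"
proof -
  obtain l where l: "length vs < 2 ^ l" "l = 0 \<or> 2 ^ (l - 1) \<le> length vs"
    "tloop (length vs) vs 1 0 0 * (tloop (length vs) vs 1 0 0 + 1) \<le> 2 * l"
    "2 * l \<le> tloop (length vs) vs 1 0 0 * (tloop (length vs) vs 1 0 0 + 3)"
    by (rule tloop_spec[of 1 0 0 0 "length vs" vs]) (use less_exp[of "length vs"] in auto)
  have "2 ^ l \<le> 2 * length vs" using l(2) assms by (cases l) (auto simp: Suc_le_eq)
  then show thesis using that l by blast
qed

text \<open>Both base and exponent are linear in \<open>q\<close>, and bounding the base by
  \<open>2 ^ (q + 6)\<close> makes the total exponent of 2 quadratic in \<open>q\<close>, hence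
  linear in \<open>l\<close>. As \<open>2 ^ l\<close> is at most \<open>2 * n\<close>, a polynomial
  in \<open>n\<close> results.\<close>

lemma plan_time_le:
  assumes a: "a \<le> 2 * (q + 2)" and l: "q * (q + 1) \<le> 2 * l" "2 ^ l \<le> 2 * (n :: nat)"
  shows "(4 * (a + 1)) ^ a \<le> 2 ^ 24 * (2 * n) ^ 32"
proof -
  have "q + 2 < 2 ^ (q + 2)" by (rule less_exp)
  then have "4 * (a + 1) \<le> 2 ^ (q + 6)" using a by (simp add: power_add)
  then have "(4 * (a + 1)) ^ a \<le> (2 ^ (q + 6)) ^ a" by (rule power_mono) simp
  also have "\<dots> \<le> (2 ^ (q + 6)) ^ (2 * (q + 2))" using a by (intro power_increasing) auto
  also have "\<dots> = 2 ^ ((q + 6) * (2 * (q + 2)))" by (simp only: power_mult)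
  also have "\<dots> \<le> 2 ^ (24 + 32 * l)"
  proof (rule power_increasing)
    have "(q + 6) * (2 * (q + 2)) \<le> 24 + 16 * (q * (q + 1))" by (simp add: algebra_simps)
    then show "(q + 6) * (2 * (q + 2)) \<le> 24 + 32 * l" using l(1) by linarith
  qed simp
  also have "\<dots> = 2 ^ 24 * (2 ^ l) ^ 32" by (simp add: power_add power_mult mult.commute)
  also have "\<dots> \<le> 2 ^ 24 * (2 * n) ^ 32" using l(2) by (intro mult_left_mono power_mono) auto
  finally show ?thesis .
qed

section \<open>Existence of decision trees\<close>

context node_tree
begin

lemma decision_tree_of_sound:
  assumes "sound E c V b (Some T)"
  shows "decision_tree V E T"
  using assms distinct_card[of "leaves T"] by (auto simp: sound_def decision_tree_def)

text \<open>With all costs set to zero, every query has the same cost bound, and repeated queries of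
  all edges at some vertex give a decision tree.\<close>

lemma decision_tree_exists: "\<exists>T. decision_tree V E T"
proof -
  define N0 where "N0 = map (\<lambda>e. Nd (nv e) (np e) 0 (nd e)) N"
  have m: "map nv N0 = map nv N" by (simp add: N0_def)
  then have "nv ` set N0 = V" using nodes by (metis tree_nodes_def set_map)
  moreover have "distinct (map nv N0)" using m distinct_nodes by simp
  moreover have "\<forall>e\<in>set N0. set (nd e) = D (nv e) \<and>
      (if nv e = r then np e = r \<and> nc e = 0 else np e = par (nv e) \<and> nc e = 0)"
    using node(2,3,4) by (auto simp: N0_def)
  ultimately have "tree_nodes N0 V r par D (\<lambda>_. 0)" unfolding tree_nodes_def by blast
  then interpret Z: node_tree V r par D dep E N0 "\<lambda>_. 0"
    by unfold_locales auto
  have star0: "star_cost s L = 0" if "set L \<subseteq> set N0" for s L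
    using that by (induction L) (auto simp: star_cost_def N0_def)
  have "\<exists>R. sound E (\<lambda>_. 0) (set X) 0 R" if "set X \<subseteq> V" "distinct X" for X
    using that
  proof (induction "length X" arbitrary: X rule: less_induct)
    case less
    show ?case
    proof (cases X)
      case Nil
      then show ?thesis by (intro exI[of _ None]) (simp add: sound_def)
    next
      case (Cons s X')
      define F where "F Y = (SOME R. sound E (\<lambda>_. 0) (set Y) 0 R)" for Y
      have F: "sound E (\<lambda>_. 0) (set Y) 0 (F Y)" if "length Y < length X" "set Y \<subseteq> V" "distinct Y" for Y
        unfolding F_def by (rule someI_ex) (rule less.hyps[OF that])
      have s: "s \<in> V" "s \<in> set X" using less.prems Cons by auto
      have shorter: "length (filter P X) < length X" if "\<not> P s" for P
        using that s(2) by (rule length_filter_less[rotated])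
      have "sound E (\<lambda>_. 0) (set X) (star_cost s N0 + 0) (star F s N0 X)"
      proof (rule Z.sound_star[OF F])
        show "set X \<subseteq> V" "distinct X" by fact+
        show "\<forall>e\<in>set N0. nv e = s \<longrightarrow> length (outer e X) < length X"
          using Z.node(1,2) D_refl by (auto intro!: shorter)
        show "\<forall>e\<in>set N0. nv e \<noteq> s \<and> np e = s \<longrightarrow> length (inner e X) < length X"
        proof (intro ballI impI shorter)
          fix e assume e: "e \<in> set N0" "nv e \<noteq> s \<and> np e = s"
          then have "nv e \<noteq> r" using Z.node(3)[OF e(1)] by auto
          then show "s \<notin> set (nd e)" using Z.node[OF e(1)] par_notin_D e(2) by auto
        qed
        show "\<forall>x\<in>set X. x = s \<or> (\<exists>e\<in>set N0. nv e = s \<and> x \<notin> set (nd e) \<or> nv e \<noteq> s \<and> np e = s \<and> x \<in> set (nd e))"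
          using Z.incident_separates[OF s(1)] by blast
      qed auto
      then show ?thesis using star0[OF subset_refl] by auto
    qed
  qed
  moreover obtain X where "set X = V" "distinct X" using finite_distinct_list[OF finite_V] by auto
  ultimately obtain R where "sound E (\<lambda>_. 0) V 0 R" by auto
  moreover from this root_in obtain T where "R = Some T" by (cases R) (auto simp: sound_def)
  ultimately show ?thesis using Z.decision_tree_of_sound by auto
qed

end

text \<open>From \<open>log 2 n < t\<^sup>2\<close>, log t is at least half of log log n, so
  \<open>i\<close> is at most 2 log n / log log n. The additional phase is at most the same
  quantity, and the factor 2 per phase turns the sum into 8.\<close>

lemma approximation_ratio:
  fixes n t i :: nat
  assumes L: "log 2 (log 2 n) > 0" and t: "log 2 n < t\<^sup>2" and i: "t ^ i \<le> n"
  shows "2 * real (Suc i) \<le> 8 * (log 2 n / log 2 (log 2 n))"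
proof -
  have n: "0 < n" using L by (cases n) (auto simp: log_def)
  have "0 \<le> log 2 n" using n by simp
  moreover have "log 2 n \<noteq> 0" using L by (auto simp: log_def)
  ultimately have L0: "0 < log 2 n" by linarith
  then have L1: "1 < log 2 n" using L by simp
  have t0: "0 < real t" using t L0 by (cases t) auto
  have "log 2 (log 2 n) \<le> log 2 (real t ^ 2)" using t L0 by (intro log_mono) auto
  also have "\<dots> = 2 * log 2 t" using t0 by (simp add: log_nat_power)
  finally have half: "log 2 (log 2 n) / 2 \<le> log 2 t" by simp
  have "i * (log 2 (log 2 n) / 2) \<le> i * log 2 t" using half by (intro mult_left_mono) auto
  also have "\<dots> = log 2 (real t ^ i)" using t0 by (simp add: log_nat_power)
  also have "\<dots> \<le> log 2 n"
  proof -
    have "real t ^ i \<le> real n" using i by (metis of_nat_le_iff of_nat_power)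
    then show ?thesis using t0 n by simp
  qed
  finally have "real i \<le> 2 * (log 2 n / log 2 (log 2 n))" using L by (simp add: field_simps)
  \<comment> \<open>For y = log n, log y is at most 2 y, because ln y is at most y and ln 2 is at
    least 1/2.\<close>
  moreover have "1 \<le> 2 * (log 2 n / log 2 (log 2 n))"
  proof -
    have "ln (1 / 2 :: real) \<le> 1 / 2 - 1" by (rule ln_le_minus_one) simp
    then have ln2: "1 / 2 \<le> ln (2 :: real)" by (simp add: ln_div)
    have "ln (log 2 n) \<le> log 2 n" using ln_le_minus_one[OF L0] by simp
    moreover have "log 2 n * 1 \<le> log 2 n * (2 * ln 2)" using ln2 L0 by (intro mult_left_mono) auto
    ultimately have "ln (log 2 n) \<le> 2 * log 2 n * ln 2" by simp
    moreover have "ln (log 2 n) = log 2 (log 2 n) * ln 2" by (simp add: log_def)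
    ultimately have "log 2 (log 2 n) \<le> 2 * log 2 n" by simp
    then show ?thesis using L by simp
  qed
  ultimately show ?thesis by simp
qed

text \<open>The bound of \<open>runs_algo\<close> with \<open>H\<close> taken from
  \<open>plan_time_le\<close>.\<close>

definition time_poly :: "nat poly" where
  "time_poly = smult (5000 * 2 ^ 24 * 2 ^ 32) ([:2, 1:] ^ 6 * [:0, 1:] ^ 32)"

lemma poly_time_poly: "poly time_poly n = 5000 * (n + 2) ^ 6 * (2 ^ 24 * (2 * n) ^ 32)"
proof -
  have "poly time_poly n = 5000 * 2 ^ 24 * 2 ^ 32 * ((2 + n) ^ 6 * n ^ 32)"
    by (simp only: time_poly_def poly_smult poly_mult poly_power poly_pCons poly_0) simp
  then show ?thesis unfolding power_mult_distrib[of 2 n] by (simp only: mult.assoc mult.left_commute mult.commute add.commute)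
qed

lemma algo_correct:
  fixes V :: "nat set" and c :: "nat set \<Rightarrow> rat"
  assumes tree: "is_tree V E" and c: "\<forall>e\<in>E. 0 \<le> c e" and en: "enumerates vs es V E"
  shows "\<exists>D t. runs prog (enc_instance c vs es) (enc_dtree D) t \<and> t \<le> poly time_poly (card V) \<and>
    decision_tree V E D \<and> (0 < log 2 (log 2 (real (card V))) \<longrightarrow> real_of_rat (cost V c D)
        \<le> 8 * (log 2 (real (card V)) / log 2 (log 2 (real (card V)))) * real_of_rat (OPT V E c))"
proof -
  define N where "N = build c es vs [Nd (hd vs) (hd vs) 0 [hd vs]]"
  obtain par D dep where g: "rtree_graph V (hd vs) par D dep E" "tree_nodes N V (hd vs) par D c"
    using build_tree[OF tree en] unfolding N_def by blast
  then interpret node_tree V "hd vs" par D dep E N c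
    using c by (intro node_tree.intro node_tree_axioms.intro) auto
  have vs: "set vs = V" "distinct vs" using en by (auto simp: enumerates_def)
  have ne: "vs \<noteq> []" using vs root_in by auto
  define n where "n = length vs"
  have n: "card V = n" "0 < n" using vs distinct_card ne by (auto simp: n_def)
  have "length es = card E" using en distinct_card by (fastforce simp: enumerates_def)
  also have "card E \<le> card (V - {hd vs})" unfolding edges by (rule card_image_le) (use finite_V in simp)
  also have "\<dots> \<le> n" using card_mono[OF finite_V, of "V - {hd vs}"] n by auto
  finally have es: "length es \<le> n" .
  define q where "q = tloop n vs 1 0 0"
  obtain l where l: "n < 2 ^ l" "2 ^ l \<le> 2 * n" "q * (q + 1) \<le> 2 * l" "2 * l \<le> q * (q + 3)"
    using tloop_length[of vs] n(2) unfolding q_def n_def by blast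
  define t where "t = q + 2"
  have t: "2 \<le> t" by (simp add: t_def)

  have fin: "finite {T. decision_tree V E T}"
    using tree finite_decision_trees by (auto simp: is_tree_def)
  then have "OPT V E c \<in> cost V c ` {T. decision_tree V E T}"
    unfolding OPT_def using decision_tree_exists by (intro Min_in) auto
  then obtain T where T: "decision_tree V E T" "OPT V E c = cost V c T" by auto
  have opt: "path_cost E c T x \<le> OPT V E c" if "x \<in> V" for x
  proof -
    have "path_cost E c T x = leaf_cost c T x"
      using T(1) that by (intro leaf_cost_eq_path_cost[symmetric]) (auto simp: decision_tree_def)
    then show ?thesis unfolding T(2) cost_def using finite_V that by (intro Max_ge) auto
  qed

  have nt: "n < t ^ n" by (rule less_le_trans[OF less_exp power_mono[OF t]]) simp
  \<comment> \<open>\<open>j\<close> is the least sufficient number of phases: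
    \<open>j \<le> n\<close> lets the counter \<open>vs\<close> suffice, and minimality gives
    \<open>t ^ i \<le> n\<close>, which the ratio requires.\<close>
  define j where "j = (LEAST j. n < t ^ j)"
  have j: "n < t ^ j" "j \<le> n" unfolding j_def using nt by (rule LeastI, rule Least_le)
  obtain i where i: "j = Suc i" using j(1) n(2) by (cases j) auto
  have ti: "t ^ i \<le> n" using not_less_Least[of i "\<lambda>j. n < t ^ j"] i by (simp add: j_def)
  have alg: "algo c vs es = solve t N vs vs"
    by (simp add: algo_def Let_def N_def t_def q_def n_def)
  have "sound E c (set vs) (2 * of_nat j * OPT V E c) (solve t N vs vs)"
    using sound_solve[OF T(1) opt t, of vs j vs] j vs n_def by simp
  then obtain R where R: "algo c vs es = Some R" "sound E c V (2 * of_nat j * OPT V E c) (Some R)"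
    using vs root_in alg by (cases "solve t N vs vs") (auto simp: sound_def)
  have dt: "decision_tree V E R" using decision_tree_of_sound[OF R(2)] .
  have "(4 * (length S + 1)) ^ length S \<le> 2 ^ 24 * (2 * n) ^ 32"
    if "S = seps N X (length X div t + 1) N" for X S
    using length_seps_le[of t X] t that by (intro plan_time_le[OF _ l(3,2)]) (auto simp: t_def)
  then obtain s where s: "runs prog (enc_instance c vs es) (enc_dtree R) s"
    "s \<le> 5000 * (n + 2) ^ 6 * (2 ^ 24 * (2 * n) ^ 32)"
    using runs_algo[OF ne _ N_def _ _ R(1), of t "2 ^ 24 * (2 * n) ^ 32"] es
    unfolding n_def t_def q_def by blast
  have pol: "s \<le> poly time_poly (card V)"
    using s(2) by (simp only: poly_time_poly n(1))
  have cost: "cost V c R \<le> 2 * of_nat j * OPT V E c"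
  proof -
    have "leaf_cost c R x \<le> 2 * of_nat j * OPT V E c" if "x \<in> V" for x
    proof -
      have "leaf_cost c R x = path_cost E c R x"
        using dt that by (intro leaf_cost_eq_path_cost) (auto simp: decision_tree_def)
      then show ?thesis using R(2) that by (auto simp: sound_def)
    qed
    then show ?thesis unfolding cost_def using finite_V root_in by (intro Max.boundedI) auto
  qed
  have ratio: "real_of_rat (cost V c R) \<le> 8 * (log 2 (real (card V)) / log 2 (log 2 (real (card V)))) * real_of_rat (OPT V E c)"
    if L: "log 2 (log 2 (real (card V))) > 0"
  proof -
    have opt0: "0 \<le> OPT V E c"
    proof -
      have "0 \<le> path_cost E c U x" if "\<forall>(u, v)\<in>node_labels U. {u, v} \<in> E" for U :: "nat dtree" and x
        using that c by (induction U) auto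
      then have "0 \<le> path_cost E c T (hd vs)" using T(1) by (simp add: decision_tree_def)
      then show ?thesis using opt[OF root_in] by linarith
    qed
    have "real n < 2 ^ l" using l(1) by (metis of_nat_less_iff of_nat_numeral of_nat_power)
    then have "log 2 n < l" using n(2) by (simp add: log_less_iff powr_realpow)
    also have "l \<le> t\<^sup>2" using l(4) by (simp add: t_def power2_eq_square algebra_simps)
    finally have "2 * real j \<le> 8 * (log 2 n / log 2 (log 2 n))"
      using approximation_ratio[of n t i] L ti n(1) i by simp
    moreover have "real_of_rat (cost V c R) \<le> 2 * real j * real_of_rat (OPT V E c)"
    proof -
      have "real_of_rat (cost V c R) \<le> real_of_rat (2 * of_nat j * OPT V E c)" using cost by (simp only: of_rat_less_eq)
      then show ?thesis by (simp add: of_rat_mult)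
    qed
    moreover have "2 * real j * real_of_rat (OPT V E c) \<le> 8 * (log 2 n / log 2 (log 2 n)) * real_of_rat (OPT V E c)"
      using calculation(1) opt0 by (intro mult_right_mono) auto
    ultimately show ?thesis using n(1) by simp
  qed
  show ?thesis using s(1) pol dt ratio by blast
qed

theorem theorem1:
  shows "\<exists>(C :: real) (P :: prog) (p :: nat poly). C > 0 \<and>
    (\<forall>(V :: nat set) (E :: nat set set) (c :: nat set \<Rightarrow> rat) (vs :: nat list) (es :: (nat \<times> nat) list).
      is_tree V E \<and> (\<forall>e\<in>E. c e \<ge> 0) \<and> enumerates vs es V E \<longrightarrow>
      (\<exists>(D :: nat dtree) (t :: nat).
        runs P (enc_instance c vs es) (enc_dtree D) t \<and>
        t \<le> poly p (card V) \<and>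
        decision_tree V E D \<and>
        (log 2 (log 2 (real (card V))) > 0 \<longrightarrow>
          real_of_rat (cost V c D) \<le>
            C * (log 2 (real (card V)) / log 2 (log 2 (real (card V)))) *
            real_of_rat (OPT V E c))))"
  by (intro exI[of _ 8] exI[of _ prog] exI[of _ time_poly]) (use algo_correct in simp)

end
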